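(* Let $k_1,k_2,k_3>0$ and $K=\begin{bmatrix} I & 0 \\ 0 & k_2I \end{bmatrix}\in\mathbb R^{6\times6}$. Consider a rigid body with configuration $g\in SE(3)$ and velocity $\xi\in\mathbb R^6$ satisfying $\dot g=g\xi^\vee$, $\mathbb I\dot\xi=\mathrm{ad}^*_\xi\mathbb I\xi+\varphi$, where $g$, $\xi$ and the applied torques and forces $\varphi\in\mathbb R^6$ are measured. Let $(\hat g,\hat\xi)$ be estimates of $(g,\xi)$ and put $\tilde g=\hat g^{-1}g$, $\tilde\eta^\vee=\mathrm{logm}_{SE(3)}(\tilde g)$, $\breve\xi=\mathrm{Ad}_{\tilde g^{-1}}\hat\xi$, $\tilde\xi=\xi-\breve\xi$, $u=k_1\tilde\eta+\tilde\xi$. Consider the observer $$\dot{\hat g}=\hat g\,\hat\xi^\vee,\qquad \mathbb I\dot{\breve\xi}=\mathrm{ad}^*_{-K(k_1\tilde\eta-\breve\xi)}\,\mathbb I\xi+\varphi+k_1\mathbb I\,G(\tilde\eta)\tilde\xi+G^T(K\tilde\eta)\tilde\eta+k_3u.$$ Then the point $(\tilde\eta,\tilde\xi)=(0,0)$ is asymptotically stable in the sense of Lyapunov for the estimation error dynamics.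
   Context: For $a\in\mathbb R^3$, $a^\times$ is the skew-symmetric matrix with $a^\times c=a\times c$. For $\zeta=[w^T, u^T]^T\in\mathbb R^6$: $\zeta^\vee=\begin{bmatrix} w^\times & u \\ 0 & 0 \end{bmatrix}$, $\mathrm{ad}_\zeta=\begin{bmatrix} w^\times & 0 \\ {u}^\times & w^\times \end{bmatrix}$, $\mathrm{ad}^*_\zeta=(\mathrm{ad}_\zeta)^T$. For $g=\begin{bmatrix} R & b \\ 0 & 1 \end{bmatrix}\in SE(3)$, $\mathrm{Ad}_g=\begin{bmatrix} R & 0 \\ {b}^\times R & R \end{bmatrix}$. $\mathbb I=\begin{bmatrix} J & 0 \\ 0 & mI \end{bmatrix}$, with $m>0$ the mass and $J$ the symmetric positive definite inertia matrix. $\mathrm{logm}_{SE(3)}$ is the logarithm on $SE(3)$; the exponential coordinates are defined when the principal rotation angle is less than $\pi$. For $\eta=[\Theta^T, \beta^T]^T$ with $\theta=\|\Theta\|$, $G(\eta)=\begin{bmatrix} A(\Theta) & 0 \\ {T}(\Theta,\beta) & A(\Theta) \end{bmatrix}$ is the matrix with $\dot{\tilde\eta}=G(\tilde\eta)\tilde\xi$, where (removable singularity at $\theta=0$ filled in by continuity) $$A(\Theta)=I+\tfrac12\Theta^\times+\Big(\tfrac1{\theta^2}-\tfrac{1+\cos\theta}{2\theta\sin\theta}\Big)(\Theta^\times)^2,\qquad S(\Theta)=I+\tfrac{1-\cos\theta}{\theta^2}\Theta^\times+\tfrac{\theta-\sin\theta}{\theta^3}(\Theta^\times)^2,$$ $$T(\Theta,\beta)=\tfrac12(S(\Theta)\beta)^\times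 A(\Theta)+\Big(\tfrac1{\theta^2}-\tfrac{1+\cos\theta}{2\theta\sin\theta}\Big)\big[\Theta\beta^T+(\Theta^T\beta)A(\Theta)\big]-\tfrac{(1+\cos\theta)(\theta-\sin\theta)}{2\theta\sin^2\theta}S(\Theta)\beta\Theta^T+\Big(\tfrac{(1+\cos\theta)(\theta+\sin\theta)}{2\theta^3\sin^2\theta}-\tfrac2{\theta^4}\Big)(\Theta^T\beta)\Theta\Theta^T.$$ *)

theory Defs
  imports "HOL-Analysis.Analysis" "HOL-Real_Asymp.Real_Asymp"
begin

section \<open>Block vectors and matrices\<close>

text \<open>
  The space R^6 is \<^typ>\<open>real^(3 + 3)\<close>, indexed by the disjoint sum of two copies of a
  three-element type, so that the split into two blocks is part of the index type. Homogeneous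
  4x4 matrices are \<^typ>\<open>real^(3 + 1)^(3 + 1)\<close>.
\<close>

definition fst_block :: "real^('a::finite + 'b::finite) \<Rightarrow> real^'a" where
  "fst_block x = (\<chi> i. x $ Inl i)"

definition snd_block :: "real^('a::finite + 'b::finite) \<Rightarrow> real^'b" where
  "snd_block x = (\<chi> i. x $ Inr i)"

definition block_mat ::
  "real^'c::finite^'a::finite \<Rightarrow> real^'d::finite^'a \<Rightarrow> real^'c^'b::finite \<Rightarrow> real^'d^'b
    \<Rightarrow> real^('c + 'd)^('a + 'b)" where
  "block_mat A B C D = (\<chi> i j.
     case i of
       Inl p \<Rightarrow> (case j of Inl q \<Rightarrow> A $ p $ q | Inr q \<Rightarrow> B $ p $ q)
     | Inr p \<Rightarrow> (case j of Inl q \<Rightarrow> C $ p $ q | Inr q \<Rightarrow> D $ p $ q))"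

definition outer_prod :: "real^'n \<Rightarrow> real^'m \<Rightarrow> real^'m^'n" where
  "outer_prod a b = (\<chi> i j. a $ i * b $ j)"


section \<open>The group SE(3) and its Lie algebra\<close>

definition skew :: "real^3 \<Rightarrow> real^3^3" where
  "skew a = matrix (cross3 a)"

definition hat :: "real^(3 + 3) \<Rightarrow> real^(3 + 1)^(3 + 1)" where
  "hat \<zeta> = block_mat (skew (fst_block \<zeta>)) (columnvector (snd_block \<zeta>)) 0 0"

definition ad :: "real^(3 + 3) \<Rightarrow> real^(3 + 3)^(3 + 3)" where
  "ad \<zeta> = block_mat (skew (fst_block \<zeta>)) 0 (skew (snd_block \<zeta>)) (skew (fst_block \<zeta>))"

definition ad_star :: "real^(3 + 3) \<Rightarrow> real^(3 + 3)^(3 + 3)" where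
  "ad_star \<zeta> = transpose (ad \<zeta>)"

definition pose :: "real^3^3 \<Rightarrow> real^3 \<Rightarrow> real^(3 + 1)^(3 + 1)" where
  "pose R b = block_mat R (columnvector b) 0 (mat 1)"

definition SE3 :: "(real^(3 + 1)^(3 + 1)) set" where
  "SE3 = {pose R b | R b. rotation_matrix R}"

definition rot_part :: "real^(3 + 1)^(3 + 1) \<Rightarrow> real^3^3" where
  "rot_part g = (\<chi> i j. g $ Inl i $ Inl j)"

definition pos_part :: "real^(3 + 1)^(3 + 1) \<Rightarrow> real^3" where
  "pos_part g = (\<chi> i. g $ Inl i $ Inr 1)"

definition Ad :: "real^(3 + 1)^(3 + 1) \<Rightarrow> real^(3 + 3)^(3 + 3)" where
  "Ad g = block_mat (rot_part g) 0 (skew (pos_part g) ** rot_part g) (rot_part g)"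


section \<open>Exponential coordinates\<close>

definition mat_exp :: "real^'n^'n \<Rightarrow> real^'n^'n" where
  "mat_exp M = (\<Sum>n. (1 / fact n) *\<^sub>R (((\<lambda>N. M ** N) ^^ n) (mat 1)))"

definition principal_angle :: "real^3^3 \<Rightarrow> real" where
  "principal_angle R = arccos ((trace R - 1) / 2)"

text \<open>
  The principal logarithm on SE(3). It is meaningful only for poses whose rotation part has
  principal angle less than pi; \<open>observer_solution\<close> below imposes this on every trajectory.
\<close>

definition logm_SE3 :: "real^(3 + 1)^(3 + 1) \<Rightarrow> real^(3 + 1)^(3 + 1)" where
  "logm_SE3 g = (THE X. X \<in> hat ` {\<eta>. norm (fst_block \<eta>) < pi} \<and> mat_exp X = g)"

definition exp_coords :: "real^(3 + 1)^(3 + 1) \<Rightarrow> real^(3 + 3)" where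
  "exp_coords g = (THE \<eta>. hat \<eta> = logm_SE3 g)"


section \<open>The kinematic matrix of the exponential coordinates\<close>

text \<open>
  The scalar coefficients, with the removable singularity at 0 filled in. The continuity lemmas
  confirm that the values chosen at 0 are the limits.
\<close>

definition coef_A :: "real \<Rightarrow> real" where
  "coef_A \<theta> = (if \<theta> = 0 then 1/12 else 1 / \<theta>\<^sup>2 - (1 + cos \<theta>) / (2 * \<theta> * sin \<theta>))"

definition coef_S1 :: "real \<Rightarrow> real" where
  "coef_S1 \<theta> = (if \<theta> = 0 then 1/2 else (1 - cos \<theta>) / \<theta>\<^sup>2)"

definition coef_S2 :: "real \<Rightarrow> real" where
  "coef_S2 \<theta> = (if \<theta> = 0 then 1/6 else (\<theta> - sin \<theta>) / \<theta>^3)"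

definition coef_T1 :: "real \<Rightarrow> real" where
  "coef_T1 \<theta> = (if \<theta> = 0 then 1/6
     else (1 + cos \<theta>) * (\<theta> - sin \<theta>) / (2 * \<theta> * (sin \<theta>)\<^sup>2))"

definition coef_T2 :: "real \<Rightarrow> real" where
  "coef_T2 \<theta> = (if \<theta> = 0 then 1/360
     else (1 + cos \<theta>) * (\<theta> + sin \<theta>) / (2 * \<theta>^3 * (sin \<theta>)\<^sup>2) - 2 / \<theta>^4)"

lemma filled_isCont:
  assumes "((f :: real \<Rightarrow> real) \<longlongrightarrow> c) (at 0)"
  shows "isCont (\<lambda>x. if x = 0 then c else f x) 0"
proof -
  have "((\<lambda>x. if x = 0 then c else f x) \<longlongrightarrow> c) (at 0)"
    by (rule Lim_transform_eventually[OF assms]) (auto simp: eventually_at_filter)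
  then show ?thesis by (simp add: isCont_def)
qed

lemma coef_A_isCont: "isCont coef_A 0"
  unfolding coef_A_def by (rule filled_isCont) real_asymp

lemma coef_S1_isCont: "isCont coef_S1 0"
  unfolding coef_S1_def by (rule filled_isCont) real_asymp

lemma coef_S2_isCont: "isCont coef_S2 0"
  unfolding coef_S2_def by (rule filled_isCont) real_asymp

lemma coef_T1_isCont: "isCont coef_T1 0"
  unfolding coef_T1_def by (rule filled_isCont) real_asymp

lemma coef_T2_isCont: "isCont coef_T2 0"
  unfolding coef_T2_def by (rule filled_isCont) real_asymp

definition A_mat :: "real^3 \<Rightarrow> real^3^3" where
  "A_mat \<Theta> = mat 1 + (1/2) *\<^sub>R skew \<Theta> + coef_A (norm \<Theta>) *\<^sub>R (skew \<Theta> ** skew \<Theta>)"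

definition S_mat :: "real^3 \<Rightarrow> real^3^3" where
  "S_mat \<Theta> = mat 1 + coef_S1 (norm \<Theta>) *\<^sub>R skew \<Theta> + coef_S2 (norm \<Theta>) *\<^sub>R (skew \<Theta> ** skew \<Theta>)"

definition T_mat :: "real^3 \<Rightarrow> real^3 \<Rightarrow> real^3^3" where
  "T_mat \<Theta> \<beta> =
     (1/2) *\<^sub>R (skew (S_mat \<Theta> *v \<beta>) ** A_mat \<Theta>)
     + coef_A (norm \<Theta>) *\<^sub>R (outer_prod \<Theta> \<beta> + (\<Theta> \<bullet> \<beta>) *\<^sub>R A_mat \<Theta>)
     - coef_T1 (norm \<Theta>) *\<^sub>R outer_prod (S_mat \<Theta> *v \<beta>) \<Theta>
     + (coef_T2 (norm \<Theta>) * (\<Theta> \<bullet> \<beta>)) *\<^sub>R outer_prod \<Theta> \<Theta>"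

definition G_mat :: "real^(3 + 3) \<Rightarrow> real^(3 + 3)^(3 + 3)" where
  "G_mat \<eta> = block_mat (A_mat (fst_block \<eta>)) 0
                       (T_mat (fst_block \<eta>) (snd_block \<eta>)) (A_mat (fst_block \<eta>))"


section \<open>Rigid body and observer\<close>

definition inertia :: "real^3^3 \<Rightarrow> real \<Rightarrow> real^(3 + 3)^(3 + 3)" where
  "inertia J m = block_mat J 0 0 (mat m)"

definition gain_K :: "real \<Rightarrow> real^(3 + 3)^(3 + 3)" where
  "gain_K k2 = block_mat (mat 1) 0 0 (mat k2)"

definition rigid_body_motion ::
  "real^3^3 \<Rightarrow> real \<Rightarrow> (real \<Rightarrow> real^(3 + 1)^(3 + 1)) \<Rightarrow> (real \<Rightarrow> real^(3 + 3)) \<Rightarrow> (real \<Rightarrow> real^(3 + 3))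
    \<Rightarrow> bool" where
  "rigid_body_motion J m g \<xi> \<phi> \<longleftrightarrow>
     (\<forall>t\<ge>0. g t \<in> SE3 \<and>
        (g has_vector_derivative (g t ** hat (\<xi> t))) (at t within {0..}) \<and>
        (\<exists>d. (\<xi> has_vector_derivative d) (at t within {0..}) \<and>
             inertia J m *v d = ad_star (\<xi> t) *v (inertia J m *v \<xi> t) + \<phi> t))"

text \<open>
  The error quantities, as functions of the estimate \<open>gh\<close>, \<open>\<xi>h\<close> (hats in the usual notation)
  and the measured \<open>g\<close>, \<open>\<xi>\<close>.
\<close>

definition pose_err :: "real^(3 + 1)^(3 + 1) \<Rightarrow> real^(3 + 1)^(3 + 1) \<Rightarrow> real^(3 + 1)^(3 + 1)" where
  "pose_err gh g = matrix_inv gh ** g"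

definition eta_err :: "real^(3 + 1)^(3 + 1) \<Rightarrow> real^(3 + 1)^(3 + 1) \<Rightarrow> real^(3 + 3)" where
  "eta_err gh g = exp_coords (pose_err gh g)"

definition xi_breve ::
  "real^(3 + 1)^(3 + 1) \<Rightarrow> real^(3 + 1)^(3 + 1) \<Rightarrow> real^(3 + 3) \<Rightarrow> real^(3 + 3)" where
  "xi_breve gh g \<xi>h = Ad (matrix_inv (pose_err gh g)) *v \<xi>h"

definition xi_err ::
  "real^(3 + 1)^(3 + 1) \<Rightarrow> real^(3 + 1)^(3 + 1) \<Rightarrow> real^(3 + 3) \<Rightarrow> real^(3 + 3) \<Rightarrow> real^(3 + 3)" where
  "xi_err gh g \<xi>h \<xi> = \<xi> - xi_breve gh g \<xi>h"

definition observer_rhs ::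
  "real^3^3 \<Rightarrow> real \<Rightarrow> real \<Rightarrow> real \<Rightarrow> real
    \<Rightarrow> real^(3 + 1)^(3 + 1) \<Rightarrow> real^(3 + 3) \<Rightarrow> real^(3 + 3)
    \<Rightarrow> real^(3 + 1)^(3 + 1) \<Rightarrow> real^(3 + 3) \<Rightarrow> real^(3 + 3)" where
  "observer_rhs J m k1 k2 k3 g \<xi> \<phi> gh \<xi>h =
     (let \<eta> = eta_err gh g;
          \<xi>b = xi_breve gh g \<xi>h;
          \<xi>e = xi_err gh g \<xi>h \<xi>;
          u = k1 *\<^sub>R \<eta> + \<xi>e;
          K = gain_K k2
      in ad_star (- (K *v (k1 *\<^sub>R \<eta> - \<xi>b))) *v (inertia J m *v \<xi>)
         + \<phi>
         + k1 *\<^sub>R (inertia J m *v (G_mat \<eta> *v \<xi>e))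
         + transpose (G_mat (K *v \<eta>)) *v \<eta>
         + k3 *\<^sub>R u)"

definition observer_solution ::
  "real^3^3 \<Rightarrow> real \<Rightarrow> real \<Rightarrow> real \<Rightarrow> real
    \<Rightarrow> (real \<Rightarrow> real^(3 + 1)^(3 + 1)) \<Rightarrow> (real \<Rightarrow> real^(3 + 3)) \<Rightarrow> (real \<Rightarrow> real^(3 + 3))
    \<Rightarrow> real set \<Rightarrow> (real \<Rightarrow> real^(3 + 1)^(3 + 1)) \<Rightarrow> (real \<Rightarrow> real^(3 + 3)) \<Rightarrow> bool" where
  "observer_solution J m k1 k2 k3 g \<xi> \<phi> I gh \<xi>h \<longleftrightarrow>
     (\<forall>t\<in>I. gh t \<in> SE3 \<and>
        principal_angle (rot_part (pose_err (gh t) (g t))) < pi \<and>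
        (gh has_vector_derivative (gh t ** hat (\<xi>h t))) (at t within I) \<and>
        (\<exists>d. ((\<lambda>s. xi_breve (gh s) (g s) (\<xi>h s)) has_vector_derivative d) (at t within I) \<and>
             inertia J m *v d = observer_rhs J m k1 k2 k3 (g t) (\<xi> t) (\<phi> t) (gh t) (\<xi>h t)))"

text \<open>
  The trajectories of the estimation error dynamics along a given motion of the rigid body.
\<close>

definition error_trajectory ::
  "real^3^3 \<Rightarrow> real \<Rightarrow> real \<Rightarrow> real \<Rightarrow> real
    \<Rightarrow> (real \<Rightarrow> real^(3 + 1)^(3 + 1)) \<Rightarrow> (real \<Rightarrow> real^(3 + 3)) \<Rightarrow> (real \<Rightarrow> real^(3 + 3))
    \<Rightarrow> real set \<Rightarrow> (real \<Rightarrow> (real^(3 + 3)) \<times> (real^(3 + 3))) \<Rightarrow> bool" where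
  "error_trajectory J m k1 k2 k3 g \<xi> \<phi> I x \<longleftrightarrow>
     (\<exists>gh \<xi>h. observer_solution J m k1 k2 k3 g \<xi> \<phi> I gh \<xi>h \<and>
        (\<forall>t\<in>I. x t = (eta_err (gh t) (g t), xi_err (gh t) (g t) (\<xi>h t) (\<xi> t))))"


section \<open>Asymptotic stability in the sense of Lyapunov\<close>

text \<open>
  A time-varying system is given by the predicate \<open>traj I x\<close>: the curve \<open>x\<close> is a
  trajectory on the time interval \<open>I\<close>. As usual for time-varying systems, the radii may depend on
  the initial time. Stability bounds also trajectories that are only defined on a bounded interval.
  Attractivity comprises the existence, for all future time, of a trajectory from every initial
  state near the point.
\<close>

definition forward_intervals :: "real \<Rightarrow> real set set" where
  "forward_intervals t0 = insert {t0..} {{t0..<T} | T. t0 < T}"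

definition lyapunov_stable ::
  "(real set \<Rightarrow> (real \<Rightarrow> 'a::metric_space) \<Rightarrow> bool) \<Rightarrow> 'a \<Rightarrow> bool" where
  "lyapunov_stable traj p \<longleftrightarrow>
     (\<forall>t0\<ge>0. \<forall>\<epsilon>>0. \<exists>\<delta>>0. \<forall>I\<in>forward_intervals t0. \<forall>x.
        traj I x \<and> dist (x t0) p < \<delta> \<longrightarrow> (\<forall>t\<in>I. dist (x t) p < \<epsilon>))"

definition attractive ::
  "(real set \<Rightarrow> (real \<Rightarrow> 'a::metric_space) \<Rightarrow> bool) \<Rightarrow> 'a \<Rightarrow> bool" where
  "attractive traj p \<longleftrightarrow>
     (\<forall>t0\<ge>0. \<exists>\<delta>>0.
        (\<forall>x0. dist x0 p < \<delta> \<longrightarrow> (\<exists>x. traj {t0..} x \<and> x t0 = x0)) \<and>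
        (\<forall>x. traj {t0..} x \<and> dist (x t0) p < \<delta> \<longrightarrow> (x \<longlongrightarrow> p) at_top))"

definition lyapunov_asymptotically_stable ::
  "(real set \<Rightarrow> (real \<Rightarrow> 'a::metric_space) \<Rightarrow> bool) \<Rightarrow> 'a \<Rightarrow> bool" where
  "lyapunov_asymptotically_stable traj p \<longleftrightarrow> lyapunov_stable traj p \<and> attractive traj p"

end

theory Submission
  imports Defs
begin

text \<open>
  In the coordinates \<open>(\<eta>, u)\<close> with \<open>u = k1 \<eta> + \<xi>e\<close> the error system is
  \<open>\<eta>' = G(\<eta>)(u - k1 \<eta>)\<close>, \<open>\<I> u' = ad*(K u) \<I> \<xi> - G(K \<eta>)\<^sup>T \<eta> - k3 u\<close>. The function
  \<open>V = (\<eta> \<bullet> K \<eta> + u \<bullet> K \<I> u) / 2\<close> satisfies \<open>V' = - k1 \<eta> \<bullet> K \<eta> - k3 u \<bullet> K u\<close>, because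
  \<open>ad(K u)(K u) = 0\<close>, \<open>G(K \<eta>) K = K G(\<eta>)\<close> and \<open>G(\<eta>) \<eta> = \<eta>\<close>; so it decays exponentially.

  The kinematic equation comes from differentiating the closed form of the logarithm: the rotation
  vector is \<open>\<theta> / sin \<theta>\<close> times the axial vector of \<open>R\<close>, and \<open>\<beta> = A(-\<Theta>) b\<close>. At \<open>\<theta> = 0\<close> the
  coefficients need only be continuous, since they multiply factors that vanish there. For the existence of
  trajectories the field in \<open>(\<eta>, u)\<close> is globally Lipschitz after a cutoff, and a solution is carried
  back to the group by the exponential.
\<close>

text \<open>Attractivity demands that trajectories exist, so group and coordinates must be linked in
  both directions. The derivative of the exponential is never computed. A differentiable curve in
  SE(3) has derivative \<open>g ** hat z\<close> for some \<open>z\<close>, and the known derivative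
  of the logarithm together with injectivity of \<open>G\<close> identifies \<open>z\<close>.

  With \<open>X = skew \<Theta>\<close>, the identities between \<open>A\<close>, \<open>S\<close>
  and the rotation reduce modulo \<open>X^3 = - \<theta>^2 X\<close> to scalar identities between
  coefficients. Away from 0 these are polynomial once denominators are cleared, since
  \<open>sin \<theta> > 0\<close> below pi. One scalar fact serves twice: \<open>coef_A\<close> is
  built from \<open>cot (\<theta> / 2)\<close> and so satisfies a Riccati equation. It yields
  \<open>G(\<eta>) \<eta> = \<eta>\<close> and also the derivative of \<open>coef_T2\<close>, on
  which the Lipschitz bounds rest.

  The velocity \<xi> of the body may be unbounded in time. The decay rate does not see it, because
  the term with \<xi> drops out of \<open>V'\<close>; the existence argument does, and therefore
  works with a Lipschitz constant that depends on time.\<close>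

unbundle cross3_syntax

lemma skew_mult [simp]: "skew a *v c = a \<times> c"
proof -
  have "linear (cross3 a)" using bilinear_cross by (simp add: bilinear_def)
  then show ?thesis by (simp add: skew_def)
qed

section \<open>Block decomposition of vectors and matrices\<close>

lemma vec_eq_blocks:
  fixes x y :: "real^('a::finite + 'b::finite)"
  shows "x = y \<longleftrightarrow> fst_block x = fst_block y \<and> snd_block x = snd_block y"
  by (auto simp: vec_eq_iff fst_block_def snd_block_def) (metis sum.exhaust)

definition join :: "real^'a::finite \<Rightarrow> real^'b::finite \<Rightarrow> real^('a + 'b)" where
  "join a b = (\<chi> i. case i of Inl p \<Rightarrow> a $ p | Inr q \<Rightarrow> b $ q)"

lemma fst_block_join [simp]: "fst_block (join a b) = a"
  and snd_block_join [simp]: "snd_block (join a b) = b"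
  by (simp_all add: join_def fst_block_def snd_block_def vec_eq_iff)

lemma join_blocks [simp]: "join (fst_block x) (snd_block x) = x"
  by (simp add: vec_eq_blocks)

lemma bounded_linear_fst_block: "bounded_linear (fst_block :: real^('a::finite + 'b::finite) \<Rightarrow> _)"
  and bounded_linear_snd_block: "bounded_linear (snd_block :: real^('a::finite + 'b::finite) \<Rightarrow> _)"
  by (auto intro!: linear_conv_bounded_linear[THEN iffD1] linearI 
     simp: fst_block_def snd_block_def vec_eq_iff)

lemma block_linear [simp]:
  "fst_block (x + y) = fst_block x + fst_block y" "snd_block (x + y) = snd_block x + snd_block y"
  "fst_block (x - y) = fst_block x - fst_block y" "snd_block (x - y) = snd_block x - snd_block y"
  "fst_block (- x) = - fst_block x" "snd_block (- x) = - snd_block x"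
  "fst_block (c *\<^sub>R x) = c *\<^sub>R fst_block x" "snd_block (c *\<^sub>R x) = c *\<^sub>R snd_block x"
  "fst_block 0 = 0" "snd_block 0 = 0"
  for x y :: "real^('a::finite + 'b::finite)"
  by (simp_all add: fst_block_def snd_block_def vec_eq_iff)

lemma sum_Plus_UNIV: "(\<Sum>i\<in>(UNIV :: ('a::finite + 'b::finite) set). f i) = (\<Sum>i\<in>UNIV. f (Inl i)) + (\<Sum>i\<in>UNIV. f (Inr i))"
  by (simp add: UNIV_Plus_UNIV[symmetric] sum.Plus del: UNIV_Plus_UNIV)

lemma inner_blocks: "x \<bullet> y = fst_block x \<bullet> fst_block y + snd_block x \<bullet> snd_block y"
  for x y :: "real^('a::finite + 'b::finite)"
  by (simp add: inner_vec_def sum_Plus_UNIV fst_block_def snd_block_def)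

lemma fst_block_block_mat_mult [simp]:
  "fst_block (block_mat A B C D *v x) = A *v fst_block x + B *v snd_block x"
  and snd_block_block_mat_mult [simp]:
  "snd_block (block_mat A B C D *v x) = C *v fst_block x + D *v snd_block x"
  by (simp_all add: vec_eq_iff matrix_vector_mult_def block_mat_def fst_block_def snd_block_def sum_Plus_UNIV)

lemma transpose_block_mat:
  "transpose (block_mat A B C D) = block_mat (transpose A) (transpose C) (transpose B) (transpose D)"
  by (auto simp: vec_eq_iff transpose_def block_mat_def split: sum.split)

lemma block_mat_mult:
  "block_mat A B C D ** block_mat A' B' C' D' =
     block_mat (A ** A' + B ** C') (A ** B' + B ** D') (C ** A' + D ** C') (C ** B' + D ** D')"
  by (auto simp: vec_eq_iff matrix_matrix_mult_def block_mat_def sum_Plus_UNIV split: sum.split)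

lemma block_mat_eq_iff [simp]:
  "block_mat A B C D = block_mat A' B' C' D' \<longleftrightarrow> A = A' \<and> B = B' \<and> C = C' \<and> D = D'"
  (is "?l \<longleftrightarrow> ?r")
proof
  assume ?l
  then have "block_mat A B C D $ i $ j = block_mat A' B' C' D' $ i $ j" for i j by simp
  from this[of "Inl _" "Inl _"] this[of "Inl _" "Inr _"] this[of "Inr _" "Inl _"] this[of "Inr _" "Inr _"]
  show ?r by (simp add: block_mat_def vec_eq_iff)
qed simp

lemma block_mat_linear:
  "block_mat A B C D + block_mat A' B' C' D' = block_mat (A + A') (B + B') (C + C') (D + D')"
  "block_mat A B C D - block_mat A' B' C' D' = block_mat (A - A') (B - B') (C - C') (D - D')"
  "c *\<^sub>R block_mat A B C D = block_mat (c *\<^sub>R A) (c *\<^sub>R B) (c *\<^sub>R C) (c *\<^sub>R D)"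
  "- block_mat A B C D = block_mat (- A) (- B) (- C) (- D)"
  by (auto simp: vec_eq_iff block_mat_def split: sum.split)

lemma mat_1_block_mat: "mat 1 = block_mat (mat 1) 0 0 (mat 1)"
  by (auto simp: vec_eq_iff block_mat_def mat_def split: sum.split)

lemma columnvector_simps [simp]:
  "M ** columnvector v = columnvector (M *v v)"
  "columnvector v + columnvector w = columnvector (v + w)"
  "columnvector v - columnvector w = columnvector (v - w)"
  "- columnvector v = columnvector (- v)"
  "c *\<^sub>R columnvector v = columnvector (c *\<^sub>R v)"
  "columnvector v = columnvector w \<longleftrightarrow> v = w"
  by (auto simp: vec_eq_iff columnvector_def matrix_matrix_mult_def matrix_vector_mult_def)

lemma columnvector_0 [simp]: "columnvector 0 = 0"
  by (simp add: vec_eq_iff columnvector_def)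

lemma outer_prod_mult [simp]: "outer_prod a b *v c = (b \<bullet> c) *\<^sub>R a"
  by (simp add: vec_eq_iff outer_prod_def matrix_vector_mult_def inner_vec_def sum_distrib_left mult_ac)

lemmas cross_linear = cross_add_left cross_add_right Cross3.left_diff_distrib Cross3.right_diff_distrib
  cross_mult_left cross_mult_right

lemma transpose_skew [simp]: "transpose (skew a) = - skew a"
  by (auto simp: skew_def transpose_def matrix_def vec_eq_iff forall_3 cross3_simps axis_def)

lemma uminus_matrix_vector_mult [simp]: "(- A) *v x = - (A *v x)" for A :: "real^'n^'m"
  by (simp add: vec_eq_iff matrix_vector_mult_def sum_negf)

lemma skew_linear [simp]:
  "skew (a + b) = skew a + skew b" "skew (a - b) = skew a - skew b" 
  "skew (c *\<^sub>R a) = c *\<^sub>R skew a" "skew 0 = 0" "skew (- a) = - skew a"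
  by (auto simp: matrix_eq matrix_vector_mult_add_rdistrib matrix_vector_mult_diff_rdistrib 
    cross_linear scaleR_matrix_vector_assoc[symmetric] )

lemma skew_inject [simp]: "skew a = skew b \<longleftrightarrow> a = b"
proof
  assume "skew a = skew b"
  \<comment> \<open>The first basis vector reveals components 2 and 3 of \<open>a\<close>, the
    second one adds component 1.\<close>
  then have "skew a *v axis 1 1 = skew b *v axis 1 1" "skew a *v axis 2 1 = skew b *v axis 2 1" by simp_all
  then show "a = b" unfolding skew_mult by (simp add: cross3_simps axis_def forall_3)
qed simp

lemma hat_eq_iff [simp]: "hat x = hat y \<longleftrightarrow> x = y"
  by (auto simp: hat_def vec_eq_blocks)

lemmas matrix_vector_simps = matrix_vector_mult_add_rdistrib matrix_vector_mult_diff_rdistrib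
  matrix_vector_right_distrib matrix_vector_mult_diff_distrib matrix_vector_mult_scaleR
  scaleR_matrix_vector_assoc[symmetric] matrix_vector_mul_assoc[symmetric]

section \<open>Poses, and quadratic polynomials in a skew matrix\<close>

lemma rot_part_pose [simp]: "rot_part (pose R b) = R"
  and pos_part_pose [simp]: "pos_part (pose R b) = b"
  by (simp_all add: rot_part_def pos_part_def pose_def block_mat_def columnvector_def vec_eq_iff)

lemma pose_mult: "pose R b ** pose R' b' = pose (R ** R') (R *v b' + b)"
  by (simp add: pose_def block_mat_mult)

lemma pose_eq_iff [simp]: "pose R b = pose R' b' \<longleftrightarrow> R = R' \<and> b = b'"
  by (auto simp: pose_def)

lemma pose_mult_hat: "pose R b ** hat \<zeta> = block_mat (R ** skew (fst_block \<zeta>)) (columnvector (R *v snd_block \<zeta>)) 0 0"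
  by (simp add: pose_def hat_def block_mat_mult)

text \<open>The inner product of \<Theta> with \<Theta> \<times> v vanishes, so one term of
  Lagrange's formula drops out. This is Cayley--Hamilton for \<open>X = skew \<Theta>\<close>; it
  brings every polynomial in \<open>X\<close> down to degree 2.\<close>

lemma cross_cross_cross: "\<Theta> \<times> (\<Theta> \<times> (\<Theta> \<times> v)) = - (norm \<Theta>)\<^sup>2 *\<^sub>R (\<Theta> \<times> v)"
  by (simp add: Lagrange[of _ _ "_ \<times> _"] dot_cross_self power2_norm_eq_inner)

text \<open>Division-free forms, valid at the filled-in point \<open>t = 0\<close> as well.\<close>

lemma coef_S1_mult: "t\<^sup>2 * coef_S1 t = 1 - cos t"
  by (simp add: coef_S1_def)

lemma coef_S2_mult: "t ^ 3 * coef_S2 t = t - sin t"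
  by (simp add: coef_S2_def)

text \<open>Rodrigues' formula for the exponential of \<open>skew \<Theta>\<close>. The factor of
  \<open>skew \<Theta>\<close> is \<open>sin \<theta> / \<theta>\<close>, written through
  \<open>coef_S2\<close> so that its singularity is already removed.\<close>

definition rodrigues :: "real^3 \<Rightarrow> real^3^3" where
  "rodrigues \<Theta> = mat 1 + (1 - (norm \<Theta>)\<^sup>2 * coef_S2 (norm \<Theta>)) *\<^sub>R skew \<Theta>
     + coef_S1 (norm \<Theta>) *\<^sub>R (skew \<Theta> ** skew \<Theta>)"

lemma rodrigues_mult: "rodrigues \<Theta> *v x = x + (1 - (norm \<Theta>)\<^sup>2 * coef_S2 (norm \<Theta>)) *\<^sub>R (\<Theta> \<times> x)
     + coef_S1 (norm \<Theta>) *\<^sub>R (\<Theta> \<times> (\<Theta> \<times> x))"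
  and S_mat_mult: "S_mat \<Theta> *v x = x + coef_S1 (norm \<Theta>) *\<^sub>R (\<Theta> \<times> x)
     + coef_S2 (norm \<Theta>) *\<^sub>R (\<Theta> \<times> (\<Theta> \<times> x))"
  and A_mat_mult: "A_mat \<Theta> *v x = x + (1/2) *\<^sub>R (\<Theta> \<times> x)
     + coef_A (norm \<Theta>) *\<^sub>R (\<Theta> \<times> (\<Theta> \<times> x))"
  by (simp_all add: rodrigues_def S_mat_def A_mat_def matrix_vector_simps)

lemma A_mat_uminus_mult: "A_mat (- \<Theta>) *v x = x - (1/2) *\<^sub>R (\<Theta> \<times> x)
     + coef_A (norm \<Theta>) *\<^sub>R (\<Theta> \<times> (\<Theta> \<times> x))"
  by (simp add: A_mat_mult)

text \<open>Modulo \<open>X^3 = - t^2 X\<close> these are the coefficients of \<open>X\<close> and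
  \<open>X^2\<close> in \<open>S(\<Theta>) A(-\<Theta>) - I\<close>. The bound below pi keeps
  \<open>sin t\<close> away from 0 for positive \<open>t\<close>.\<close>

lemma coef_A_inverse:
  assumes "0 \<le> t" "t < pi"
  shows "coef_S1 t - 1/2 - t\<^sup>2 * (coef_S1 t * coef_A t - coef_S2 t / 2) = 0"
    and "coef_S2 t - coef_S1 t / 2 + coef_A t - t\<^sup>2 * (coef_S2 t * coef_A t) = 0"
proof -
  consider "t = 0" | "t > 0" using assms by linarith
  then have "coef_S1 t - 1/2 - t\<^sup>2 * (coef_S1 t * coef_A t - coef_S2 t / 2) = 0 \<and> 
    coef_S2 t - coef_S1 t / 2 + coef_A t - t\<^sup>2 * (coef_S2 t * coef_A t) = 0"
  proof cases
    case 2
    define s c where "s = sin t" and "c = cos t"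
    have s: "s > 0" using 2 assms by (simp add: s_def sin_gt_zero)
    have sc: "s * s = 1 - c * c" using sin_squared_eq[of t] by (simp add: s_def c_def power2_eq_square)
    have S1: "t\<^sup>2 * coef_S1 t = 1 - c" and S2: "t ^ 3 * coef_S2 t = t - s"
      by (simp_all add: coef_S1_mult coef_S2_mult c_def s_def)
    have A: "2 * t\<^sup>2 * s * coef_A t = 2 * s - t * (1 + c)"
      using 2 s by (simp add: coef_A_def s_def[symmetric] c_def[symmetric] field_simps power2_eq_square)
    \<comment> \<open>The factor clears all denominators. What remains is regrouped into the
      products \<open>S1\<close>, \<open>S2\<close>, \<open>A\<close>, so that only
      \<open>s * s = 1 - c * c\<close> is needed to finish.\<close>
    have "2 * t\<^sup>2 * s * (coef_S1 t - 1/2 - t\<^sup>2 * (coef_S1 t * coef_A t - coef_S2 t / 2)) = 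
       2 * s * (t\<^sup>2 * coef_S1 t) - t\<^sup>2 * s - (t\<^sup>2 * coef_S1 t) * (2 * t\<^sup>2 * s * coef_A t) + t * s * (t ^ 3 * coef_S2 t)"
      by algebra
    also have "\<dots> = 0" unfolding S1 S2 A using sc by algebra
    finally have 1: "coef_S1 t - 1/2 - t\<^sup>2 * (coef_S1 t * coef_A t - coef_S2 t / 2) = 0" using 2 s by simp
    have "2 * t ^ 3 * (coef_S2 t - coef_S1 t / 2 + coef_A t - t\<^sup>2 * (coef_S2 t * coef_A t)) =
       2 * (t ^ 3 * coef_S2 t) - t * (t\<^sup>2 * coef_S1 t) + 2 * t ^ 3 * coef_A t - 2 * t\<^sup>2 * coef_A t * (t ^ 3 * coef_S2 t)"
      by algebra
    also have "\<dots> = 2 * (t - s) - t * (1 - c) + 2 * t\<^sup>2 * s * coef_A t" unfolding S1 S2 by algebra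
    also have "\<dots> = 0" unfolding A by algebra
    finally have "coef_S2 t - coef_S1 t / 2 + coef_A t - t\<^sup>2 * (coef_S2 t * coef_A t) = 0" using 2 by simp
    with 1 show ?thesis by simp
  qed (simp add: coef_A_def coef_S1_def coef_S2_def)
  then show "coef_S1 t - 1/2 - t\<^sup>2 * (coef_S1 t * coef_A t - coef_S2 t / 2) = 0"
    and "coef_S2 t - coef_S1 t / 2 + coef_A t - t\<^sup>2 * (coef_S2 t * coef_A t) = 0" by auto
qed

text \<open>The translation of an exponential is \<open>b = S(\<Theta>) \<beta>\<close>; this
  inverts that relation. Both factors are polynomials in \<open>skew \<Theta>\<close>, so the two
  products reduce to the same expression.\<close>

lemma S_mat_A_mat:
  assumes "norm \<Theta> < pi"
  shows "S_mat \<Theta> *v (A_mat (- \<Theta>) *v v) = v" "A_mat (- \<Theta>) *v (S_mat \<Theta> *v v) = v"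
proof -
  let ?t = "norm \<Theta>"
  have *: "v + (coef_S1 ?t - 1/2 - ?t\<^sup>2 * (coef_S1 ?t * coef_A ?t - coef_S2 ?t / 2)) *\<^sub>R (\<Theta> \<times> v)
   + (coef_S2 ?t - coef_S1 ?t / 2 + coef_A ?t - ?t\<^sup>2 * (coef_S2 ?t * coef_A ?t)) *\<^sub>R (\<Theta> \<times> (\<Theta> \<times> v)) = v"
    using coef_A_inverse[of ?t] assms by simp
  have 1: "S_mat \<Theta> *v (A_mat (- \<Theta>) *v v) = v + (coef_S1 ?t - 1/2 - ?t\<^sup>2 * (coef_S1 ?t * coef_A ?t - coef_S2 ?t / 2)) *\<^sub>R (\<Theta> \<times> v)
   + (coef_S2 ?t - coef_S1 ?t / 2 + coef_A ?t - ?t\<^sup>2 * (coef_S2 ?t * coef_A ?t)) *\<^sub>R (\<Theta> \<times> (\<Theta> \<times> v))"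
    unfolding S_mat_mult A_mat_uminus_mult cross_linear cross_cross_cross
    by (simp add: vec_eq_iff cross_linear cross_cross_cross field_simps)
  have 2: "A_mat (- \<Theta>) *v (S_mat \<Theta> *v v) = v + (coef_S1 ?t - 1/2 - ?t\<^sup>2 * (coef_S1 ?t * coef_A ?t - coef_S2 ?t / 2)) *\<^sub>R (\<Theta> \<times> v)
   + (coef_S2 ?t - coef_S1 ?t / 2 + coef_A ?t - ?t\<^sup>2 * (coef_S2 ?t * coef_A ?t)) *\<^sub>R (\<Theta> \<times> (\<Theta> \<times> v))"
    unfolding S_mat_mult A_mat_uminus_mult cross_linear cross_cross_cross
    by (simp add: vec_eq_iff cross_linear cross_cross_cross field_simps)
  show "S_mat \<Theta> *v (A_mat (- \<Theta>) *v v) = v" "A_mat (- \<Theta>) *v (S_mat \<Theta> *v v) = v"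
    using 1 2 * by simp_all
qed

section \<open>The exponential\<close>

text \<open>The total weight with which the square of the matrix occurs in the exponential series,
  indexed by the exponent of that series so that it can be summed termwise with the others. It is
  the cosine series without its constant term, divided by \<open>t^2\<close>.\<close>

lemma coef_S1_sums:
  "(\<lambda>n. if even n \<and> 2 \<le> n then (- (t\<^sup>2)) ^ ((n - 2) div 2) / fact n else 0) sums coef_S1 t"
  (is "?c sums _")
proof (cases "t = 0")
  case True
  have "?c = (\<lambda>n. if n = 2 then 1/2 else 0)"
  proof
    fix n :: nat
    \<comment> \<open>At \<open>t = 0\<close> the power of 0 survives only for exponent 0, which
      happens at \<open>n = 2\<close>.\<close>
    have "n = 2 \<or> \<not> (even n \<and> 2 \<le> n) \<or> 0 < (n - 2) div 2" by presburger
    then show "?c n = (if n = 2 then 1/2 else 0)" using True by auto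
  qed
  then show ?thesis using True sums_single[of 2 "\<lambda>n. 1/2 :: real"] by (simp add: coef_S1_def)
next
  case False
  have "(\<lambda>n. ((if n = 0 then 1 else 0) - cos_coeff n *\<^sub>R t ^ n) / t\<^sup>2) sums ((1 - cos t) / t\<^sup>2)"
    by (intro sums_divide sums_diff cos_converges sums_single)
  moreover have "((if n = 0 then 1 else 0) - cos_coeff n *\<^sub>R t ^ n) / t\<^sup>2 = ?c n" for n
  proof (cases "even n \<and> 2 \<le> n")
    case True
    then have "\<exists>k. n = 2 * Suc k" by presburger
    then obtain k where n: "n = 2 * Suc k" ..
    have "t ^ n = t\<^sup>2 * (t\<^sup>2) ^ k" unfolding n by (simp add: power_mult power2_eq_square)
    moreover have "(- (t\<^sup>2)) ^ k = (-1) ^ k * (t\<^sup>2) ^ k" by (metis mult_minus1 power_mult_distrib)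
    ultimately show ?thesis using True False by (simp add: n cos_coeff_def del: fact_Suc)
  next
    case False
    then have "n = 0 \<or> odd n" by presburger
    then show ?thesis using \<open>t \<noteq> 0\<close> False by (auto simp: cos_coeff_def)
  qed
  ultimately show ?thesis using False by (simp add: coef_S1_def)
qed

text \<open>The weight of the cube of the matrix, from the sine series without its linear
  term.\<close>

lemma coef_S2_sums:
  "(\<lambda>n. if odd n \<and> 3 \<le> n then (- (t\<^sup>2)) ^ ((n - 3) div 2) / fact n else 0) sums coef_S2 t"
  (is "?c sums _")
proof (cases "t = 0")
  case True
  have "?c = (\<lambda>n. if n = 3 then 1/6 else 0)"
  proof
    fix n :: nat
    have "n = 3 \<or> \<not> (odd n \<and> 3 \<le> n) \<or> 0 < (n - 3) div 2" by presburger
    then show "?c n = (if n = 3 then 1/6 else 0)" using True by (auto simp: fact_numeral)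
  qed
  then show ?thesis using True sums_single[of 3 "\<lambda>n. 1/6 :: real"] by (simp add: coef_S2_def)
next
  case False
  have "(\<lambda>n. ((if n = 1 then t else 0) - sin_coeff n *\<^sub>R t ^ n) / t ^ 3) sums ((t - sin t) / t ^ 3)"
    by (intro sums_divide sums_diff sin_converges sums_single)
  moreover have "((if n = 1 then t else 0) - sin_coeff n *\<^sub>R t ^ n) / t ^ 3 = ?c n" for n
  proof (cases "odd n \<and> 3 \<le> n")
    case True
    then have "\<exists>k. n = 2 * k + 3" by presburger
    then obtain k where n: "n = 2 * k + 3" ..
    have "t ^ n = t ^ 3 * (t\<^sup>2) ^ k" unfolding n by (simp add: power_mult power_add)
    moreover have "(- (t\<^sup>2)) ^ k = (-1) ^ k * (t\<^sup>2) ^ k" by (metis mult_minus1 power_mult_distrib)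
    ultimately show ?thesis using True False by (simp add: n sin_coeff_def del: fact_Suc)
  next
    case False
    then have "n = 1 \<or> even n" by presburger
    then show ?thesis using \<open>t \<noteq> 0\<close> False by (auto simp: sin_coeff_def)
  qed
  ultimately show ?thesis using False by (simp add: coef_S2_def)
qed

lemma skew_cube: "skew \<Theta> ** (skew \<Theta> ** skew \<Theta>) = - (norm \<Theta>)\<^sup>2 *\<^sub>R skew \<Theta>"
  by (simp add: matrix_eq matrix_vector_simps cross_cross_cross)

lemma matrix_mult_scaleR [simp]: "A ** (c *\<^sub>R B) = c *\<^sub>R (A ** B)" "(c *\<^sub>R A) ** B = c *\<^sub>R (A ** B)"
  for A :: "real^'n^'m" and B :: "real^'k^'n"
  by (simp_all add: vec_eq_iff matrix_matrix_mult_def sum_distrib_left mult_ac)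

lemma matrix_mult_uminus [simp]: "A ** (- B) = - (A ** B)" "(- A) ** B = - (A ** B)"
  for A :: "real^'n^'m" and B :: "real^'k^'n"
  by (simp_all add: vec_eq_iff matrix_matrix_mult_def sum_negf)

text \<open>The matrix \<open>M = hat \<eta>\<close> satisfies
  \<open>M^4 = - \<theta>^2 M^2\<close>. From exponent 2 on, its powers therefore are multiples of
  \<open>M^2\<close> and \<open>M^3\<close> in turn, and the series splits into \<open>I + M\<close>
  and two scalar series.\<close>

theorem mat_exp_hat:
  "mat_exp (hat \<eta>) = pose (rodrigues (fst_block \<eta>)) (S_mat (fst_block \<eta>) *v snd_block \<eta>)"
proof -
  define M where "M = hat \<eta>"
  define \<Theta> \<beta> where "\<Theta> = fst_block \<eta>" and "\<beta> = snd_block \<eta>"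
  let ?t = "norm \<Theta>"
  define P where "P n = ((\<lambda>N. M ** N) ^^ n) (mat 1)" for n
  have M: "M = block_mat (skew \<Theta>) (columnvector \<beta>) 0 0" by (simp add: M_def hat_def \<Theta>_def \<beta>_def)
  have P0: "P 0 = mat 1" and PS: "P (Suc n) = M ** P n" for n by (simp_all add: P_def)
  have P1: "P 1 = M" by (simp add: P_def)
  have P2: "P 2 = block_mat (skew \<Theta> ** skew \<Theta>) (columnvector (\<Theta> \<times> \<beta>)) 0 0"
  proof -
    have "P 2 = M ** M" using PS[of 1] P1 by (metis Suc_1)
    then show ?thesis by (simp add: M block_mat_mult)
  qed
  have P3: "P 3 = block_mat (- ?t\<^sup>2 *\<^sub>R skew \<Theta>) (columnvector (\<Theta> \<times> (\<Theta> \<times> \<beta>))) 0 0"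
    using PS[of 2] by (simp add: P2 block_mat_mult M skew_cube)
  have MP3: "M ** P 3 = (- (?t\<^sup>2)) *\<^sub>R P 2"
    by (simp add: P2 P3 M block_mat_mult block_mat_linear cross_cross_cross)
  have Pk: "P (2 * k + 2) = (- (?t\<^sup>2)) ^ k *\<^sub>R P 2 \<and> P (2 * k + 3) = (- (?t\<^sup>2)) ^ k *\<^sub>R P 3" for k
  proof (induction k)
    case (Suc k)
    have "2 * Suc k + 2 = Suc (2 * k + 3)" by simp
    then have "P (2 * Suc k + 2) = M ** P (2 * k + 3)" by (simp only: PS)
    then have 1: "P (2 * Suc k + 2) = (- (?t\<^sup>2)) ^ Suc k *\<^sub>R P 2"
      using Suc MP3 by (simp add: mult.commute)
    have "2 * Suc k + 3 = Suc (2 * Suc k + 2)" by simp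
    then have "P (2 * Suc k + 3) = M ** P (2 * Suc k + 2)" by (simp only: PS)
    also have "\<dots> = (- (?t\<^sup>2)) ^ Suc k *\<^sub>R P 3" unfolding 1 using PS[of 2] by simp
    finally show ?case using 1 by blast
  qed (simp add: eval_nat_numeral)
  let ?c = "\<lambda>n. if even n \<and> 2 \<le> n then (- (?t\<^sup>2)) ^ ((n - 2) div 2) / fact n else (0::real)"
  let ?d = "\<lambda>n. if odd n \<and> 3 \<le> n then (- (?t\<^sup>2)) ^ ((n - 3) div 2) / fact n else (0::real)"
  have "(1 / fact n) *\<^sub>R P n = ((if n = 0 then mat 1 else 0) + (if n = 1 then M else 0)) 
      + (?c n *\<^sub>R P 2 + ?d n *\<^sub>R P 3)" for n
  proof -
    have "n = 0 \<or> n = 1 \<or> (\<exists>k. n = 2 * k + 2) \<or> (\<exists>k. n = 2 * k + 3)" by presburger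
    then consider "n = 0" | "n = 1" | k where "n = 2 * k + 2" | k where "n = 2 * k + 3" by blast
    then show ?thesis
    proof cases
      case (3 k)
      then show ?thesis using Pk[of k] by (simp del: power_Suc fact_Suc)
    next
      case (4 k)
      then show ?thesis using Pk[of k] by (simp del: power_Suc fact_Suc)
    qed (use P0 P1 in auto)
  qed
  moreover have "(\<lambda>n. ((if n = 0 then mat 1 else 0) + (if n = 1 then M else 0)) 
      + (?c n *\<^sub>R P 2 + ?d n *\<^sub>R P 3)) sums ((mat 1 + M) + (coef_S1 ?t *\<^sub>R P 2 + coef_S2 ?t *\<^sub>R P 3))"
    by (intro sums_add sums_single bounded_linear.sums[OF bounded_linear_scaleR_left] coef_S1_sums coef_S2_sums)
  ultimately have "mat_exp M = (mat 1 + M) + (coef_S1 ?t *\<^sub>R P 2 + coef_S2 ?t *\<^sub>R P 3)"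
    by (simp add: mat_exp_def P_def[symmetric] sums_iff)
  also have "\<dots> = pose (rodrigues \<Theta>) (S_mat \<Theta> *v \<beta>)"
    by (simp add: M P2 P3 block_mat_linear mat_1_block_mat pose_def rodrigues_def S_mat_mult algebra_simps)
  finally show ?thesis by (simp add: M_def \<Theta>_def \<beta>_def)
qed

section \<open>The logarithm\<close>

text \<open>The vector whose skew matrix is the skew-symmetric part of \<open>R\<close>; for a
  rotation by an angle \<theta> below pi its length is \<open>sin \<theta>\<close>.\<close>

definition rot_axis :: "real^3^3 \<Rightarrow> real^3" where
  "rot_axis R = (1/2) *\<^sub>R vector [R$3$2 - R$2$3, R$1$3 - R$3$1, R$2$1 - R$1$2]"

definition angle_ratio :: "real \<Rightarrow> real" where
  "angle_ratio t = (if t = 0 then 1 else t / sin t)"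

text \<open>An explicit formula that can be differentiated, in place of the definite description
  behind \<open>logm_SE3\<close>.\<close>

definition rot_log :: "real^3^3 \<Rightarrow> real^3" where
  "rot_log R = angle_ratio (principal_angle R) *\<^sub>R rot_axis R"

lemma rot_axis_linear [simp]: "rot_axis (A + B) = rot_axis A + rot_axis B" "rot_axis (c *\<^sub>R A) = c *\<^sub>R rot_axis A"
  by (simp_all add: rot_axis_def vec_eq_iff forall_3 field_simps)

lemma bounded_linear_rot_axis: "bounded_linear rot_axis"
  by (auto intro!: linear_conv_bounded_linear[THEN iffD1] linearI)

lemma bounded_linear_trace: "bounded_linear (trace :: real^'n^'n \<Rightarrow> real)"
  by (auto intro!: linear_conv_bounded_linear[THEN iffD1] linearI 
     simp: trace_def sum.distrib sum_distrib_left)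

lemma skew_entries: "skew v $ 1 $ 1 = 0" "skew v $ 1 $ 2 = - v $ 3" "skew v $ 1 $ 3 = v $ 2"
  "skew v $ 2 $ 1 = v $ 3" "skew v $ 2 $ 2 = 0" "skew v $ 2 $ 3 = - v $ 1"
  "skew v $ 3 $ 1 = - v $ 2" "skew v $ 3 $ 2 = v $ 1" "skew v $ 3 $ 3 = 0"
  by (simp_all add: skew_def matrix_def cross3_simps axis_def)

lemma rot_axis_skew [simp]: "rot_axis (mat 1) = 0" "rot_axis (skew v) = v" "rot_axis (skew v ** skew v) = 0"
  by (simp_all add: rot_axis_def skew_entries vec_eq_iff forall_3 mat_def matrix_matrix_mult_def sum_3)

lemma trace_skew [simp]: "trace (skew v) = 0" "trace (skew v ** skew v) = - 2 * (norm v)\<^sup>2"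
  by (simp_all add: trace_def skew_entries matrix_matrix_mult_def sum_3 power2_norm_eq_inner inner_vec_def)

lemma trace_linear [simp]: "trace (A + B) = trace A + trace B" "trace (c *\<^sub>R A) = c * trace A"
  for A B :: "real^'n^'n"
  by (simp_all add: trace_def sum.distrib sum_distrib_left)

lemma trace_mat_1 [simp]: "trace (mat 1 :: real^3^3) = 3"
  by (simp add: trace_def mat_def sum_3)

lemma principal_angle_rodrigues:
  assumes "norm \<Theta> \<le> pi"
  shows "principal_angle (rodrigues \<Theta>) = norm \<Theta>"
proof -
  have "trace (rodrigues \<Theta>) = 3 - 2 * ((norm \<Theta>)\<^sup>2 * coef_S1 (norm \<Theta>))"
    by (simp add: rodrigues_def)
  then have "(trace (rodrigues \<Theta>) - 1) / 2 = cos (norm \<Theta>)" by (simp add: coef_S1_mult)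
  then show ?thesis using assms by (simp add: principal_angle_def arccos_cos)
qed

text \<open>The quadratic term of Rodrigues' formula is symmetric, so the axial vector sees only
  \<open>sin \<theta> / \<theta>\<close> times \<Theta>; \<open>angle_ratio\<close> undoes this
  factor.\<close>

lemma rot_log_rodrigues:
  assumes "norm \<Theta> < pi"
  shows "rot_log (rodrigues \<Theta>) = \<Theta>"
proof -
  have "rot_axis (rodrigues \<Theta>) = (1 - (norm \<Theta>)\<^sup>2 * coef_S2 (norm \<Theta>)) *\<^sub>R \<Theta>"
    by (simp add: rodrigues_def)
  moreover have "angle_ratio (norm \<Theta>) * (1 - (norm \<Theta>)\<^sup>2 * coef_S2 (norm \<Theta>)) = 1"
  proof (cases "norm \<Theta> = 0")
    case False
    then have "sin (norm \<Theta>) \<noteq> 0" using assms sin_gt_zero[of "norm \<Theta>"] by force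
    then show ?thesis using False
      by (simp add: angle_ratio_def coef_S2_def field_simps power2_eq_square power3_eq_cube)
  qed (simp add: angle_ratio_def)
  ultimately show ?thesis 
    using assms by (simp add: rot_log_def principal_angle_rodrigues)
qed

lemma matrix_mult_diff [simp]: "A ** (B - C) = A ** B - A ** C" "(B' - C') ** A = B' ** A - C' ** A"
  for A :: "real^'n^'m" and B C :: "real^'k^'n" and B' C' :: "real^'m^'k"
  by (simp_all add: vec_eq_iff matrix_matrix_mult_def sum_subtractf algebra_simps)

text \<open>Cayley--Hamilton for a rotation matrix, whose adjugate is its transpose.\<close>

lemma rotation_matrix_square:
  fixes R :: "real^3^3"
  assumes "rotation_matrix R"
  shows "R ** R = trace R *\<^sub>R R - trace R *\<^sub>R mat 1 + transpose R"
proof -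
  have c: "(R *v x) \<times> (R *v y) = R *v (x \<times> y)" for x y by (rule cross_rotation_matrix[OF assms])
  have col: "R *v axis k 1 = column k R" for k by (rule matrix_vector_mult_basis)
  \<comment> \<open>The columns form a right-handed frame. Read componentwise, these nine equations
    say that the adjugate is the transpose, and each entry of the claim is linear in them.\<close>
  have 1: "column 1 R \<times> column 2 R = column 3 R" "column 2 R \<times> column 3 R = column 1 R" "column 3 R \<times> column 1 R = column 2 R"
    using c[of "axis 1 1" "axis 2 1"] c[of "axis 2 1" "axis 3 1"] c[of "axis 3 1" "axis 1 1"] 
    by (simp_all add: cross_basis col)
  note 2 = 1[unfolded vec_eq_iff forall_3 cross_components column_def, simplified]
  note 3 = 2[THEN conjunct1] 2[THEN conjunct2, THEN conjunct1] 2[THEN conjunct2, THEN conjunct2]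
  show ?thesis
    unfolding vec_eq_iff forall_3 trace_def matrix_matrix_mult_def sum_3 transpose_def mat_def
    by (intro conjI; simp add: algebra_simps; insert 3; simp only: mult_ac; linarith)
qed

text \<open>The formula for \<open>R ** R\<close> turns the square of the skew-symmetric part into a
  multiple of the symmetric part minus the identity. Hence the axial vector \<open>q\<close> and the
  trace determine \<open>R\<close>, and Rodrigues' formula is recovered by matching coefficients.
  The third conclusion keeps \<open>arccos\<close> inside its domain along a curve of
  rotations.\<close>

lemma rodrigues_rot_log:
  assumes R: "rotation_matrix R" and lt: "principal_angle R < pi"
  shows "rodrigues (rot_log R) = R" "norm (rot_log R) = principal_angle R"
    and "(trace R - 1) / 2 \<in> {-1..1}"
proof -
  define c where "c = (trace R - 1) / 2"
  define q where "q = rot_axis R"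
  define t where "t = principal_angle R"
  have orth: "R ** transpose R = mat 1" "transpose R ** R = mat 1"
    using R by (auto simp: rotation_matrix_def orthogonal_matrix_def orthogonal_matrix)
  have sk: "skew q = (1/2) *\<^sub>R (R - transpose R)"
    by (simp add: q_def rot_axis_def vec_eq_iff forall_3 skew_entries transpose_def field_simps)
  have sq: "skew q ** skew q = ((trace R + 1) / 2) *\<^sub>R ((1/2) *\<^sub>R (R + transpose R) - mat 1)"
  proof -
    have a: "(R - transpose R) ** (R - transpose R) = R ** R + transpose R ** transpose R - 2 *\<^sub>R mat 1"
      using orth by (simp add: algebra_simps scaleR_2)
    have "transpose R ** transpose R = transpose (R ** R)" by (simp add: matrix_transpose_mul)
    also have "\<dots> = trace R *\<^sub>R transpose R - trace R *\<^sub>R mat 1 + R" 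
      by (subst rotation_matrix_square[OF R]) (simp add: transpose_def vec_eq_iff mat_def)
    finally have b: "transpose R ** transpose R = trace R *\<^sub>R transpose R - trace R *\<^sub>R mat 1 + R" .
    have "skew q ** skew q = (1/4) *\<^sub>R ((R - transpose R) ** (R - transpose R))"
      by (simp add: sk del: matrix_mult_diff)
    also have "\<dots> = ((trace R + 1) / 2) *\<^sub>R ((1/2) *\<^sub>R (R + transpose R) - mat 1)"
      unfolding a b rotation_matrix_square[OF R] by (simp add: vec_eq_iff field_simps)
    finally show ?thesis .
  qed
  have tr_t: "trace (transpose R) = trace R" by (simp add: trace_def transpose_def)
  have tr_minus: "trace (A - mat 1) = trace A - 3" for A :: "real^3^3"
    using trace_linear(1)[of "A - mat 1" "mat 1"] by simp
  \<comment> \<open>Taking traces gives the length of \<open>q\<close>, whence \<open>c\<close> lies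
    between -1 and 1.\<close>
  have "- 2 * (norm q)\<^sup>2 = trace (skew q ** skew q)" by simp
  also have "\<dots> = ((trace R + 1) / 2) * (trace R - 3)" unfolding sq by (simp add: tr_minus tr_t)
  finally have nq: "(norm q)\<^sup>2 = 1 - c\<^sup>2" by (simp add: c_def field_simps power2_eq_square)
  then have "c\<^sup>2 \<le> 1" using zero_le_power2[of "norm q"] by linarith
  then have c: "-1 \<le> c" "c \<le> 1" by (auto simp: abs_square_le_1 abs_le_iff)
  then show "(trace R - 1) / 2 \<in> {-1..1}" by (simp add: c_def)
  have t: "t = arccos c" by (simp add: t_def principal_angle_def c_def)
  then have ct: "cos t = c" and t0: "0 \<le> t" using c by (simp_all add: cos_arccos arccos_lbound)
  have "t < pi" using lt t_def by simp
  then have cm: "c \<noteq> -1" using t by auto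
  have st: "sin t = norm q"
    using nq ct t0 \<open>t < pi\<close> by (metis sin_squared_eq norm_ge_zero power2_eq_iff_nonneg sin_ge_zero less_imp_le)
  \<comment> \<open>The denominator is \<open>1 + c\<close> and not \<open>sin t\<close>, so the
    identity rotation is included; an angle below pi means \<open>c \<noteq> -1\<close>.\<close>
  have Rq: "R = mat 1 + skew q + (1 / (1 + c)) *\<^sub>R (skew q ** skew q)"
  proof -
    have "(trace R + 1) / 2 = 1 + c" by (simp add: c_def field_simps)
    moreover have "1 + c \<noteq> 0" using cm by linarith
    ultimately have e: "(1 / (1 + c)) *\<^sub>R (skew q ** skew q) = (1/2) *\<^sub>R (R + transpose R) - mat 1"
      by (simp add: sq)
    show ?thesis unfolding e unfolding sk by (simp add: vec_eq_iff field_simps)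
  qed
  have L: "rot_log R = angle_ratio t *\<^sub>R q" by (simp add: rot_log_def t_def q_def)
  have n: "norm (rot_log R) = t"
    using st t0 \<open>t < pi\<close> sin_gt_zero[of t] by (auto simp: L angle_ratio_def abs_if divide_less_0_iff)
  then show "norm (rot_log R) = principal_angle R" by (simp add: t_def)
  show "rodrigues (rot_log R) = R"
  proof (cases "t = 0")
    case True
    then have "q = 0" using st by simp
    then have "rot_log R = 0" by (simp add: L)
    moreover have "R = mat 1" using Rq \<open>q = 0\<close> by simp
    ultimately have "rot_log R = 0" "R = mat 1" by blast+
    then show ?thesis by (simp only: rodrigues_def) simp
  next
    case False
    then have s: "sin t > 0" using t0 \<open>t < pi\<close> by (simp add: sin_gt_zero)
    have "(1 - t\<^sup>2 * coef_S2 t) * angle_ratio t = 1"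
      using False s by (simp add: angle_ratio_def coef_S2_def field_simps power2_eq_square power3_eq_cube)
    moreover have "coef_S1 t * (angle_ratio t)\<^sup>2 = 1 / (1 + c)"
    proof -
      have "(sin t)\<^sup>2 = (1 - c) * (1 + c)" using sin_squared_eq[of t] ct by (simp add: algebra_simps power2_eq_square)
      moreover have "1 + c \<noteq> 0" using cm by linarith
      ultimately show ?thesis
        using False s by (auto simp: angle_ratio_def coef_S1_def ct power_divide)
    qed
    moreover have "rodrigues (rot_log R) = mat 1 + ((1 - t\<^sup>2 * coef_S2 t) * angle_ratio t) *\<^sub>R skew q
        + (coef_S1 t * (angle_ratio t)\<^sup>2) *\<^sub>R (skew q ** skew q)"
      unfolding rodrigues_def n unfolding L by (simp add: power2_eq_square mult.assoc)
    ultimately show ?thesis using Rq by simp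
  qed
qed

definition pose_log :: "real^(3 + 1)^(3 + 1) \<Rightarrow> real^(3 + 3)" where
  "pose_log g = join (rot_log (rot_part g)) (A_mat (- rot_log (rot_part g)) *v pos_part g)"

definition pose_exp :: "real^(3 + 3) \<Rightarrow> real^(3 + 1)^(3 + 1)" where
  "pose_exp \<eta> = pose (rodrigues (fst_block \<eta>)) (S_mat (fst_block \<eta>) *v snd_block \<eta>)"

lemma pose_log_pose_exp: "norm (fst_block \<eta>) < pi \<Longrightarrow> pose_log (pose_exp \<eta>) = \<eta>"
  by (simp add: pose_log_def pose_exp_def rot_log_rodrigues S_mat_A_mat)

lemma SE3_pose: "g \<in> SE3 \<Longrightarrow> g = pose (rot_part g) (pos_part g)"
  and SE3_rotation: "g \<in> SE3 \<Longrightarrow> rotation_matrix (rot_part g)"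
  and pose_in_SE3: "rotation_matrix R \<Longrightarrow> pose R b \<in> SE3"
  by (auto simp: SE3_def)

text \<open>The definite description is resolved by injectivity: \<open>pose_log\<close> is a left
  inverse of the exponential on rotation vectors shorter than pi.\<close>

lemma exp_coords_eq:
  assumes "mat_exp (hat \<eta>) = g" "norm (fst_block \<eta>) < pi"
  shows "exp_coords g = \<eta>"
proof -
  have "logm_SE3 g = hat \<eta>"
    unfolding logm_SE3_def
    by (rule the_equality) (use assms in \<open>auto simp: mat_exp_hat pose_exp_def[symmetric] dest: pose_log_pose_exp\<close>,
      metis pose_log_pose_exp)
  then show ?thesis by (simp add: exp_coords_def)
qed

lemma
  assumes "g \<in> SE3" "principal_angle (rot_part g) < pi"
  shows exp_coords_pose_log: "exp_coords g = pose_log g"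
    and norm_exp_coords: "norm (fst_block (exp_coords g)) = principal_angle (rot_part g)"
proof -
  note * = rodrigues_rot_log[OF SE3_rotation[OF assms(1)] assms(2)]
  have "pose_exp (pose_log g) = g"
    using * assms by (subst (2) SE3_pose[OF assms(1)]) (simp add: pose_exp_def pose_log_def S_mat_A_mat)
  moreover have n: "norm (fst_block (pose_log g)) = principal_angle (rot_part g)"
    using * by (simp add: pose_log_def)
  ultimately show "exp_coords g = pose_log g"
    using assms(2) by (intro exp_coords_eq) (simp_all add: mat_exp_hat pose_exp_def)
  with n show "norm (fst_block (exp_coords g)) = principal_angle (rot_part g)" by simp
qed

lemma exp_coords_pose_exp: "norm (fst_block \<eta>) < pi \<Longrightarrow> exp_coords (pose_exp \<eta>) = \<eta>"
  by (intro exp_coords_eq) (simp_all add: mat_exp_hat pose_exp_def)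

section \<open>Kinematics of the exponential coordinates\<close>

lemma has_vector_derivative_iff_tendsto:
  "(f has_vector_derivative f') (at t within S) \<longleftrightarrow> ((\<lambda>s. (1 / (s - t)) *\<^sub>R (f s - f t)) \<longlongrightarrow> f') (at t within S)"
proof -
  have e: "norm (f s - f t - (s - t) *\<^sub>R f') / norm (s - t) = norm ((1 / (s - t)) *\<^sub>R (f s - f t) - f')" if "s \<noteq> t" for s
  proof -
    have "(1 / (s - t)) *\<^sub>R (f s - f t) - f' = (1 / (s - t)) *\<^sub>R (f s - f t - (s - t) *\<^sub>R f')"
      using that by (simp add: scaleR_right_diff_distrib)
    then show ?thesis by simp
  qed
  have "(f has_vector_derivative f') (at t within S) \<longleftrightarrow> ((\<lambda>s. norm (f s - f t - (s - t) *\<^sub>R f') / norm (s - t)) \<longlongrightarrow> 0) (at t within S)"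
    by (simp add: has_vector_derivative_def has_derivative_iff_norm bounded_linear_scaleR_left)
  also have "\<dots> \<longleftrightarrow> ((\<lambda>s. norm ((1 / (s - t)) *\<^sub>R (f s - f t) - f')) \<longlongrightarrow> 0) (at t within S)"
    by (rule filterlim_cong[OF refl refl]) (use e in \<open>auto simp: eventually_at_filter\<close>)
  also have "\<dots> \<longleftrightarrow> ((\<lambda>s. (1 / (s - t)) *\<^sub>R (f s - f t)) \<longlongrightarrow> f') (at t within S)"
    by (simp add: tendsto_norm_zero_iff LIM_zero_iff)
  finally show ?thesis .
qed

text \<open>Since \<open>f\<close> vanishes at \<open>t\<close>, the difference quotient of the
  product is \<open>a s\<close> times that of \<open>f\<close>. This handles every spot where a
  coefficient of \<open>norm \<Theta>\<close> meets \<Theta> = 0, where the norm itself has no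
  derivative.\<close>

lemma has_vector_derivative_vanishing_product:
  assumes "continuous (at t within S) a" "(f has_vector_derivative f') (at t within S)" "f t = 0"
  shows "((\<lambda>s. a s *\<^sub>R f s) has_vector_derivative a t *\<^sub>R f') (at t within S)"
proof -
  have "((\<lambda>s. a s *\<^sub>R ((1 / (s - t)) *\<^sub>R (f s - f t))) \<longlongrightarrow> a t *\<^sub>R f') (at t within S)"
    using assms(1,2) unfolding has_vector_derivative_iff_tendsto continuous_within by (rule tendsto_scaleR)
  then show ?thesis by (simp add: has_vector_derivative_iff_tendsto assms(3))
qed

lemma bounded_bilinear_matrix_vector_mult: "bounded_bilinear ((*v) :: real^'n^'m \<Rightarrow> _)"
  by (simp add: bilinear_conv_bounded_bilinear[symmetric] bilinear_def matrix_vector_mul_linear)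
     (auto intro!: linearI simp: matrix_vector_simps)

lemma bounded_bilinear_matrix_mult: "bounded_bilinear ((**) :: real^'n^'m \<Rightarrow> real^'k^'n \<Rightarrow> _)"
  by (auto simp: bilinear_conv_bounded_bilinear[symmetric] bilinear_def intro!: linearI
     simp: vec_eq_iff matrix_matrix_mult_def sum.distrib sum_distrib_left algebra_simps)

lemmas has_vector_derivative_matrix_vector_mult = bounded_bilinear.has_vector_derivative[OF bounded_bilinear_matrix_vector_mult]
  and has_vector_derivative_matrix_mult = bounded_bilinear.has_vector_derivative[OF bounded_bilinear_matrix_mult]

lemma bounded_bilinear_cross: "bounded_bilinear (\<times>)"
  using bilinear_cross by (simp add: bilinear_conv_bounded_bilinear)

lemmas has_vector_derivative_cross = bounded_bilinear.has_vector_derivative[OF bounded_bilinear_cross]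

text \<open>The first line explains \<open>coef_T2\<close>: it is the derivative of
  \<open>coef_A\<close> divided by \<theta>, and so accounts for the last term of
  \<open>T_mat\<close>.\<close>

lemma coef_deriv:
  assumes "0 < t" "t < pi"
  shows "(coef_A has_real_derivative t * coef_T2 t) (at t)"
    and "(coef_S1 has_real_derivative (t * sin t - 2 * (1 - cos t)) / t ^ 3) (at t)"
    and "(coef_S2 has_real_derivative (t * (1 - cos t) - 3 * (t - sin t)) / t ^ 4) (at t)"
    and "(angle_ratio has_real_derivative (sin t - t * cos t) / (sin t)\<^sup>2) (at t)"
proof -
  have s: "sin t > 0" using assms by (simp add: sin_gt_zero)
  have sc: "sin t * sin t = 1 - cos t * cos t" using sin_squared_eq[of t] by (simp add: power2_eq_square)
  \<comment> \<open>Near a positive \<open>t\<close> the case distinction at 0 in the coefficients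
    is invisible.\<close>
  have ev: "\<forall>\<^sub>F x in nhds t. x \<noteq> 0"
    using assms by (intro t1_space_nhds) auto
  have "((\<lambda>\<theta>. 1 / \<theta>\<^sup>2 - (1 + cos \<theta>) / (2 * \<theta> * sin \<theta>)) has_real_derivative 
     - 2 / t ^ 3 - ((- sin t) * (2 * t * sin t) - (1 + cos t) * (2 * sin t + 2 * t * cos t)) / (2 * t * sin t)\<^sup>2) (at t)"
    using assms s by (auto intro!: derivative_eq_intros simp: field_simps power2_eq_square power3_eq_cube)
  also have "- 2 / t ^ 3 - ((- sin t) * (2 * t * sin t) - (1 + cos t) * (2 * sin t + 2 * t * cos t)) / (2 * t * sin t)\<^sup>2 = t * coef_T2 t"
  proof -
    \<comment> \<open>Writing \<open>sin^2\<close> as \<open>(1 - cos) (1 + cos)\<close> makes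
      \<open>1 + cos\<close> a common factor.\<close>
    have N: "((- sin t) * (2 * t * sin t) - (1 + cos t) * (2 * sin t + 2 * t * cos t)) = - 2 * (1 + cos t) * (t + sin t)"
      using sc by algebra
    have "((- sin t) * (2 * t * sin t) - (1 + cos t) * (2 * sin t + 2 * t * cos t)) / (2 * t * sin t)\<^sup>2
       = - t * ((1 + cos t) * (t + sin t) / (2 * t^3 * (sin t)\<^sup>2))"
      unfolding N using assms s
      by (simp add: divide_simps power2_eq_square power3_eq_cube) (simp add: algebra_simps)
    moreover have "t * (2 / t ^ 4) = 2 / t ^ 3" using assms by (simp add: power_def field_simps eval_nat_numeral)
    ultimately show ?thesis using assms unfolding coef_T2_def by (simp add: right_diff_distrib)
  qed
  finally show "(coef_A has_real_derivative t * coef_T2 t) (at t)"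
    by (rule DERIV_cong_ev[THEN iffD1, rotated -1, OF _ refl _ refl])
       (use ev in \<open>auto simp: coef_A_def elim: eventually_mono\<close>)
  have "((\<lambda>\<theta>. (1 - cos \<theta>) / \<theta>\<^sup>2) has_real_derivative (t * sin t - 2 * (1 - cos t)) / t ^ 3) (at t)"
    using assms by (auto intro!: derivative_eq_intros simp: field_simps power2_eq_square power3_eq_cube)
  then show "(coef_S1 has_real_derivative (t * sin t - 2 * (1 - cos t)) / t ^ 3) (at t)"
    by (rule DERIV_cong_ev[THEN iffD1, rotated -1, OF _ refl _ refl])
       (use ev in \<open>auto simp: coef_S1_def elim: eventually_mono\<close>)
  have "((\<lambda>\<theta>. (\<theta> - sin \<theta>) / \<theta>^3) has_real_derivative (t * (1 - cos t) - 3 * (t - sin t)) / t ^ 4) (at t)"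
    using assms by (auto intro!: derivative_eq_intros simp: field_simps eval_nat_numeral)
  then show "(coef_S2 has_real_derivative (t * (1 - cos t) - 3 * (t - sin t)) / t ^ 4) (at t)"
    by (rule DERIV_cong_ev[THEN iffD1, rotated -1, OF _ refl _ refl])
       (use ev in \<open>auto simp: coef_S2_def elim: eventually_mono\<close>)
  have "((\<lambda>\<theta>. \<theta> / sin \<theta>) has_real_derivative (sin t - t * cos t) / (sin t)\<^sup>2) (at t)"
    using assms s by (auto intro!: derivative_eq_intros simp: field_simps power2_eq_square)
  then show "(angle_ratio has_real_derivative (sin t - t * cos t) / (sin t)\<^sup>2) (at t)"
    by (rule DERIV_cong_ev[THEN iffD1, rotated -1, OF _ refl _ refl])
       (use ev in \<open>auto simp: angle_ratio_def elim: eventually_mono\<close>)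
qed

lemma coef_isCont:
  assumes "0 \<le> t" "t < pi"
  shows "isCont coef_A t" "isCont coef_S1 t" "isCont coef_S2 t" "isCont angle_ratio t"
proof -
  have "isCont angle_ratio 0"
    unfolding angle_ratio_def by (rule filled_isCont) real_asymp
  then have "isCont coef_A t \<and> isCont coef_S1 t \<and> isCont coef_S2 t \<and> isCont angle_ratio t"
    using coef_deriv[of t, THEN DERIV_isCont] assms coef_A_isCont coef_S1_isCont coef_S2_isCont
    by (cases "t = 0") auto
  then show "isCont coef_A t" "isCont coef_S1 t" "isCont coef_S2 t" "isCont angle_ratio t" by auto
qed

lemma has_vector_derivative_norm_chain:
  fixes \<Theta> :: "real \<Rightarrow> 'a::real_inner"
  assumes "(\<Theta> has_vector_derivative d) (at t within S)" "\<Theta> t \<noteq> 0" 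
    "(h has_real_derivative h') (at (norm (\<Theta> t)))"
  shows "((\<lambda>s. h (norm (\<Theta> s))) has_real_derivative h' * (\<Theta> t \<bullet> d / norm (\<Theta> t))) (at t within S)"
proof -
  have "((\<lambda>s. norm (\<Theta> s)) has_derivative (\<lambda>x. (x *\<^sub>R d) \<bullet> sgn (\<Theta> t))) (at t within S)"
    using has_derivative_compose[OF assms(1)[unfolded has_vector_derivative_def] has_derivative_norm[OF assms(2)]] .
  then have "((\<lambda>s. norm (\<Theta> s)) has_real_derivative (\<Theta> t \<bullet> d / norm (\<Theta> t))) (at t within S)"
    unfolding has_field_derivative_def
    by (rule has_derivative_eq_rhs) (auto simp: sgn_div_norm fun_eq_iff inner_commute divide_inverse)
  from DERIV_chain2[OF assms(3) this] show ?thesis .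
qed

text \<open>The first two compare the coefficients of \<open>X\<close> and \<open>X^2\<close> in
  \<open>A(-\<Theta>) R = A(\<Theta>)\<close>. The third says that \<open>coef_T1\<close> is
  \<open>2 coef_A\<close> plus \<open>t\<close> times the derivative of \<open>coef_A\<close>; this
  is the factor of \<open>b\<close> when \<open>A(-\<Theta>) b\<close> is differentiated.\<close>

lemma rodrigues_coef_identities:
  assumes "0 \<le> t" "t < pi"
  shows "1 - t\<^sup>2 * coef_S2 t - t\<^sup>2 * (coef_A t * (1 - t\<^sup>2 * coef_S2 t) - coef_S1 t / 2) = 1"
    and "coef_S1 t - (1 - t\<^sup>2 * coef_S2 t) / 2 - t\<^sup>2 * coef_A t * coef_S1 t = 0"
    and "coef_T1 t = 2 * coef_A t + t\<^sup>2 * coef_T2 t"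
proof -
  consider "t = 0" | "t > 0" using assms by linarith
  then have "1 - t\<^sup>2 * coef_S2 t - t\<^sup>2 * (coef_A t * (1 - t\<^sup>2 * coef_S2 t) - coef_S1 t / 2) = 1
    \<and> coef_S1 t - (1 - t\<^sup>2 * coef_S2 t) / 2 - t\<^sup>2 * coef_A t * coef_S1 t = 0
    \<and> coef_T1 t = 2 * coef_A t + t\<^sup>2 * coef_T2 t"
  proof cases
    case 2
    define s c where "s = sin t" and "c = cos t"
    have s: "s > 0" using 2 assms by (simp add: s_def sin_gt_zero)
    have sc: "s * s = 1 - c * c" using sin_squared_eq[of t] by (simp add: s_def c_def power2_eq_square)
    have S1: "t\<^sup>2 * coef_S1 t = 1 - c" and S2: "t ^ 3 * coef_S2 t = t - s"
      by (simp_all add: coef_S1_mult coef_S2_mult c_def s_def)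
    have A: "2 * t\<^sup>2 * s * coef_A t = 2 * s - t * (1 + c)"
      using 2 s by (simp add: coef_A_def s_def[symmetric] c_def[symmetric] field_simps power2_eq_square)
    have S2': "t * (1 - t\<^sup>2 * coef_S2 t) = s" using S2 by algebra
    have "2 * s * t * (1 - t\<^sup>2 * coef_S2 t - t\<^sup>2 * (coef_A t * (1 - t\<^sup>2 * coef_S2 t) - coef_S1 t / 2) - 1)
      = 2 * s * (t * (1 - t\<^sup>2 * coef_S2 t)) - 2 * t\<^sup>2 * s * coef_A t * (t * (1 - t\<^sup>2 * coef_S2 t)) + s * t * (t\<^sup>2 * coef_S1 t) - 2 * s * t"
      by algebra
    also have "\<dots> = 0" unfolding S1 S2' A by (simp add: algebra_simps)
    finally have 1: "1 - t\<^sup>2 * coef_S2 t - t\<^sup>2 * (coef_A t * (1 - t\<^sup>2 * coef_S2 t) - coef_S1 t / 2) = 1"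
      using 2 s by simp
    have "2 * s * t\<^sup>2 * (coef_S1 t - (1 - t\<^sup>2 * coef_S2 t) / 2 - t\<^sup>2 * coef_A t * coef_S1 t)
      = 2 * s * (t\<^sup>2 * coef_S1 t) - s * t * (t * (1 - t\<^sup>2 * coef_S2 t)) - 2 * t\<^sup>2 * s * coef_A t * (t\<^sup>2 * coef_S1 t)"
      by algebra
    also have "\<dots> = 0" unfolding S1 S2' A using sc by algebra
    finally have 3: "coef_S1 t - (1 - t\<^sup>2 * coef_S2 t) / 2 - t\<^sup>2 * coef_A t * coef_S1 t = 0" using 2 s by simp
    have e2: "t\<^sup>2 * coef_T2 t = (1 + c) * (t + s) / (2 * t * s\<^sup>2) - 2 / t\<^sup>2"
      using 2 s unfolding coef_T2_def s_def[symmetric] c_def[symmetric]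
      by (simp add: field_simps eval_nat_numeral)
    have e1: "coef_A t = 1 / t\<^sup>2 - (1 + c) * s / (2 * t * s\<^sup>2)"
      using 2 s unfolding coef_A_def s_def[symmetric] c_def[symmetric] by (simp add: power2_eq_square)
    have e3: "coef_T1 t = (1 + c) * (t - s) / (2 * t * s\<^sup>2)"
      using 2 by (simp add: coef_T1_def s_def c_def)
    have "coef_T1 t = 2 * coef_A t + t\<^sup>2 * coef_T2 t"
      unfolding e1 e2 e3 using 2 s by (simp add: divide_simps) (simp add: algebra_simps power2_eq_square)
    with 1 3 show ?thesis by simp
  qed (simp add: coef_A_def coef_S1_def coef_S2_def coef_T1_def)
  then show "1 - t\<^sup>2 * coef_S2 t - t\<^sup>2 * (coef_A t * (1 - t\<^sup>2 * coef_S2 t) - coef_S1 t / 2) = 1"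
    "coef_S1 t - (1 - t\<^sup>2 * coef_S2 t) / 2 - t\<^sup>2 * coef_A t * coef_S1 t = 0"
    "coef_T1 t = 2 * coef_A t + t\<^sup>2 * coef_T2 t" by blast+
qed

text \<open>The matrices \<open>A(-\<Theta>)\<close> and \<open>A(\<Theta>)\<close> invert the left
  and right Jacobians \<open>S(\<Theta>)\<close> and \<open>S(-\<Theta>)\<close> of the exponential,
  and these differ by the rotation. It turns the translational velocity \<open>R v\<close> into
  \<open>A(\<Theta>) v\<close>.\<close>

lemma A_mat_rodrigues:
  assumes "norm \<Theta> < pi"
  shows "A_mat (- \<Theta>) *v (rodrigues \<Theta> *v x) = A_mat \<Theta> *v x"
proof -
  let ?t = "norm \<Theta>"
  have "A_mat (- \<Theta>) *v (rodrigues \<Theta> *v x) = A_mat \<Theta> *v x 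
     + (1 - ?t\<^sup>2 * coef_S2 ?t - ?t\<^sup>2 * (coef_A ?t * (1 - ?t\<^sup>2 * coef_S2 ?t) - coef_S1 ?t / 2) - 1) *\<^sub>R (\<Theta> \<times> x)
     + (coef_S1 ?t - (1 - ?t\<^sup>2 * coef_S2 ?t) / 2 - ?t\<^sup>2 * coef_A ?t * coef_S1 ?t) *\<^sub>R (\<Theta> \<times> (\<Theta> \<times> x))"
    unfolding A_mat_mult A_mat_uminus_mult rodrigues_mult
    by (simp add: vec_eq_iff cross_linear cross_cross_cross field_simps)
  then show ?thesis using rodrigues_coef_identities[of ?t] assms by simp
qed

lemma rot_axis_mult_skew: "rot_axis (skew w) = w" "rot_axis (skew a ** skew w) = (1/2) *\<^sub>R (a \<times> w)"
  "rot_axis (skew a ** skew a ** skew w) = - ((norm a)\<^sup>2 *\<^sub>R w + (1/2) *\<^sub>R (a \<times> (a \<times> w)))"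
  by (simp_all add: rot_axis_def vec_eq_iff forall_3 skew_entries matrix_matrix_mult_def sum_3 
    cross_components power2_norm_eq_inner inner_vec_def field_simps)

lemma trace_mult_skew: "trace (skew a ** skew w) = - 2 * (a \<bullet> w)" "trace (skew a ** skew a ** skew w) = 0"
  by (simp_all add: trace_def skew_entries matrix_matrix_mult_def sum_3 inner_vec_def algebra_simps)

lemma rodrigues_mult_skew:
  defines "s \<equiv> \<lambda>\<Theta>. 1 - (norm \<Theta>)\<^sup>2 * coef_S2 (norm \<Theta>)"
  shows "rodrigues \<Theta> ** skew w = skew w + s \<Theta> *\<^sub>R (skew \<Theta> ** skew w) + coef_S1 (norm \<Theta>) *\<^sub>R (skew \<Theta> ** skew \<Theta> ** skew w)"
  by (simp add: matrix_eq matrix_vector_simps rodrigues_mult s_def)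

lemma rot_log_has_vector_derivative:
  assumes R': "(R has_vector_derivative R t ** skew w) (at t within I)" and t: "t \<in> I"
    and rot: "\<And>s. s \<in> I \<Longrightarrow> rotation_matrix (R s)" and lt: "\<And>s. s \<in> I \<Longrightarrow> principal_angle (R s) < pi"
  shows "((\<lambda>s. rot_log (R s)) has_vector_derivative A_mat (rot_log (R t)) *v w) (at t within I)"
proof -
  define \<Theta> \<theta> where "\<Theta> = rot_log (R t)" and "\<theta> = principal_angle (R t)"
  define c where "c s = (trace (R s) - 1) / 2" for s
  define q where "q s = rot_axis (R s)" for s
  let ?s = "1 - \<theta>\<^sup>2 * coef_S2 \<theta>"
  have Rt: "R t = rodrigues \<Theta>" and n: "norm \<Theta> = \<theta>" using rodrigues_rot_log[OF rot[OF t] lt[OF t]] by (simp_all add: \<Theta>_def \<theta>_def)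
  have \<theta>: "0 \<le> \<theta>" "\<theta> < pi" using n lt[OF t] norm_ge_zero[of \<Theta>] by (auto simp: \<theta>_def)
  define q' where "q' = w + (?s / 2) *\<^sub>R (\<Theta> \<times> w) - coef_S1 \<theta> *\<^sub>R (\<theta>\<^sup>2 *\<^sub>R w + (1/2) *\<^sub>R (\<Theta> \<times> (\<Theta> \<times> w)))"
  have q'eq: "rot_axis (R t ** skew w) = q'"
    unfolding Rt rodrigues_mult_skew by (simp add: rot_axis_mult_skew n q'_def) (simp add: algebra_simps)
  have q: "(q has_vector_derivative q') (at t within I)"
    using bounded_linear.has_vector_derivative[OF bounded_linear_rot_axis R'] by (simp add: q'eq q_def[abs_def])
  have qt: "q t = ?s *\<^sub>R \<Theta>" by (simp add: q_def Rt rodrigues_def n)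
  have "trace (R t ** skew w) = - 2 * ?s * (\<Theta> \<bullet> w)"
    unfolding Rt rodrigues_mult_skew by (simp add: trace_mult_skew n) (simp add: algebra_simps)
  then have "((\<lambda>s. trace (R s)) has_real_derivative - 2 * ?s * (\<Theta> \<bullet> w)) (at t within I)"
    using bounded_linear.has_vector_derivative[OF bounded_linear_trace R'] 
    by (simp add: has_real_derivative_iff_has_vector_derivative)
  then have c: "(c has_real_derivative - ?s * (\<Theta> \<bullet> w)) (at t within I)"
    unfolding c_def[abs_def] by (auto intro!: derivative_eq_intros simp: field_simps)
  have cb: "c s \<in> {-1..1}" if "s \<in> I" for s
    using rodrigues_rot_log(3)[OF rot lt] that by (auto simp: c_def)
  have pa: "principal_angle (R s) = arccos (c s)" for s by (simp add: principal_angle_def c_def)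
  have ct: "c t = cos \<theta>" using cb[OF t] by (simp add: \<theta>_def pa)
  have L: "rot_log (R s) = angle_ratio (arccos (c s)) *\<^sub>R q s" for s by (simp add: rot_log_def q_def pa)
  have ar: "arccos (c t) = \<theta>" by (simp add: \<theta>_def pa)
  show ?thesis
  proof (cases "\<theta> = 0")
    case True
    then have "\<Theta> = 0" using n by simp
    \<comment> \<open>At the identity \<open>arccos\<close> is not differentiable, but
      \<open>q\<close> vanishes there, so continuity of the angle factor suffices. The curve
      \<open>c\<close> stays in the domain of \<open>arccos\<close> because \<open>R\<close> stays
      in the rotation group on \<open>I\<close>.\<close>
    have "continuous (at t within I) (\<lambda>s. arccos (c s))"
    proof -
      have "(c \<longlongrightarrow> c t) (at t within I)" using DERIV_continuous[OF c] by (simp add: continuous_within)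
      moreover have "\<forall>\<^sub>F s in at t within I. c s \<in> {-1..1}"
        unfolding eventually_at_filter by (rule always_eventually) (use cb in blast)
      ultimately show ?thesis
        unfolding continuous_within by (rule continuous_on_tendsto_compose[OF continuous_on_arccos' _ cb[OF t]])
    qed
    then have "continuous (at t within I) (\<lambda>s. angle_ratio (arccos (c s)))"
      using isCont_tendsto_compose[OF coef_isCont(4)[OF \<theta>]] by (simp add: continuous_within ar)
    from has_vector_derivative_vanishing_product[OF this q]
    have "((\<lambda>s. rot_log (R s)) has_vector_derivative angle_ratio \<theta> *\<^sub>R q') (at t within I)"
      by (simp add: L ar qt \<open>\<Theta> = 0\<close>)
    moreover have "angle_ratio \<theta> *\<^sub>R q' = A_mat \<Theta> *v w" using True \<open>\<Theta> = 0\<close> by (simp add: angle_ratio_def q'_def A_mat_mult)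
    ultimately show ?thesis by (simp add: \<Theta>_def)
  next
    case False
    then have pos: "0 < \<theta>" using \<theta> by simp
    then have s: "0 < sin \<theta>" using \<theta> by (simp add: sin_gt_zero)
    \<comment> \<open>Strict bounds, as required by the derivative of \<open>arccos\<close>.\<close>
    have c1: "- 1 < c t" "c t < 1" 
      using cos_monotone_0_pi[of 0 \<theta>] cos_monotone_0_pi[of \<theta> pi] pos \<theta> ct by auto
    have sq: "sqrt (1 - (c t)\<^sup>2) = sin \<theta>" using s by (simp add: ct sin_squared_eq[symmetric])
    have "((\<lambda>s. arccos (c s)) has_real_derivative ?s * (\<Theta> \<bullet> w) / sin \<theta>) (at t within I)"
      using DERIV_chain2[OF DERIV_arccos[OF c1] c] by (rule DERIV_cong) (simp add: sq divide_inverse algebra_simps)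
    moreover have "(angle_ratio has_real_derivative (sin \<theta> - \<theta> * cos \<theta>) / (sin \<theta>)\<^sup>2) (at (arccos (c t)))"
      using coef_deriv(4)[OF pos \<theta>(2)] by (simp add: ar)
    ultimately have "((\<lambda>s. angle_ratio (arccos (c s))) has_real_derivative 
       (sin \<theta> - \<theta> * cos \<theta>) / (sin \<theta>)\<^sup>2 * (?s * (\<Theta> \<bullet> w) / sin \<theta>)) (at t within I)" by (rule DERIV_chain2[rotated])
    from has_vector_derivative_scaleR[OF this q]
    have "((\<lambda>s. rot_log (R s)) has_vector_derivative angle_ratio \<theta> *\<^sub>R q' +
       ((sin \<theta> - \<theta> * cos \<theta>) / (sin \<theta>)\<^sup>2 * (?s * (\<Theta> \<bullet> w) / sin \<theta>)) *\<^sub>R (?s *\<^sub>R \<Theta>)) (at t within I)"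
      by (simp add: L[abs_def] qt ar)
    moreover have "angle_ratio \<theta> *\<^sub>R q' +
       ((sin \<theta> - \<theta> * cos \<theta>) / (sin \<theta>)\<^sup>2 * (?s * (\<Theta> \<bullet> w) / sin \<theta>)) *\<^sub>R (?s *\<^sub>R \<Theta>) = A_mat \<Theta> *v w"
    proof -
      define S C where "S = sin \<theta>" and "C = cos \<theta>"
      have SC: "S * S = 1 - C * C" using sin_squared_eq[of \<theta>] by (simp add: S_def C_def power2_eq_square)
      have "S > 0" using s by (simp add: S_def)
      have e1: "?s = S / \<theta>" using pos by (simp add: coef_S2_def S_def field_simps power2_eq_square power3_eq_cube)
      have e2: "angle_ratio \<theta> = \<theta> / S" using pos by (simp add: angle_ratio_def S_def)
      have e3: "coef_S1 \<theta> = (1 - C) / \<theta>\<^sup>2" using pos by (simp add: coef_S1_def C_def)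
      have e4: "coef_A \<theta> = 1 / \<theta>\<^sup>2 - (1 + C) / (2 * \<theta> * S)" using pos by (simp add: coef_A_def S_def C_def)
      \<comment> \<open>This leaves only \<open>w\<close>, \<open>\<Theta> \<times> w\<close> and
        \<open>\<Theta> \<times> (\<Theta> \<times> w)\<close>, the vectors in which
        \<open>A_mat \<Theta> *v w\<close> is expressed.\<close>
      have tw: "(\<Theta> \<bullet> w) *\<^sub>R \<Theta> = \<Theta> \<times> (\<Theta> \<times> w) + \<theta>\<^sup>2 *\<^sub>R w" by (simp add: Lagrange n[symmetric] power2_norm_eq_inner)
      have "((S - \<theta> * C) / S\<^sup>2 * (S / \<theta> * (\<Theta> \<bullet> w) / S)) *\<^sub>R ((S / \<theta>) *\<^sub>R \<Theta>) = ((S - \<theta> * C) / (S * \<theta>\<^sup>2)) *\<^sub>R ((\<Theta> \<bullet> w) *\<^sub>R \<Theta>)"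
        using pos \<open>S > 0\<close> by (simp add: field_simps power2_eq_square)
      also have "\<dots> = ((S - \<theta> * C) / (S * \<theta>\<^sup>2)) *\<^sub>R (\<Theta> \<times> (\<Theta> \<times> w)) + ((S - \<theta> * C) / S) *\<^sub>R w"
        unfolding tw using pos \<open>S > 0\<close> by (simp add: scaleR_right_distrib)
      finally have f: "((S - \<theta> * C) / S\<^sup>2 * (S / \<theta> * (\<Theta> \<bullet> w) / S)) *\<^sub>R ((S / \<theta>) *\<^sub>R \<Theta>) = \<dots>" .
      have g1: "angle_ratio \<theta> *\<^sub>R q' = (\<theta> * C / S) *\<^sub>R w + (1/2) *\<^sub>R (\<Theta> \<times> w) - ((1 - C) / (2 * \<theta> * S)) *\<^sub>R (\<Theta> \<times> (\<Theta> \<times> w))"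
        unfolding q'_def e1 e2 e3 using pos \<open>S > 0\<close> 
        by (simp add: vec_eq_iff divide_simps power2_eq_square) (simp add: algebra_simps)
      have g2: "(S - \<theta> * C) / S = 1 - \<theta> * C / S" using \<open>S > 0\<close> by (simp add: field_simps)
      have g3: "coef_A \<theta> = (S - \<theta> * C) / (S * \<theta>\<^sup>2) - (1 - C) / (2 * \<theta> * S)"
        unfolding e4 using pos \<open>S > 0\<close> by (simp add: divide_simps power2_eq_square) (simp add: algebra_simps)
      show ?thesis
        unfolding S_def[symmetric] C_def[symmetric] e1 f g1 A_mat_mult n g2 g3 by (simp add: algebra_simps)
    qed
    ultimately show ?thesis by (simp add: \<Theta>_def)
  qed
qed

section \<open>The translational part of the logarithm and the matrix \<open>G\<close>\<close>

lemma bounded_linear_rot_part: "bounded_linear rot_part"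
  and bounded_linear_pos_part: "bounded_linear pos_part"
  by (auto intro!: linear_conv_bounded_linear[THEN iffD1] linearI simp: rot_part_def pos_part_def vec_eq_iff)

lemma rot_part_block_mat [simp]: "rot_part (block_mat A B C D) = A"
  and pos_part_block_mat [simp]: "pos_part (block_mat A (columnvector b) C D) = b"
  by (simp_all add: rot_part_def pos_part_def block_mat_def columnvector_def vec_eq_iff)

lemma has_vector_derivative_join:
  assumes "(a has_vector_derivative a') (at t within S)" "(b has_vector_derivative b') (at t within S)"
  shows "((\<lambda>s. join (a s) (b s)) has_vector_derivative join a' b') (at t within S)"
proof -
  have "bounded_linear (\<lambda>p. join (fst p) (snd p))"
    by (auto intro!: linear_conv_bounded_linear[THEN iffD1] linearI simp: vec_eq_blocks)
  from bounded_linear.has_vector_derivative[OF this has_vector_derivative_Pair[OF assms]] 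
  show ?thesis by simp
qed

text \<open>The terms are arranged so that they become \<open>T_mat\<close> once
  \<open>d = A(\<Theta>) w\<close> and \<open>b = S(\<Theta>) \<beta>\<close> are inserted. All
  double cross products are expanded by Lagrange's formula.\<close>

lemma has_vector_derivative_A_mat_uminus_mult:
  fixes \<Theta> b :: "real \<Rightarrow> real^3"
  assumes T: "(\<Theta> has_vector_derivative d) (at t within S)" and b: "(b has_vector_derivative b') (at t within S)"
    and lt: "norm (\<Theta> t) < pi"
  shows "((\<lambda>s. A_mat (- \<Theta> s) *v b s) has_vector_derivative
     A_mat (- \<Theta> t) *v b' + (1/2) *\<^sub>R (b t \<times> d)
     + coef_A (norm (\<Theta> t)) *\<^sub>R ((b t \<bullet> d) *\<^sub>R \<Theta> t + (\<Theta> t \<bullet> b t) *\<^sub>R d)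
     - (coef_T1 (norm (\<Theta> t)) * (\<Theta> t \<bullet> d)) *\<^sub>R b t
     + (coef_T2 (norm (\<Theta> t)) * (\<Theta> t \<bullet> b t) * (\<Theta> t \<bullet> d)) *\<^sub>R \<Theta> t) (at t within S)"
proof -
  let ?a = "coef_A (norm (\<Theta> t))" and ?h = "coef_T2 (norm (\<Theta> t))"
  define p where "p s = \<Theta> s \<times> (\<Theta> s \<times> b s)" for s
  define p' where "p' = d \<times> (\<Theta> t \<times> b t) + \<Theta> t \<times> (d \<times> b t) + \<Theta> t \<times> (\<Theta> t \<times> b')"
  have p: "(p has_vector_derivative p') (at t within S)"
    using has_vector_derivative_cross[OF T has_vector_derivative_cross[OF T b]]
    by (simp add: p_def[abs_def] p'_def cross_linear add_ac)
  \<comment> \<open>The double cross product is quadratic in \<Theta> and vanishes at \<Theta> = 0,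
    where the coefficient is merely known to be continuous.\<close>
  have ap: "((\<lambda>s. coef_A (norm (\<Theta> s)) *\<^sub>R p s) has_vector_derivative ?a *\<^sub>R p' + (?h * (\<Theta> t \<bullet> d)) *\<^sub>R p t) (at t within S)"
  proof (cases "\<Theta> t = 0")
    case True
    have "continuous (at t within S) (\<lambda>s. coef_A (norm (\<Theta> s)))"
      using isCont_tendsto_compose[OF coef_isCont(1) tendsto_norm] lt has_vector_derivative_continuous[OF T]
      by (simp add: continuous_within)
    from has_vector_derivative_vanishing_product[OF this p] show ?thesis by (simp add: True p_def)
  next
    case False
    have "((\<lambda>s. coef_A (norm (\<Theta> s))) has_real_derivative ?h * (\<Theta> t \<bullet> d)) (at t within S)"
      using has_vector_derivative_norm_chain[OF T False coef_deriv(1)] False lt by simp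
    from has_vector_derivative_scaleR[OF this p] show ?thesis by simp
  qed
  have D: "((\<lambda>s. b s - (1/2) *\<^sub>R (\<Theta> s \<times> b s) + coef_A (norm (\<Theta> s)) *\<^sub>R p s) has_vector_derivative
     b' - (1/2) *\<^sub>R (\<Theta> t \<times> b' + d \<times> b t) + (?a *\<^sub>R p' + (?h * (\<Theta> t \<bullet> d)) *\<^sub>R p t)) (at t within S)"
    by (rule derivative_eq_intros has_vector_derivative_cross T b ap refl)+ simp
  have E: "b' - (1/2) *\<^sub>R (\<Theta> t \<times> b' + d \<times> b t) + (?a *\<^sub>R p' + (?h * (\<Theta> t \<bullet> d)) *\<^sub>R p t) =
     A_mat (- \<Theta> t) *v b' + (1/2) *\<^sub>R (b t \<times> d)
     + coef_A (norm (\<Theta> t)) *\<^sub>R ((b t \<bullet> d) *\<^sub>R \<Theta> t + (\<Theta> t \<bullet> b t) *\<^sub>R d)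
     - (coef_T1 (norm (\<Theta> t)) * (\<Theta> t \<bullet> d)) *\<^sub>R b t
     + (coef_T2 (norm (\<Theta> t)) * (\<Theta> t \<bullet> b t) * (\<Theta> t \<bullet> d)) *\<^sub>R \<Theta> t"
  proof -
    have 1: "d \<times> b t = - (b t \<times> d)" by (rule cross_skew)
    have 2: "d \<times> (\<Theta> t \<times> b t) = (b t \<bullet> d) *\<^sub>R \<Theta> t - (\<Theta> t \<bullet> d) *\<^sub>R b t"
      "\<Theta> t \<times> (d \<times> b t) = (\<Theta> t \<bullet> b t) *\<^sub>R d - (\<Theta> t \<bullet> d) *\<^sub>R b t"
      "p t = (\<Theta> t \<bullet> b t) *\<^sub>R \<Theta> t - (norm (\<Theta> t))\<^sup>2 *\<^sub>R b t"
      by (simp_all add: Lagrange inner_commute p_def power2_norm_eq_inner)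
    show ?thesis
      unfolding p'_def 2 A_mat_uminus_mult rodrigues_coef_identities(3)[OF norm_ge_zero lt]
      unfolding 1 by (simp add: vec_eq_iff algebra_simps)
  qed
  have "(\<lambda>s. A_mat (- \<Theta> s) *v b s) = (\<lambda>s. b s - (1/2) *\<^sub>R (\<Theta> s \<times> b s) + coef_A (norm (\<Theta> s)) *\<^sub>R p s)"
    by (simp add: A_mat_uminus_mult p_def)
  then show ?thesis using D unfolding E by simp
qed

text \<open>A skew matrix changes sign under transposition, so \<open>A(-\<Theta>)\<close> is the
  transpose of \<open>A(\<Theta>)\<close>.\<close>

lemma A_mat_adjoint: "(A_mat (- \<Theta>) *v x) \<bullet> y = x \<bullet> (A_mat \<Theta> *v y)"
proof -
  have "(a \<times> x) \<bullet> y = - (x \<bullet> (a \<times> y))" for a x y by (metis cross_triple cross_skew inner_commute inner_minus_left)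
  then show ?thesis by (simp add: A_mat_uminus_mult A_mat_mult inner_simps)
qed

lemma A_mat_self: "A_mat \<Theta> *v \<Theta> = \<Theta>" "A_mat (- \<Theta>) *v \<Theta> = \<Theta>"
  by (simp_all add: A_mat_mult A_mat_uminus_mult)

lemma G_mat_mult:
  "fst_block (G_mat \<eta> *v \<zeta>) = A_mat (fst_block \<eta>) *v fst_block \<zeta>"
  "snd_block (G_mat \<eta> *v \<zeta>) = T_mat (fst_block \<eta>) (snd_block \<eta>) *v fst_block \<zeta> + A_mat (fst_block \<eta>) *v snd_block \<zeta>"
  by (simp_all add: G_mat_def)

lemma T_mat_mult:
  "T_mat \<Theta> \<beta> *v w = (1/2) *\<^sub>R ((S_mat \<Theta> *v \<beta>) \<times> (A_mat \<Theta> *v w))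
     + coef_A (norm \<Theta>) *\<^sub>R ((\<beta> \<bullet> w) *\<^sub>R \<Theta> + (\<Theta> \<bullet> \<beta>) *\<^sub>R (A_mat \<Theta> *v w))
     - (coef_T1 (norm \<Theta>) * (\<Theta> \<bullet> w)) *\<^sub>R (S_mat \<Theta> *v \<beta>)
     + (coef_T2 (norm \<Theta>) * (\<Theta> \<bullet> \<beta>) * (\<Theta> \<bullet> w)) *\<^sub>R \<Theta>"
  by (simp add: T_mat_def matrix_vector_simps)

theorem pose_log_has_vector_derivative:
  assumes g': "(g has_vector_derivative g t ** hat \<zeta>) (at t within I)" and t: "t \<in> I"
    and SE3: "\<And>s. s \<in> I \<Longrightarrow> g s \<in> SE3" and lt: "\<And>s. s \<in> I \<Longrightarrow> principal_angle (rot_part (g s)) < pi"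
  shows "((\<lambda>s. pose_log (g s)) has_vector_derivative G_mat (pose_log (g t)) *v \<zeta>) (at t within I)"
proof -
  define R b where "R s = rot_part (g s)" and "b s = pos_part (g s)" for s
  define w v where "w = fst_block \<zeta>" and "v = snd_block \<zeta>"
  define \<Theta> where "\<Theta> s = rot_log (R s)" for s
  define \<beta> where "\<beta> = A_mat (- \<Theta> t) *v b t"
  have rot: "rotation_matrix (R s)" if "s \<in> I" for s using SE3_rotation[OF SE3[OF that]] by (simp add: R_def)
  have g: "g t ** hat \<zeta> = block_mat (R t ** skew w) (columnvector (R t *v v)) 0 0"
    by (subst SE3_pose[OF SE3[OF t]]) (simp add: pose_mult_hat R_def w_def v_def)
  have R': "(R has_vector_derivative R t ** skew w) (at t within I)"
    using bounded_linear.has_vector_derivative[OF bounded_linear_rot_part g'] by (simp add: g R_def[abs_def])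
  have b': "(b has_vector_derivative R t *v v) (at t within I)"
    using bounded_linear.has_vector_derivative[OF bounded_linear_pos_part g'] by (simp add: g b_def[abs_def])
  have "principal_angle (R s) < pi" if "s \<in> I" for s using lt[OF that] by (simp add: R_def)
  note \<Theta>' = rot_log_has_vector_derivative[OF R' t rot this, folded \<Theta>_def]
  have lt': "norm (\<Theta> t) < pi" "rodrigues (\<Theta> t) = R t"
    using rodrigues_rot_log[OF rot[OF t]] lt[OF t] by (simp_all add: \<Theta>_def R_def)
  have Sb: "S_mat (\<Theta> t) *v \<beta> = b t" using S_mat_A_mat(1)[OF lt'(1)] by (simp add: \<beta>_def)
  \<comment> \<open>Inner products with the position \<open>b\<close> become inner products with
    \<beta>, because \<open>A(-\<Theta>)\<close> is the transpose of \<open>A(\<Theta>)\<close> and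
    fixes \<Theta>.\<close>
  have ip: "b t \<bullet> (A_mat (\<Theta> t) *v w) = \<beta> \<bullet> w" "\<Theta> t \<bullet> b t = \<Theta> t \<bullet> \<beta>" "\<Theta> t \<bullet> (A_mat (\<Theta> t) *v w) = \<Theta> t \<bullet> w"
    using A_mat_adjoint[of "\<Theta> t" "b t" w] A_mat_adjoint[of "\<Theta> t" "b t" "\<Theta> t"] A_mat_adjoint[of "\<Theta> t" "\<Theta> t" w]
    by (simp_all add: \<beta>_def A_mat_self inner_commute)
  have AR: "A_mat (- \<Theta> t) *v (R t *v v) = A_mat (\<Theta> t) *v v"
    using A_mat_rodrigues[OF lt'(1), of v] lt'(2) by simp
  have "((\<lambda>s. A_mat (- \<Theta> s) *v b s) has_vector_derivative T_mat (\<Theta> t) \<beta> *v w + A_mat (\<Theta> t) *v v) (at t within I)"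
    using has_vector_derivative_A_mat_uminus_mult[OF \<Theta>' b' lt'(1)]
    unfolding T_mat_mult Sb ip AR by (simp add: algebra_simps)
  from has_vector_derivative_join[OF \<Theta>' this]
  have "((\<lambda>s. pose_log (g s)) has_vector_derivative 
    join (A_mat (\<Theta> t) *v w) (T_mat (\<Theta> t) \<beta> *v w + A_mat (\<Theta> t) *v v)) (at t within I)"
    using lt by (simp add: pose_log_def \<Theta>_def R_def b_def)
  moreover have "join (A_mat (\<Theta> t) *v w) (T_mat (\<Theta> t) \<beta> *v w + A_mat (\<Theta> t) *v v) = G_mat (pose_log (g t)) *v \<zeta>"
    by (simp add: vec_eq_blocks G_mat_mult pose_log_def \<beta>_def \<Theta>_def R_def b_def w_def v_def)
  ultimately show ?thesis by simp
qed

section \<open>Pose error kinematics\<close>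

text \<open>As a rewrite rule it would turn \<open>transpose A *v x\<close> into a row vector times
  \<open>A\<close>; below, the matrix-vector form has to persist.\<close>

declare transpose_matrix_vector [simp del]

lemma pose_one [simp]: "pose (mat 1) 0 = mat 1"
  by (simp add: pose_def mat_1_block_mat)

lemma matrix_vector_mult_uminus: "A *v (- x) = - (A *v x)" for A :: "real^'n^'m"
  by (simp add: vec_eq_iff matrix_vector_mult_def sum_negf)

lemma matrix_inv_eqI:
  fixes A :: "real^'n^'n"
  assumes "A ** B = mat 1"
  shows "matrix_inv A = B"
proof -
  have "B ** A = mat 1" using assms by (simp add: matrix_left_right_inverse)
  with assms have "A ** matrix_inv A = mat 1 \<and> matrix_inv A ** A = mat 1"
    unfolding matrix_inv_def by (metis (mono_tags, lifting) someI_ex)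
  then show ?thesis by (metis assms matrix_mul_assoc matrix_mul_lid matrix_mul_rid)
qed

lemma rotation_matrix_transpose:
  assumes "rotation_matrix R"
  shows "R ** transpose R = mat 1" "transpose R ** R = mat 1" "rotation_matrix (transpose R)"
  using assms by (auto simp: rotation_matrix_def orthogonal_matrix_def)

lemma rotation_matrix_mult: "rotation_matrix A \<Longrightarrow> rotation_matrix B \<Longrightarrow> rotation_matrix (A ** B)"
  for A B :: "real^'n^'n"
  by (simp add: rotation_matrix_def orthogonal_matrix_mul det_mul)

lemma matrix_inv_pose:
  assumes "rotation_matrix R"
  shows "matrix_inv (pose R b) = pose (transpose R) (- (transpose R *v b))"
  by (rule matrix_inv_eqI)
     (simp add: pose_mult rotation_matrix_transpose[OF assms] matrix_vector_mul_assoc matrix_vector_mult_uminus)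

lemma SE3_mult: "g \<in> SE3 \<Longrightarrow> h \<in> SE3 \<Longrightarrow> g ** h \<in> SE3"
  by (auto simp: SE3_def pose_mult rotation_matrix_mult)

lemma SE3_inv:
  assumes "g \<in> SE3"
  shows "matrix_inv g \<in> SE3" "matrix_inv g ** g = mat 1" "g ** matrix_inv g = mat 1" "matrix_inv (matrix_inv g) = g"
proof -
  obtain R b where g: "g = pose R b" and R: "rotation_matrix R" using assms by (auto simp: SE3_def)
  show "matrix_inv g \<in> SE3" using R by (simp add: g matrix_inv_pose pose_in_SE3 rotation_matrix_transpose)
  show 1: "g ** matrix_inv g = mat 1"
    using R by (simp add: g matrix_inv_pose pose_mult rotation_matrix_transpose matrix_vector_mul_assoc 
       matrix_vector_mult_uminus)
  then show 2: "matrix_inv g ** g = mat 1" by (simp add: matrix_left_right_inverse)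
  show "matrix_inv (matrix_inv g) = g" by (rule matrix_inv_eqI) (rule 2)
qed

lemma skew_rotation:
  assumes "rotation_matrix R"
  shows "R ** skew w ** transpose R = skew (R *v w)"
proof -
  have "R *v (w \<times> (transpose R *v x)) = (R *v w) \<times> x" for x
    using cross_rotation_matrix[OF assms, of w "transpose R *v x"] 
    by (simp add: matrix_vector_mul_assoc rotation_matrix_transpose[OF assms])
  then show ?thesis by (simp add: matrix_eq matrix_vector_simps)
qed

lemma hat_Ad:
  assumes "g \<in> SE3"
  shows "g ** hat \<zeta> ** matrix_inv g = hat (Ad g *v \<zeta>)"
proof -
  obtain R b where g: "g = pose R b" and R: "rotation_matrix R" using assms by (auto simp: SE3_def)
  let ?w = "fst_block \<zeta>" and ?v = "snd_block \<zeta>"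
  have "g ** hat \<zeta> ** matrix_inv g = 
    block_mat (R ** skew ?w ** transpose R) (columnvector (- ((R ** skew ?w ** transpose R) *v b) + R *v ?v)) 0 0"
    using R by (simp add: g matrix_inv_pose pose_mult_hat) 
      (simp add: pose_def block_mat_mult matrix_vector_mul_assoc matrix_mul_assoc matrix_vector_mult_uminus)
  also have "\<dots> = hat (Ad g *v \<zeta>)"
    unfolding skew_rotation[OF R] skew_mult
    by (simp add: hat_def Ad_def g matrix_vector_simps cross_skew[of b])
  finally show ?thesis .
qed

text \<open>Under the injective map \<open>hat\<close>, \<open>Ad g\<close> is conjugation by
  \<open>g\<close>, so the claim is cancellation in the group.\<close>

lemma Ad_inv:
  assumes "g \<in> SE3"
  shows "Ad (matrix_inv g) *v (Ad g *v \<zeta>) = \<zeta>"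
proof -
  have "hat (Ad (matrix_inv g) *v (Ad g *v \<zeta>)) = matrix_inv g ** (g ** hat \<zeta> ** matrix_inv g) ** g"
    using hat_Ad[OF SE3_inv(1)[OF assms], of "Ad g *v \<zeta>"] hat_Ad[OF assms] SE3_inv(4)[OF assms] by simp
  also have "\<dots> = (matrix_inv g ** g) ** hat \<zeta> ** (matrix_inv g ** g)" by (simp add: matrix_mul_assoc)
  finally show ?thesis using SE3_inv(2)[OF assms] by simp
qed

lemma has_vector_derivative_pose:
  assumes "(R has_vector_derivative R') (at t within S)" "(b has_vector_derivative b') (at t within S)"
  shows "((\<lambda>s. pose (R s) (b s)) has_vector_derivative block_mat R' (columnvector b') 0 0) (at t within S)"
proof -
  have "bounded_linear (\<lambda>p. block_mat (fst p) (columnvector (snd p)) 0 (0 :: real^1^1))"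
    by (auto intro!: linear_conv_bounded_linear[THEN iffD1] linearI simp: block_mat_linear)
  from bounded_linear.has_vector_derivative[OF this has_vector_derivative_Pair[OF assms]]
  \<comment> \<open>A pose is an affine function of \<open>R\<close> and \<open>b\<close>; the
    constant \<open>pose 0 0\<close> carries the corner entry 1.\<close>
  have "((\<lambda>s. block_mat (R s) (columnvector (b s)) 0 0 + pose 0 0) has_vector_derivative block_mat R' (columnvector b') 0 0) (at t within S)"
    by (auto intro!: derivative_eq_intros)
  then show ?thesis by (simp add: pose_def block_mat_linear)
qed

lemma bounded_linear_transpose: "bounded_linear (transpose :: real^'n^'m \<Rightarrow> _)"
  by (auto intro!: linear_conv_bounded_linear[THEN iffD1] linearI simp: transpose_def vec_eq_iff)

text \<open>On SE(3) the inverse is polynomial in the blocks, with parts \<open>transpose R\<close>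
  and \<open>- (transpose R *v b)\<close>, so the product rule is enough.\<close>

lemma SE3_inv_has_vector_derivative:
  assumes g': "(g has_vector_derivative g t ** hat \<zeta>) (at t within I)" and t: "t \<in> I"
    and SE3: "\<And>s. s \<in> I \<Longrightarrow> g s \<in> SE3"
  shows "((\<lambda>s. matrix_inv (g s)) has_vector_derivative - (hat \<zeta> ** matrix_inv (g t))) (at t within I)"
proof -
  define R b where "R s = rot_part (g s)" and "b s = pos_part (g s)" for s
  define w v where "w = fst_block \<zeta>" and "v = snd_block \<zeta>"
  have g: "g s = pose (R s) (b s)" and rot: "rotation_matrix (R s)" if "s \<in> I" for s
    using SE3_pose[OF SE3[OF that]] SE3_rotation[OF SE3[OF that]] by (simp_all add: R_def b_def)
  have gt: "g t ** hat \<zeta> = block_mat (R t ** skew w) (columnvector (R t *v v)) 0 0"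
    by (simp add: g[OF t] pose_mult_hat w_def v_def)
  have R': "(R has_vector_derivative R t ** skew w) (at t within I)"
    using bounded_linear.has_vector_derivative[OF bounded_linear_rot_part g'] by (simp add: gt R_def[abs_def])
  have b': "(b has_vector_derivative R t *v v) (at t within I)"
    using bounded_linear.has_vector_derivative[OF bounded_linear_pos_part g'] by (simp add: gt b_def[abs_def])
  have RT: "((\<lambda>s. transpose (R s)) has_vector_derivative - (skew w ** transpose (R t))) (at t within I)"
    using bounded_linear.has_vector_derivative[OF bounded_linear_transpose R'] by (simp add: matrix_transpose_mul)
  have D: "((\<lambda>s. pose (transpose (R s)) (- (transpose (R s) *v b s))) has_vector_derivative
     block_mat (- (skew w ** transpose (R t))) 
       (columnvector (- (transpose (R t) *v (R t *v v) + - (skew w ** transpose (R t)) *v b t))) 0 0) (at t within I)"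
    by (intro has_vector_derivative_pose RT has_vector_derivative_minus has_vector_derivative_matrix_vector_mult b')
  have RTR: "transpose (R t) *v (R t *v x) = x" for x
    by (simp add: matrix_vector_mul_assoc rotation_matrix_transpose[OF rot[OF t]])
  have E: "block_mat (- (skew w ** transpose (R t))) 
       (columnvector (- (transpose (R t) *v (R t *v v) + - (skew w ** transpose (R t)) *v b t))) 0 0
     = - (hat \<zeta> ** matrix_inv (g t))"
    unfolding g[OF t] matrix_inv_pose[OF rot[OF t]]
    by (simp add: hat_def pose_def block_mat_mult block_mat_linear matrix_vector_mult_uminus w_def v_def)
      (simp add: RTR matrix_vector_mul_assoc[symmetric])
  from D[unfolded E] show ?thesis
    by (rule has_vector_derivative_transform[OF t, rotated]) (simp add: g rot matrix_inv_pose)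
qed

lemma pose_err_SE3: "gh \<in> SE3 \<Longrightarrow> g \<in> SE3 \<Longrightarrow> pose_err gh g \<in> SE3"
  by (simp add: pose_err_def SE3_mult SE3_inv)

text \<open>Moving \<open>hat \<xi>h\<close> from the left of the error pose to its right conjugates
  it into \<open>hat\<close> of \<open>xi_breve\<close>. The error pose thus follows a
  left-invariant equation with velocity \<open>xi_err\<close>.\<close>

lemma pose_err_has_vector_derivative:
  assumes gh': "(gh has_vector_derivative gh t ** hat \<xi>h) (at t within I)" 
    and g': "(g has_vector_derivative g t ** hat \<xi>) (at t within I)" and t: "t \<in> I"
    and SE3: "\<And>s. s \<in> I \<Longrightarrow> gh s \<in> SE3" "\<And>s. s \<in> I \<Longrightarrow> g s \<in> SE3"
  shows "((\<lambda>s. pose_err (gh s) (g s)) has_vector_derivative 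
    pose_err (gh t) (g t) ** hat (xi_err (gh t) (g t) \<xi>h \<xi>)) (at t within I)"
proof -
  let ?e = "pose_err (gh t) (g t)"
  have e: "?e \<in> SE3" using SE3 t by (simp add: pose_err_SE3)
  have "?e ** hat (Ad (matrix_inv ?e) *v \<xi>h) = ?e ** (matrix_inv ?e ** hat \<xi>h ** ?e)"
    using hat_Ad[OF SE3_inv(1)[OF e]] SE3_inv(4)[OF e] by simp
  also have "\<dots> = hat \<xi>h ** ?e" using SE3_inv(3)[OF e] by (simp add: matrix_mul_assoc)
  finally have 1: "?e ** hat (Ad (matrix_inv ?e) *v \<xi>h) = hat \<xi>h ** ?e" .
  have "hat (x - y) = hat x - hat y" for x y by (simp add: hat_def block_mat_linear)
  then have "?e ** hat (xi_err (gh t) (g t) \<xi>h \<xi>) = ?e ** hat \<xi> - hat \<xi>h ** ?e"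
    by (simp add: xi_err_def xi_breve_def 1)
  moreover have "((\<lambda>s. matrix_inv (gh s) ** g s) has_vector_derivative 
     matrix_inv (gh t) ** (g t ** hat \<xi>) + (- (hat \<xi>h ** matrix_inv (gh t))) ** g t) (at t within I)"
    by (intro has_vector_derivative_matrix_mult g' SE3_inv_has_vector_derivative[OF gh' t SE3(1)])
  ultimately show ?thesis by (simp add: pose_err_def matrix_mul_assoc)
qed

text \<open>The converse: from the true pose and a prescribed error curve it recovers an estimate
  and the observer velocity that drives it.\<close>

lemma reconstructed_pose_has_vector_derivative:
  assumes e': "(e has_vector_derivative e t ** hat \<xi>e) (at t within I)" 
    and g': "(g has_vector_derivative g t ** hat \<xi>) (at t within I)" and t: "t \<in> I"
    and SE3: "\<And>s. s \<in> I \<Longrightarrow> e s \<in> SE3"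
  shows "((\<lambda>s. g s ** matrix_inv (e s)) has_vector_derivative 
    (g t ** matrix_inv (e t)) ** hat (Ad (e t) *v (\<xi> - \<xi>e))) (at t within I)"
proof -
  have "hat (x - y) = hat x - hat y" for x y by (simp add: hat_def block_mat_linear)
  then have "(g t ** matrix_inv (e t)) ** hat (Ad (e t) *v (\<xi> - \<xi>e)) = 
     g t ** (matrix_inv (e t) ** e t) ** (hat \<xi> - hat \<xi>e) ** matrix_inv (e t)"
    unfolding hat_Ad[OF SE3[OF t], symmetric] by (simp add: matrix_mul_assoc)
  also have "\<dots> = g t ** (- (hat \<xi>e ** matrix_inv (e t))) + (g t ** hat \<xi>) ** matrix_inv (e t)"
    using SE3_inv(2)[OF SE3[OF t]] by (simp add: matrix_mul_assoc)
  finally show ?thesis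
    using has_vector_derivative_matrix_mult[OF g' SE3_inv_has_vector_derivative[OF e' t SE3]] by simp
qed

section \<open>Kinematics of the exponential\<close>

text \<open>Both properties reduce to \<open>sin^2 + cos^2 = 1\<close>. Orthogonality is tested on
  vectors modulo \<open>X^3 = - \<theta>^2 X\<close>; the determinant comes out as
  \<open>cos^2 + sin^2\<close>.\<close>

lemma rodrigues_rotation: "rotation_matrix (rodrigues \<Theta>)"
proof -
  let ?t = "norm \<Theta>"
  let ?s = "1 - ?t\<^sup>2 * coef_S2 ?t"
  let ?X = "skew \<Theta>"
  have S: "?t\<^sup>2 * coef_S1 ?t = 1 - cos ?t" "?t * ?s = sin ?t"
    using coef_S1_mult[of ?t] coef_S2_mult[of ?t] by (simp_all add: algebra_simps power2_eq_square power3_eq_cube)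
  have sc: "(sin ?t)\<^sup>2 = 1 - (cos ?t)\<^sup>2" by (rule sin_squared_eq)
  have "transpose (rodrigues \<Theta>) = mat 1 - ?s *\<^sub>R ?X + coef_S1 ?t *\<^sub>R (?X ** ?X)"
    by (simp add: rodrigues_def vec_eq_iff transpose_def forall_3 skew_entries matrix_matrix_mult_def sum_3 mat_def)
  then have "transpose (rodrigues \<Theta>) *v (rodrigues \<Theta> *v x) = x + (2 * coef_S1 ?t - ?s\<^sup>2 - ?t\<^sup>2 * (coef_S1 ?t)\<^sup>2) *\<^sub>R (\<Theta> \<times> (\<Theta> \<times> x))" for x
    by (simp add: rodrigues_mult matrix_vector_simps cross_linear cross_cross_cross)
       (simp add: vec_eq_iff algebra_simps power2_eq_square)
  moreover have "(2 * coef_S1 ?t - ?s\<^sup>2 - ?t\<^sup>2 * (coef_S1 ?t)\<^sup>2) *\<^sub>R (\<Theta> \<times> (\<Theta> \<times> x)) = 0" for x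
  proof (cases "\<Theta> = 0")
    case False
    have "?t\<^sup>2 * (2 * coef_S1 ?t - ?s\<^sup>2 - ?t\<^sup>2 * (coef_S1 ?t)\<^sup>2) = 2 * (?t\<^sup>2 * coef_S1 ?t) - (?t * ?s)\<^sup>2 - (?t\<^sup>2 * coef_S1 ?t)\<^sup>2"
      by algebra
    also have "\<dots> = 0" unfolding S sc by algebra
    finally show ?thesis using False by simp
  qed simp
  ultimately have "transpose (rodrigues \<Theta>) ** rodrigues \<Theta> = mat 1"
    by (simp add: matrix_eq matrix_vector_mul_assoc[symmetric])
  then have "orthogonal_matrix (rodrigues \<Theta>)" by (simp add: orthogonal_matrix)
  moreover have "det (rodrigues \<Theta>) = 1"
  proof -
    have n: "?t\<^sup>2 = \<Theta> $ 1 * \<Theta> $ 1 + \<Theta> $ 2 * \<Theta> $ 2 + \<Theta> $ 3 * \<Theta> $ 3" 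
      by (simp add: power2_norm_eq_inner inner_vec_def sum_3)
    have "det (mat 1 + s *\<^sub>R ?X + c *\<^sub>R (?X ** ?X)) = (1 - c * ?t\<^sup>2)\<^sup>2 + s\<^sup>2 * ?t\<^sup>2" for s c
      unfolding n by (simp add: det_3 skew_entries matrix_matrix_mult_def sum_3 mat_def) algebra
    from this[of ?s "coef_S1 ?t"] have "det (rodrigues \<Theta>) = (1 - ?t\<^sup>2 * coef_S1 ?t)\<^sup>2 + (?t * ?s)\<^sup>2"
      by (simp add: rodrigues_def power_mult_distrib mult.commute)
    also have "\<dots> = 1" unfolding S by simp
    finally show ?thesis .
  qed
  ultimately show ?thesis by (simp add: rotation_matrix_def)
qed

lemma pose_exp_SE3: "pose_exp \<eta> \<in> SE3"
  by (simp add: pose_exp_def pose_in_SE3 rodrigues_rotation)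

lemma principal_angle_pose_exp: "norm (fst_block \<eta>) < pi \<Longrightarrow> principal_angle (rot_part (pose_exp \<eta>)) < pi"
  by (simp add: pose_exp_def principal_angle_rodrigues)

lemma skew_symmetric_eq_skew:
  assumes "transpose M = - M"
  shows "M = skew (rot_axis M)"
proof -
  have M: "M $ j $ i = - M $ i $ j" for i j
    using arg_cong[OF assms, of "\<lambda>N. N $ i $ j"] by (simp add: transpose_def)
  have "M $ i $ i = 0" for i using M[of i i] by simp
  with M[of 1 2] M[of 1 3] M[of 2 3] show ?thesis
    by (simp add: vec_eq_iff forall_3 skew_entries rot_axis_def)
qed

text \<open>The tangent space of SE(3): differentiating \<open>transpose R ** R = mat 1\<close>
  shows that \<open>transpose R ** R'\<close> is skew-symmetric. The filter must be nontrivial so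
  that one-sided derivatives are unique.\<close>

lemma SE3_curve_derivative:
  assumes g': "(g has_vector_derivative D) (at t within I)" and t: "t \<in> I"
    and SE3: "\<And>s. s \<in> I \<Longrightarrow> g s \<in> SE3" and nt: "at t within I \<noteq> bot"
  shows "\<exists>\<zeta>. D = g t ** hat \<zeta>"
proof -
  define R b where "R s = rot_part (g s)" and "b s = pos_part (g s)" for s
  define R' b' where "R' = rot_part D" and "b' = pos_part D"
  have g: "g s = pose (R s) (b s)" and rot: "rotation_matrix (R s)" if "s \<in> I" for s
    using SE3_pose[OF SE3[OF that]] SE3_rotation[OF SE3[OF that]] by (simp_all add: R_def b_def)
  have R': "(R has_vector_derivative R') (at t within I)"
    using bounded_linear.has_vector_derivative[OF bounded_linear_rot_part g'] by (simp add: R_def[abs_def] R'_def)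
  have b': "(b has_vector_derivative b') (at t within I)"
    using bounded_linear.has_vector_derivative[OF bounded_linear_pos_part g'] by (simp add: b_def[abs_def] b'_def)
  have "(g has_vector_derivative block_mat R' (columnvector b') 0 0) (at t within I)"
    by (rule has_vector_derivative_transform[OF t _ has_vector_derivative_pose[OF R' b']]) (simp add: g)
  then have D: "D = block_mat R' (columnvector b') 0 0"
    using g' by (rule vector_derivative_unique_within[OF nt, rotated])
  have "((\<lambda>s. transpose (R s) ** R s) has_vector_derivative transpose (R t) ** R' + transpose R' ** R t) (at t within I)"
    by (intro has_vector_derivative_matrix_mult R' bounded_linear.has_vector_derivative[OF bounded_linear_transpose])
  moreover have "((\<lambda>s. transpose (R s) ** R s) has_vector_derivative 0) (at t within I)"
    by (rule has_vector_derivative_transform[OF t _ has_vector_derivative_const[of "mat 1"]])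
       (simp add: rot rotation_matrix_transpose)
  ultimately have "transpose (R t) ** R' + transpose R' ** R t = 0" by (rule vector_derivative_unique_within[OF nt])
  then have "transpose (transpose (R t) ** R') = - (transpose (R t) ** R')"
    by (simp add: matrix_transpose_mul eq_neg_iff_add_eq_0 add.commute)
  from skew_symmetric_eq_skew[OF this] obtain w where w: "transpose (R t) ** R' = skew w" by blast
  have "R' = R t ** skew w"
    using rotation_matrix_transpose(1)[OF rot[OF t]] by (simp add: w[symmetric] matrix_mul_assoc)
  moreover have "b' = R t *v (transpose (R t) *v b')"
    using rotation_matrix_transpose(1)[OF rot[OF t]] by (simp add: matrix_vector_mul_assoc)
  ultimately have "D = g t ** hat (join w (transpose (R t) *v b'))"
    unfolding D g[OF t] pose_mult_hat by simp
  then show ?thesis ..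
qed

text \<open>Only the existence of a derivative is claimed; for the exponential its value is
  identified afterwards through the logarithm.\<close>

lemma coef_norm_scaleR_differentiable:
  fixes \<Theta> :: "real \<Rightarrow> real^3" and f :: "real \<Rightarrow> 'b::real_normed_vector"
  assumes T: "(\<Theta> has_vector_derivative d) (at t within S)" and f: "(f has_vector_derivative f') (at t within S)"
    and 0: "\<Theta> t = 0 \<Longrightarrow> f t = 0" and h: "isCont h (norm (\<Theta> t))"
    and h': "\<Theta> t \<noteq> 0 \<Longrightarrow> (h has_real_derivative h') (at (norm (\<Theta> t)))"
  shows "\<exists>D. ((\<lambda>s. h (norm (\<Theta> s)) *\<^sub>R f s) has_vector_derivative D) (at t within S)"
proof (cases "\<Theta> t = 0")
  case True
  have "continuous (at t within S) (\<lambda>s. h (norm (\<Theta> s)))"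
    using isCont_tendsto_compose[OF h tendsto_norm] has_vector_derivative_continuous[OF T] by (simp add: continuous_within)
  from has_vector_derivative_vanishing_product[OF this f 0[OF True]] show ?thesis ..
next
  case False
  from has_vector_derivative_scaleR[OF has_vector_derivative_norm_chain[OF T False h'[OF False]] f]
  show ?thesis by blast
qed

text \<open>The curve of exponentials is differentiable and lies in SE(3), so its derivative is
  \<open>pose_exp (\<eta> t) ** hat \<zeta>'\<close> for some \<zeta>'. Taking the logarithm again
  and comparing derivatives gives \<open>G \<zeta>' = G \<zeta>\<close>, and \<open>G\<close> is
  injective.\<close>

theorem pose_exp_has_vector_derivative:
  assumes \<eta>': "(\<eta> has_vector_derivative G_mat (\<eta> t) *v \<zeta>) (at t within I)" and t: "t \<in> I"
    and lt: "\<And>s. s \<in> I \<Longrightarrow> norm (fst_block (\<eta> s)) < pi" and nt: "at t within I \<noteq> bot"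
  shows "((\<lambda>s. pose_exp (\<eta> s)) has_vector_derivative pose_exp (\<eta> t) ** hat \<zeta>) (at t within I)"
proof -
  define \<Theta> \<beta> where "\<Theta> s = fst_block (\<eta> s)" and "\<beta> s = snd_block (\<eta> s)" for s
  obtain d where d: "(\<Theta> has_vector_derivative d) (at t within I)"
    using bounded_linear.has_vector_derivative[OF bounded_linear_fst_block \<eta>'] unfolding \<Theta>_def by blast
  obtain e where e: "(\<beta> has_vector_derivative e) (at t within I)"
    using bounded_linear.has_vector_derivative[OF bounded_linear_snd_block \<eta>'] unfolding \<beta>_def by blast
  have b: "norm (\<Theta> t) < pi" using lt[OF t] by (simp add: \<Theta>_def)
  note c = coef_isCont[OF norm_ge_zero b]
  have bl: "bounded_linear skew" by (auto intro!: linear_conv_bounded_linear[THEN iffD1] linearI)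
  note X = bounded_linear.has_vector_derivative[OF bl d]
  note XX = has_vector_derivative_matrix_mult[OF X X]
  note pos = coef_deriv[OF _ b]
  obtain D1 where D1: "((\<lambda>s. coef_S1 (norm (\<Theta> s)) *\<^sub>R (skew (\<Theta> s) ** skew (\<Theta> s))) has_vector_derivative D1) (at t within I)"
    using coef_norm_scaleR_differentiable[OF d XX _ c(2) pos(2)] by auto
  have c2: "isCont (\<lambda>x. 1 - x\<^sup>2 * coef_S2 x) (norm (\<Theta> t))" using c(3) by (intro continuous_intros)
  have p2: "((\<lambda>x. 1 - x\<^sup>2 * coef_S2 x) has_real_derivative 
     - (2 * y * coef_S2 y + h' * y\<^sup>2)) (at y)" if "(coef_S2 has_real_derivative h') (at y)" for y h'
    using that by (auto intro!: derivative_eq_intros)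
  obtain D2 where D2: "((\<lambda>s. (1 - (norm (\<Theta> s))\<^sup>2 * coef_S2 (norm (\<Theta> s))) *\<^sub>R skew (\<Theta> s)) has_vector_derivative D2) (at t within I)"
    using coef_norm_scaleR_differentiable[OF d X _ c2 p2[OF pos(3)]] by auto
  note Y = has_vector_derivative_cross[OF d e]
  note YY = has_vector_derivative_cross[OF d Y]
  obtain D3 where D3: "((\<lambda>s. coef_S1 (norm (\<Theta> s)) *\<^sub>R (\<Theta> s \<times> \<beta> s)) has_vector_derivative D3) (at t within I)"
    using coef_norm_scaleR_differentiable[OF d Y _ c(2) pos(2)] by auto
  obtain D4 where D4: "((\<lambda>s. coef_S2 (norm (\<Theta> s)) *\<^sub>R (\<Theta> s \<times> (\<Theta> s \<times> \<beta> s))) has_vector_derivative D4) (at t within I)"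
    using coef_norm_scaleR_differentiable[OF d YY _ c(3) pos(3)] by auto
  have "((\<lambda>s. rodrigues (\<Theta> s)) has_vector_derivative (0 + D2) + D1) (at t within I)"
    unfolding rodrigues_def by (intro has_vector_derivative_add has_vector_derivative_const D1 D2)
  moreover have "((\<lambda>s. S_mat (\<Theta> s) *v \<beta> s) has_vector_derivative (e + D3) + D4) (at t within I)"
    unfolding S_mat_mult by (intro has_vector_derivative_add has_vector_derivative_const D3 D4 e)
  ultimately obtain D where D: "((\<lambda>s. pose_exp (\<eta> s)) has_vector_derivative D) (at t within I)"
    using has_vector_derivative_pose unfolding pose_exp_def \<Theta>_def \<beta>_def by blast
  then obtain \<zeta>' where \<zeta>': "D = pose_exp (\<eta> t) ** hat \<zeta>'"
    using SE3_curve_derivative[OF D t pose_exp_SE3 nt] by blast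
  have "((\<lambda>s. pose_log (pose_exp (\<eta> s))) has_vector_derivative G_mat (pose_log (pose_exp (\<eta> t))) *v \<zeta>') (at t within I)"
    using D unfolding \<zeta>' by (rule pose_log_has_vector_derivative[OF _ t pose_exp_SE3]) (simp add: lt principal_angle_pose_exp)
  then have "((\<lambda>s. pose_log (pose_exp (\<eta> s))) has_vector_derivative G_mat (\<eta> t) *v \<zeta>') (at t within I)"
    by (simp add: pose_log_pose_exp lt t)
  then have "(\<eta> has_vector_derivative G_mat (\<eta> t) *v \<zeta>') (at t within I)"
    by (rule has_vector_derivative_transform[OF t, rotated]) (simp add: pose_log_pose_exp lt)
  then have eq: "G_mat (\<eta> t) *v \<zeta>' = G_mat (\<eta> t) *v \<zeta>"
    using \<eta>' by (rule vector_derivative_unique_within[OF nt])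
  \<comment> \<open>A left inverse of \<open>A(\<Theta>)\<close> is \<open>S(-\<Theta>)\<close>. As
    \<open>G\<close> is block triangular, the rotational block is compared first.\<close>
  have inj: "x = y" if "A_mat (\<Theta> t) *v x = A_mat (\<Theta> t) *v y" for x y
    using S_mat_A_mat(1)[of "- \<Theta> t"] b that by (metis minus_minus norm_minus_cancel)
  have "fst_block \<zeta>' = fst_block \<zeta>" 
    using arg_cong[OF eq, of fst_block] unfolding G_mat_mult \<Theta>_def[symmetric] by (rule inj)
  moreover from this have "snd_block \<zeta>' = snd_block \<zeta>"
    using arg_cong[OF eq, of snd_block] unfolding G_mat_mult \<Theta>_def[symmetric]
    by - (rule inj, simp)
  ultimately have "\<zeta>' = \<zeta>" unfolding vec_eq_blocks[of \<zeta>'] by (rule conjI)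
  then show ?thesis using D \<zeta>' by simp
qed

section \<open>The Lyapunov function\<close>

lemma mat_mult_vector: "mat c *v x = c *\<^sub>R x" for x :: "real^'n"
  by (simp add: vec_eq_iff matrix_vector_mult_def mat_def if_distrib[of "\<lambda>a. a * _"] cong: if_cong)

lemma inertia_mult [simp]: "fst_block (inertia J m *v x) = J *v fst_block x" "snd_block (inertia J m *v x) = m *\<^sub>R snd_block x"
  by (simp_all add: inertia_def mat_mult_vector)

lemma gain_K_mult [simp]: "fst_block (gain_K k *v x) = fst_block x" "snd_block (gain_K k *v x) = k *\<^sub>R snd_block x"
  by (simp_all add: gain_K_def mat_mult_vector)

lemma ad_mult [simp]: "fst_block (ad z *v x) = fst_block z \<times> fst_block x"
  "snd_block (ad z *v x) = snd_block z \<times> fst_block x + fst_block z \<times> snd_block x"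
  by (simp_all add: ad_def)

lemma transpose_0 [simp]: "transpose 0 = 0"
  by (simp add: transpose_def vec_eq_iff)

lemma ad_star_mult [simp]: "fst_block (ad_star z *v x) = - (fst_block z \<times> fst_block x) - snd_block z \<times> snd_block x"
  "snd_block (ad_star z *v x) = - (fst_block z \<times> snd_block x)"
  by (simp_all add: ad_star_def ad_def transpose_block_mat)

lemma inner_transpose: "x \<bullet> (transpose A *v y) = (A *v x) \<bullet> y" for A :: "real^'n^'m"
  using dot_lmul_matrix[of y A x] by (simp add: transpose_matrix_vector inner_commute)

definition err_force :: "real^3^3 \<Rightarrow> real \<Rightarrow> real \<Rightarrow> real \<Rightarrow> real^(3+3) \<Rightarrow> real^(3+3) \<Rightarrow> real^(3+3) \<Rightarrow> real^(3+3)" where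
  "err_force J m k2 k3 \<xi> \<eta> u = ad_star (gain_K k2 *v u) *v (inertia J m *v \<xi>)
     - transpose (G_mat (gain_K k2 *v \<eta>)) *v \<eta> - k3 *\<^sub>R u"

text \<open>The linear part of the translational momentum is parallel to the velocity, so the gain \<open>k2\<close>
  may be moved across the term \<open>\<xi>\<close> in the argument of the coadjoint operator.\<close>

lemma ad_star_gain_K:
  "ad_star \<xi> *v (inertia J m *v \<xi>) - ad_star (- (gain_K k2 *v (a - \<xi>b))) *v (inertia J m *v \<xi>)
    = ad_star (gain_K k2 *v (a + (\<xi> - \<xi>b))) *v (inertia J m *v \<xi>)"
  by (simp add: vec_eq_blocks cross_linear) (simp add: algebra_simps)

text \<open>An equivalence, because it is used both ways: to read the equation of \<open>u\<close>
  off a given observer, and to verify the observer equation for an estimate built from a solution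
  \<open>u\<close>.\<close>

lemma observer_equation_iff:
  assumes "inertia J m *v d\<xi> = ad_star \<xi> *v (inertia J m *v \<xi>) + \<phi>"
    and "u' = k1 *\<^sub>R (G_mat \<eta> *v (\<xi> - \<xi>b)) + (d\<xi> - d\<xi>b)" and "u = k1 *\<^sub>R \<eta> + (\<xi> - \<xi>b)"
  shows "inertia J m *v d\<xi>b = ad_star (- (gain_K k2 *v (k1 *\<^sub>R \<eta> - \<xi>b))) *v (inertia J m *v \<xi>) + \<phi>
         + k1 *\<^sub>R (inertia J m *v (G_mat \<eta> *v (\<xi> - \<xi>b)))
         + transpose (G_mat (gain_K k2 *v \<eta>)) *v \<eta> + k3 *\<^sub>R u
     \<longleftrightarrow> inertia J m *v u' = err_force J m k2 k3 \<xi> \<eta> u"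
  unfolding err_force_def assms(2,3) ad_star_gain_K[symmetric]
  by (simp only: matrix_vector_right_distrib matrix_vector_mult_diff_distrib matrix_vector_mult_scaleR assms(1))
     (auto simp: algebra_simps)

text \<open>Here \<open>coef_A t = 1 / t^2 - cot (t / 2) / (2 t)\<close> for positive
  \<open>t\<close>. Together with \<open>coef_T1 = 2 coef_A + t coef_A'\<close> this is the Riccati
  equation that \<open>coef_A\<close> inherits from the cotangent.\<close>

lemma coef_T1_riccati:
  assumes "0 \<le> t" "t < pi"
  shows "coef_T1 t = 1/4 - coef_A t + t\<^sup>2 * (coef_A t)\<^sup>2"
proof (cases "t = 0")
  case False
  then have "t > 0" using assms by simp
  define s c where "s = sin t" and "c = cos t"
  have s: "s > 0" using \<open>t > 0\<close> assms by (simp add: s_def sin_gt_zero)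
  have sc: "s * s = 1 - c * c" using sin_squared_eq[of t] by (simp add: s_def c_def power2_eq_square)
  have A: "2 * t\<^sup>2 * s * coef_A t = 2 * s - t * (1 + c)"
    using \<open>t > 0\<close> s by (simp add: coef_A_def s_def[symmetric] c_def[symmetric] field_simps power2_eq_square)
  have T: "2 * t * s\<^sup>2 * coef_T1 t = (1 + c) * (t - s)"
    using \<open>t > 0\<close> s by (simp add: coef_T1_def s_def[symmetric] c_def[symmetric])
  have "4 * t\<^sup>2 * s\<^sup>2 * (1/4 - coef_A t + t\<^sup>2 * (coef_A t)\<^sup>2) = t\<^sup>2 * s\<^sup>2 - 2 * s * (2 * t\<^sup>2 * s * coef_A t) + (2 * t\<^sup>2 * s * coef_A t)\<^sup>2"
    by algebra
  also have "\<dots> = 2 * t * (2 * t * s\<^sup>2 * coef_T1 t)" unfolding A T using sc by algebra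
  also have "\<dots> = 4 * t\<^sup>2 * s\<^sup>2 * coef_T1 t" by algebra
  finally show ?thesis using \<open>t > 0\<close> s by simp
qed (simp add: coef_T1_def coef_A_def)

text \<open>The geometric reason: along the one-parameter group of \<eta> the coordinates are
  \<open>s *\<^sub>R \<eta>\<close> and the velocity is constantly \<eta>. The proof is algebraic,
  with \<open>b = S(\<Theta>) \<beta>\<close> as unknown.\<close>

lemma G_mat_self:
  assumes "norm (fst_block \<eta>) < pi"
  shows "G_mat \<eta> *v \<eta> = \<eta>"
proof -
  define \<Theta> \<beta> where "\<Theta> = fst_block \<eta>" and "\<beta> = snd_block \<eta>"
  define b where "b = S_mat \<Theta> *v \<beta>"
  let ?a = "coef_A (norm \<Theta>)" and ?t = "norm \<Theta>"
  have lt: "norm \<Theta> < pi" using assms by (simp add: \<Theta>_def)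
  have \<beta>: "\<beta> = A_mat (- \<Theta>) *v b" using S_mat_A_mat(2)[OF lt] by (simp add: b_def)
  have ip: "\<Theta> \<bullet> \<beta> = \<Theta> \<bullet> b" using A_mat_adjoint[of \<Theta> b \<Theta>] by (simp add: \<beta> A_mat_self inner_commute)
  have Y: "(\<Theta> \<bullet> b) *\<^sub>R \<Theta> - ?t\<^sup>2 *\<^sub>R b = \<Theta> \<times> (\<Theta> \<times> b)" by (simp add: Lagrange power2_norm_eq_inner)
  have "T_mat \<Theta> \<beta> *v \<Theta> = - (1/2) *\<^sub>R (\<Theta> \<times> b) + (2 * ?a + ?t\<^sup>2 * coef_T2 ?t) *\<^sub>R ((\<Theta> \<bullet> b) *\<^sub>R \<Theta> - ?t\<^sup>2 *\<^sub>R b)"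
    unfolding T_mat_mult b_def[symmetric] A_mat_self rodrigues_coef_identities(3)[OF norm_ge_zero lt] 
      inner_commute[of \<beta> \<Theta>] ip power2_norm_eq_inner[symmetric] cross_skew[of b \<Theta>]
    by (simp add: vec_eq_iff algebra_simps)
  \<comment> \<open>The Riccati identity enters; the new factor is the coefficient of
    \<open>X^2\<close> in \<open>(I - A(\<Theta>)) A(-\<Theta>)\<close>.\<close>
  also have "\<dots> = - (1/2) *\<^sub>R (\<Theta> \<times> b) + (1/4 - ?a + ?t\<^sup>2 * ?a\<^sup>2) *\<^sub>R (\<Theta> \<times> (\<Theta> \<times> b))"
    unfolding Y rodrigues_coef_identities(3)[OF norm_ge_zero lt, symmetric] coef_T1_riccati[OF norm_ge_zero lt] ..
  also have "\<dots> = \<beta> - A_mat \<Theta> *v \<beta>"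
    unfolding \<beta> A_mat_mult A_mat_uminus_mult cross_linear cross_cross_cross
    by (simp add: cross_linear cross_cross_cross vec_eq_iff power2_eq_square) (simp add: field_simps)
  finally show ?thesis
    by (simp add: vec_eq_blocks G_mat_mult \<Theta>_def[symmetric] \<beta>_def[symmetric] A_mat_self)
qed

text \<open>The gain corresponds to the scaling \<open>(R, b)\<close> to \<open>(R, k b)\<close>,
  which is compatible with the group product. Concretely, \<Theta> is unchanged and
  \<open>T_mat\<close> is linear in \<beta>.\<close>

lemma G_mat_gain_K: "G_mat (gain_K k *v \<eta>) *v (gain_K k *v x) = gain_K k *v (G_mat \<eta> *v x)"
  by (simp add: vec_eq_blocks G_mat_mult T_mat_mult matrix_vector_simps)
     (simp add: cross_linear algebra_simps)

lemma gain_K_symmetric: "(gain_K k *v x) \<bullet> y = x \<bullet> (gain_K k *v y)"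
  by (simp add: inner_blocks)

lemma err_dissipation:
  assumes "norm (fst_block \<eta>) < pi"
  shows "(gain_K k2 *v \<eta>) \<bullet> (G_mat \<eta> *v (u - k1 *\<^sub>R \<eta>)) + (gain_K k2 *v u) \<bullet> err_force J m k2 k3 \<xi> \<eta> u
    = - k1 * (\<eta> \<bullet> (gain_K k2 *v \<eta>)) - k3 * (u \<bullet> (gain_K k2 *v u))"
proof -
  let ?K = "gain_K k2" and ?p = "inertia J m *v \<xi>"
  have "ad (?K *v u) *v (?K *v u) = 0"
    using cross_skew[of "fst_block (?K *v u)" "snd_block (?K *v u)"] by (simp add: vec_eq_blocks)
  then have 1: "(?K *v u) \<bullet> (ad_star (?K *v u) *v ?p) = 0" by (simp add: ad_star_def inner_transpose)
  have 2: "(?K *v u) \<bullet> (transpose (G_mat (?K *v \<eta>)) *v \<eta>) = (?K *v \<eta>) \<bullet> (G_mat \<eta> *v u)"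
    unfolding inner_transpose G_mat_gain_K by (metis gain_K_symmetric inner_commute)
  have 3: "(?K *v \<eta>) \<bullet> (G_mat \<eta> *v (u - k1 *\<^sub>R \<eta>)) = (?K *v \<eta>) \<bullet> (G_mat \<eta> *v u) - k1 * (\<eta> \<bullet> (?K *v \<eta>))"
    by (simp add: matrix_vector_mult_diff_distrib matrix_vector_mult_scaleR G_mat_self[OF assms] inner_diff_right gain_K_symmetric)
  show ?thesis
    unfolding err_force_def inner_diff_right 1 2 3 by (simp add: gain_K_symmetric)
qed

text \<open>The weight of \<open>u\<close> is the product of gain and inertia. It is symmetric when
  \<open>J\<close> is, because the gain is a scalar on each block.\<close>

definition lyapunov :: "real^3^3 \<Rightarrow> real \<Rightarrow> real \<Rightarrow> real^(3+3) \<Rightarrow> real^(3+3) \<Rightarrow> real" where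
  "lyapunov J m k2 \<eta> u = (\<eta> \<bullet> (gain_K k2 *v \<eta>) + u \<bullet> (gain_K k2 *v (inertia J m *v u))) / 2"

lemma lyapunov_has_derivative:
  assumes J: "transpose J = J" and \<eta>: "(\<eta> has_vector_derivative \<eta>') (at t within S)"
    and u: "(u has_vector_derivative u') (at t within S)"
  shows "((\<lambda>s. lyapunov J m k2 (\<eta> s) (u s)) has_real_derivative 
    (gain_K k2 *v \<eta> t) \<bullet> \<eta>' + (gain_K k2 *v u t) \<bullet> (inertia J m *v u')) (at t within S)"
proof -
  note K = bounded_linear.has_vector_derivative[OF matrix_vector_mul_bounded_linear]
  have "((\<lambda>s. (\<eta> s \<bullet> (gain_K k2 *v \<eta> s) + u s \<bullet> (gain_K k2 *v (inertia J m *v u s))) *\<^sub>R (1/2 :: real)) has_vector_derivative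
    ((\<eta> t \<bullet> (gain_K k2 *v \<eta>') + \<eta>' \<bullet> (gain_K k2 *v \<eta> t)) + (u t \<bullet> (gain_K k2 *v (inertia J m *v u')) + u' \<bullet> (gain_K k2 *v (inertia J m *v u t)))) *\<^sub>R (1/2 :: real)) (at t within S)"
    by (intro bounded_linear.has_vector_derivative[OF bounded_linear_scaleR_left] has_vector_derivative_add 
      bounded_bilinear.has_vector_derivative[OF bounded_bilinear_inner] \<eta> u K)
  moreover have "u' \<bullet> (gain_K k2 *v (inertia J m *v u t)) = u t \<bullet> (gain_K k2 *v (inertia J m *v u'))"
  proof -
    have "x \<bullet> (J *v y) = y \<bullet> (J *v x)" for x y using inner_transpose[of x J y] J by (simp add: inner_commute)
    then show ?thesis by (simp add: inner_blocks inner_commute)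
  qed
  moreover have "\<eta>' \<bullet> (gain_K k2 *v \<eta> t) = \<eta> t \<bullet> (gain_K k2 *v \<eta>')" by (simp add: inner_blocks inner_commute)
  ultimately show ?thesis
    by (simp add: lyapunov_def has_real_derivative_iff_has_vector_derivative gain_K_symmetric add_divide_distrib)
qed

text \<open>The constant is the minimum over the unit sphere, carried to all vectors by
  homogeneity.\<close>

lemma positive_definite_lower_bound:
  fixes J :: "real^'n^'n"
  assumes "\<And>v. v \<noteq> 0 \<Longrightarrow> v \<bullet> (J *v v) > 0"
  shows "\<exists>c>0. \<forall>v. c * (norm v)\<^sup>2 \<le> v \<bullet> (J *v v)"
proof -
  have "continuous_on (sphere 0 1) (\<lambda>v. v \<bullet> (J *v v))" by (intro continuous_intros)
  from continuous_attains_inf[OF compact_sphere _ this] 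
  obtain v0 where v0: "v0 \<in> sphere 0 1" "\<And>v. v \<in> sphere 0 1 \<Longrightarrow> v0 \<bullet> (J *v v0) \<le> v \<bullet> (J *v v)"
    by auto
  have "(v0 \<bullet> (J *v v0)) * (norm v)\<^sup>2 \<le> v \<bullet> (J *v v)" for v
  proof (cases "v = 0")
    case False
    have "v0 \<bullet> (J *v v0) \<le> (v /\<^sub>R norm v) \<bullet> (J *v (v /\<^sub>R norm v))" by (rule v0) (simp add: False)
    also have "\<dots> = v \<bullet> (J *v v) / (norm v)\<^sup>2" using False by (simp add: matrix_vector_mult_scaleR power2_eq_square field_simps)
    finally show ?thesis using False by (simp add: pos_le_divide_eq)
  qed simp
  moreover have "v0 \<bullet> (J *v v0) > 0" using v0(1) by (intro assms) auto
  ultimately show ?thesis by blast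
qed

lemma lyapunov_bounds:
  assumes "\<And>v. v \<noteq> 0 \<Longrightarrow> v \<bullet> (J *v v) > 0" "m > 0" "k2 > 0"
  shows "\<exists>a>0. \<forall>\<eta> u. a * ((norm \<eta>)\<^sup>2 + (norm u)\<^sup>2) \<le> lyapunov J m k2 \<eta> u"
    and "k1 > 0 \<Longrightarrow> k3 > 0 \<Longrightarrow> \<exists>c>0. \<forall>\<eta> u. c * lyapunov J m k2 \<eta> u \<le> k1 * (\<eta> \<bullet> (gain_K k2 *v \<eta>)) + k3 * (u \<bullet> (gain_K k2 *v u))"
    and "0 \<le> \<eta> \<bullet> (gain_K k2 *v \<eta>)"
proof -
  obtain j where j: "j > 0" "\<And>v. j * (norm v)\<^sup>2 \<le> v \<bullet> (J *v v)" using positive_definite_lower_bound[OF assms(1)] by blast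
  have n: "(norm x)\<^sup>2 = (norm (fst_block x))\<^sup>2 + (norm (snd_block x))\<^sup>2" for x :: "real^(3+3)"
    by (simp add: power2_norm_eq_inner inner_blocks)
  have V: "2 * lyapunov J m k2 \<eta> u = (norm (fst_block \<eta>))\<^sup>2 + k2 * (norm (snd_block \<eta>))\<^sup>2
       + fst_block u \<bullet> (J *v fst_block u) + k2 * m * (norm (snd_block u))\<^sup>2" for \<eta> u
    by (simp add: lyapunov_def inner_blocks power2_norm_eq_inner)
  \<comment> \<open>Half of the smallest of the four coefficients of \<open>2 V\<close>, with
    \<open>j\<close> standing for the lower bound of \<open>J\<close>.\<close>
  define a where "a = min (min 1 k2) (min j (k2 * m)) / 2"
  have a: "a > 0" "2 * a \<le> 1" "2 * a \<le> k2" "2 * a \<le> j" "2 * a \<le> k2 * m" using j assms by (auto simp: a_def)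
  have "a * ((norm \<eta>)\<^sup>2 + (norm u)\<^sup>2) \<le> lyapunov J m k2 \<eta> u" for \<eta> u
  proof -
    have "2 * a * (norm (fst_block \<eta>))\<^sup>2 \<le> 1 * (norm (fst_block \<eta>))\<^sup>2" "2 * a * (norm (snd_block \<eta>))\<^sup>2 \<le> k2 * (norm (snd_block \<eta>))\<^sup>2"
      "2 * a * (norm (fst_block u))\<^sup>2 \<le> j * (norm (fst_block u))\<^sup>2" "2 * a * (norm (snd_block u))\<^sup>2 \<le> k2 * m * (norm (snd_block u))\<^sup>2"
      by (intro mult_right_mono a zero_le_power2)+
    then show ?thesis using V[of \<eta> u] j(2)[of "fst_block u"] n[of \<eta>] n[of u] by (simp add: algebra_simps)
  qed
  then show "\<exists>a>0. \<forall>\<eta> u. a * ((norm \<eta>)\<^sup>2 + (norm u)\<^sup>2) \<le> lyapunov J m k2 \<eta> u" using a by blast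
  have K: "x \<bullet> (gain_K k2 *v x) = (norm (fst_block x))\<^sup>2 + k2 * (norm (snd_block x))\<^sup>2" for x
    by (simp add: inner_blocks power2_norm_eq_inner)
  show "0 \<le> \<eta> \<bullet> (gain_K k2 *v \<eta>)" using assms by (simp add: K)
  assume k: "k1 > 0" "k3 > 0"
  define M where "M = onorm ((*v) J)"
  have M: "v \<bullet> (J *v v) \<le> M * (norm v)\<^sup>2" for v
  proof -
    have "v \<bullet> (J *v v) \<le> norm v * norm (J *v v)" by (rule norm_cauchy_schwarz)
    also have "\<dots> \<le> norm v * (M * norm v)" unfolding M_def by (intro mult_left_mono onorm) auto
    finally show ?thesis by (simp add: power2_eq_square algebra_simps)
  qed
  have "M \<ge> 0" unfolding M_def by (rule onorm_pos_le) simp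
  \<comment> \<open>With \<open>k2\<close> kept as a weight, the four terms of \<open>2 V\<close>
    carry the factors 1, 1, at most \<open>M\<close>, and \<open>m\<close>; \<open>B\<close>
    dominates all of them.\<close>
  define B where "B = 1 + M + m"
  have B: "B > 0" "1 \<le> B" "M \<le> B" "m \<le> B" using \<open>M \<ge> 0\<close> assms by (auto simp: B_def)
  define c where "c = 2 * min k1 k3 / B"
  have c: "c > 0" using k B by (simp add: c_def)
  have "c * lyapunov J m k2 \<eta> u \<le> k1 * (\<eta> \<bullet> (gain_K k2 *v \<eta>)) + k3 * (u \<bullet> (gain_K k2 *v u))" for \<eta> u
  proof -
    have "1 * (norm (fst_block \<eta>))\<^sup>2 \<le> B * (norm (fst_block \<eta>))\<^sup>2" "1 * (k2 * (norm (snd_block \<eta>))\<^sup>2) \<le> B * (k2 * (norm (snd_block \<eta>))\<^sup>2)"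
      "M * (norm (fst_block u))\<^sup>2 \<le> B * (norm (fst_block u))\<^sup>2" "m * (k2 * (norm (snd_block u))\<^sup>2) \<le> B * (k2 * (norm (snd_block u))\<^sup>2)"
      using assms by (intro mult_right_mono B; simp)+
    then have "2 * lyapunov J m k2 \<eta> u \<le> B * (\<eta> \<bullet> (gain_K k2 *v \<eta>) + u \<bullet> (gain_K k2 *v u))"
      using V[of \<eta> u] M[of "fst_block u"] unfolding K by (simp add: algebra_simps)
    then have "min k1 k3 * (2 * lyapunov J m k2 \<eta> u) \<le> min k1 k3 * (B * (\<eta> \<bullet> (gain_K k2 *v \<eta>) + u \<bullet> (gain_K k2 *v u)))"
      using k by (intro mult_left_mono) auto
    then have "c * lyapunov J m k2 \<eta> u \<le> min k1 k3 * (\<eta> \<bullet> (gain_K k2 *v \<eta>) + u \<bullet> (gain_K k2 *v u))"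
      using B by (simp add: c_def field_simps)
    also have "\<dots> \<le> k1 * (\<eta> \<bullet> (gain_K k2 *v \<eta>)) + k3 * (u \<bullet> (gain_K k2 *v u))"
      unfolding distrib_left using assms by (intro add_mono mult_right_mono) (auto simp: K)
    finally show ?thesis .
  qed
  then show "\<exists>c>0. \<forall>\<eta> u. c * lyapunov J m k2 \<eta> u \<le> k1 * (\<eta> \<bullet> (gain_K k2 *v \<eta>)) + k3 * (u \<bullet> (gain_K k2 *v u))" using c by blast
qed

lemma has_real_derivative_nonpos_imp_le:
  assumes "s \<le> t" "{s..t} \<subseteq> I" and "\<And>x. x \<in> I \<Longrightarrow> (f has_real_derivative f' x) (at x within I)"
    and "\<And>x. x \<in> I \<Longrightarrow> f' x \<le> 0"
  shows "f t \<le> f s"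
proof (cases "s = t")
  case False
  show ?thesis
  proof (rule DERIV_nonpos_imp_decreasing_open[of s t f])
    show "s \<le> t" by (rule assms(1))
    show "continuous_on {s..t} f"
      using DERIV_continuous_on[of I f f'] assms(2,3) continuous_on_subset by blast
    fix x assume x: "s < x" "x < t"
    have "(f has_real_derivative f' x) (at x within {s<..<t})"
      using assms(2) x by (intro DERIV_subset[OF assms(3)]) auto
    then have "DERIV f x :> f' x" using x by (simp add: at_within_open[of x "{s<..<t}"])
    then show "\<exists>y. DERIV f x :> y \<and> y \<le> 0" using assms(2,4) x by (meson atLeastAtMost_iff less_imp_le subsetD)
  qed
qed simp

section \<open>Global solutions of ordinary differential equations\<close>

lemma at_within_atLeast_eq: "t0 \<le> t \<Longrightarrow> at t within {t0..} = at t within {t0..t + 1}" for t :: real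
  by (rule at_within_nhd[of t "{..<t + 1}"]) auto

lemma indefinite_integral_has_vector_derivative:
  fixes h :: "real \<Rightarrow> 'a::banach"
  assumes "continuous_on {t0..} h" "t0 \<le> t"
  shows "((\<lambda>u. integral {t0..u} h) has_vector_derivative h t) (at t within {t0..})"
  unfolding at_within_atLeast_eq[OF assms(2)]
  by (rule integral_has_vector_derivative) (use assms in \<open>auto intro: continuous_on_subset\<close>)

text \<open>The weight \<open>exp (2 \<integral> L)\<close> makes the Picard operator a contraction on the whole half-line at once.\<close>

lemma picard_global:
  fixes f :: "real \<Rightarrow> 'a::banach \<Rightarrow> 'a"
  assumes cont: "\<And>y. continuous_on {t0..} y \<Longrightarrow> continuous_on {t0..} (\<lambda>s. f s (y s))"
    and lip: "\<And>t x y. t0 \<le> t \<Longrightarrow> dist (f t x) (f t y) \<le> L t * dist x y"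
    and bnd: "\<And>t x. t0 \<le> t \<Longrightarrow> norm (f t x) \<le> L t"
    and L: "continuous_on {t0..} L"
  shows "\<exists>x. x t0 = x0 \<and> (\<forall>t\<ge>t0. (x has_vector_derivative f t (x t)) (at t within {t0..}))"
proof -
  define W where "W t = exp (integral {t0..t} (\<lambda>s. 2 * L s))" for t
  have L2: "continuous_on {t0..} (\<lambda>s. 2 * L s)" by (intro continuous_intros L)
  have W0: "W t0 = 1" and Wpos: "W t > 0" for t by (simp_all add: W_def)
  have Lnn: "0 \<le> L t" if "t0 \<le> t" for t using bnd[OF that, of 0] norm_ge_zero order_trans by blast
  have W': "(W has_real_derivative 2 * L t * W t) (at t within {t0..})" if "t0 \<le> t" for t
    using DERIV_chain2[OF DERIV_exp 
      indefinite_integral_has_vector_derivative[OF L2 that, folded has_real_derivative_iff_has_vector_derivative]]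
    by (simp add: W_def[abs_def] mult_ac)
  have Wcont: "continuous_on {t0..} W" 
    by (rule DERIV_continuous_on[where D = "\<lambda>t. 2 * L t * W t"]) (simp add: W')
  \<comment> \<open>Because \<open>W' = 2 L W\<close>, integrating \<open>L W\<close> and dividing
    by \<open>W\<close> leaves less than 1/2; this is both the bound and the contraction constant of
    the operator.\<close>
  have LW: "((\<lambda>s. L s * W s) has_integral (W t - 1) / 2) {t0..t}" if "t0 \<le> t" for t
  proof -
    have "((\<lambda>s. L s * W s) has_integral (W t / 2 - W t0 / 2)) {t0..t}"
    proof (rule fundamental_theorem_of_calculus[OF that])
      fix s assume s: "s \<in> {t0..t}"
      have "(W has_real_derivative 2 * L s * W s) (at s within {t0..t})" using s by (intro DERIV_subset[OF W']) auto
      then show "((\<lambda>s. W s / 2) has_vector_derivative L s * W s) (at s within {t0..t})"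
        by (auto intro!: derivative_eq_intros simp: has_real_derivative_iff_has_vector_derivative[symmetric])
    qed
    then show ?thesis by (simp add: W0 diff_divide_distrib)
  qed
  have W1: "1 \<le> W t" if "t0 \<le> t" for t
  proof -
    have "0 \<le> (W t - 1) / 2" 
      by (rule has_integral_nonneg[OF LW[OF that]]) (simp add: Lnn less_imp_le[OF Wpos])
    then show ?thesis by simp
  qed
  \<comment> \<open>The unknown is \<open>y = (x - x0) / W\<close>, so that the plain supremum norm
    of \<open>y\<close> is the weighted norm of \<open>x - x0\<close>.\<close>
  define F where "F y s = f s (x0 + W s *\<^sub>R y s)" for y :: "real \<Rightarrow> 'a" and s
  \<comment> \<open>The \<open>max\<close> extends the operator constantly to the left of
    \<open>t0\<close>, since bounded continuous functions live on the whole line.\<close>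
  define T where "T y t = (1 / W (max t0 t)) *\<^sub>R integral {t0..max t0 t} (F y)" for y t
  have Fc: "continuous_on {t0..} (F y)" if "continuous_on UNIV y" for y
    unfolding F_def using that by (intro cont continuous_intros Wcont) (auto intro: continuous_on_subset)
  have Fi: "F y integrable_on {t0..t}" if "continuous_on UNIV y" for y t
    using continuous_on_subset[OF Fc[OF that]] by (intro integrable_continuous_interval) auto
  have half: "(W t - 1) / 2 / W t \<le> 1 / 2" if "t0 \<le> t" for t
    using Wpos[of t] W1[OF that] by (simp add: divide_simps)
  have Tcont: "continuous_on UNIV (T y)" if y: "continuous_on UNIV y" for y
  proof -
    have "continuous_on {t0..} (\<lambda>t. (1 / W t) *\<^sub>R integral {t0..t} (F y))"
      using indefinite_integral_has_vector_derivative[OF Fc[OF y]] Wpos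
      by (intro continuous_intros Wcont) (auto intro!: continuous_on_vector_derivative, metis less_irrefl)
    moreover have "continuous_on UNIV (\<lambda>t. max t0 t)" by (intro continuous_intros)
    ultimately have "continuous_on UNIV (\<lambda>t. (1 / W (max t0 t)) *\<^sub>R integral {t0..max t0 t} (F y))"
      by (rule continuous_on_compose2) auto
    then show ?thesis by (simp add: T_def[abs_def])
  qed
  have Tbound: "norm (T y t) \<le> 1 / 2" if y: "continuous_on UNIV y" for y t
  proof -
    let ?t = "max t0 t"
    have "norm (integral {t0..?t} (F y)) \<le> integral {t0..?t} (\<lambda>s. L s * W s)"
    proof (rule integral_norm_bound_integral[OF Fi[OF y]])
      show "(\<lambda>s. L s * W s) integrable_on {t0..?t}" by (rule has_integral_integrable[OF LW]) simp
      fix s assume "s \<in> {t0..?t}"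
      then have "t0 \<le> s" by simp
      then have "norm (F y s) \<le> L s * 1" "L s * 1 \<le> L s * W s"
        using bnd[of s] mult_left_mono[OF W1 Lnn] by (auto simp: F_def)
      then show "norm (F y s) \<le> L s * W s" by linarith
    qed
    also have "\<dots> = (W ?t - 1) / 2" using LW[of ?t] by (simp add: integral_unique)
    finally have "norm (integral {t0..?t} (F y)) \<le> (W ?t - 1) / 2" .
    from divide_right_mono[OF this less_imp_le[OF Wpos[of ?t]]]
    have "norm (T y t) \<le> (W ?t - 1) / 2 / W ?t" using Wpos[of ?t] by (simp add: T_def)
    also have "\<dots> \<le> 1 / 2" by (rule half) simp
    finally show ?thesis .
  qed
  define TT where "TT y = Bcontfun (T (apply_bcontfun y))" for y
  have TT: "apply_bcontfun (TT y) = T (apply_bcontfun y)" for y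
    unfolding TT_def by (rule Bcontfun_inverse) (auto intro!: bcontfun_normI Tcont Tbound)
  have "dist (TT y) (TT z) \<le> 1 / 2 * dist y z" for y z
  proof (rule dist_bound, unfold TT)
    fix t
    let ?t = "max t0 t"
    have yc: "continuous_on UNIV (apply_bcontfun y)" and zc: "continuous_on UNIV (apply_bcontfun z)" by auto
    have A: "T y t - T z t = (1 / W ?t) *\<^sub>R integral {t0..?t} (\<lambda>s. F y s - F z s)"
      unfolding T_def by (simp add: integral_diff Fi yc zc scaleR_diff_right)
    have B: "norm (integral {t0..?t} (\<lambda>s. F y s - F z s)) \<le> integral {t0..?t} (\<lambda>s. L s * W s * dist y z)"
    proof (rule integral_norm_bound_integral)
      show "(\<lambda>s. F y s - F z s) integrable_on {t0..?t}" by (intro integrable_diff Fi yc zc)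
      show "(\<lambda>s. L s * W s * dist y z) integrable_on {t0..?t}" 
        using has_integral_integrable[OF LW[of ?t]] by (intro integrable_on_mult_left) simp
      fix s assume s: "s \<in> {t0..?t}"
      have "norm (F y s - F z s) \<le> L s * dist (x0 + W s *\<^sub>R y s) (x0 + W s *\<^sub>R z s)"
        using lip[of s "x0 + W s *\<^sub>R y s" "x0 + W s *\<^sub>R z s"] s by (simp add: F_def dist_norm)
      also have "\<dots> = L s * (W s * dist (y s) (z s))"
        using Wpos[of s] by (simp add: dist_norm scaleR_diff_right[symmetric])
      also have "\<dots> \<le> L s * (W s * dist y z)"
        using Lnn s Wpos[of s] by (intro mult_left_mono dist_bounded) (auto simp: less_imp_le)
      finally show "norm (F y s - F z s) \<le> L s * W s * dist y z" by (simp add: mult.assoc)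
    qed
    have C: "integral {t0..?t} (\<lambda>s. L s * W s * dist y z) = (W ?t - 1) / 2 * dist y z"
      by (intro integral_unique has_integral_mult_left LW) simp
    have "dist (T y t) (T z t) = norm (integral {t0..?t} (\<lambda>s. F y s - F z s)) / W ?t"
      unfolding dist_norm A using Wpos[of ?t] by simp
    also have "\<dots> \<le> (W ?t - 1) / 2 * dist y z / W ?t"
      using B unfolding C by (rule divide_right_mono) (rule less_imp_le[OF Wpos])
    also have "\<dots> = (W ?t - 1) / 2 / W ?t * dist y z" by simp
    also have "\<dots> \<le> 1 / 2 * dist y z" by (intro mult_right_mono half) auto
    finally show "dist (T y t) (T z t) \<le> 1 / 2 * dist y z" .
  qed
  then obtain y where y: "TT y = y" using banach_fix_type[of "1 / 2" TT] by auto
  define x where "x t = x0 + W t *\<^sub>R y t" for t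
  have yc: "continuous_on UNIV (apply_bcontfun y)" by auto
  have x: "x t = x0 + integral {t0..t} (F y)" if "t0 \<le> t" for t
  proof -
    have "y t = T y t" using y TT by metis
    then show ?thesis using that Wpos[of t] by (simp add: x_def T_def max_absorb2)
  qed
  have "(x has_vector_derivative f t (x t)) (at t within {t0..})" if "t0 \<le> t" for t
  proof (rule has_vector_derivative_transform)
    have "((\<lambda>t. x0 + integral {t0..t} (F y)) has_vector_derivative 0 + F y t) (at t within {t0..})"
      by (intro has_vector_derivative_add has_vector_derivative_const indefinite_integral_has_vector_derivative Fc yc that)
    then show "((\<lambda>t. x0 + integral {t0..t} (F y)) has_vector_derivative f t (x t)) (at t within {t0..})"
      by (simp add: F_def x_def)
  qed (use that x in auto)
  moreover have "x t0 = x0" using x[of t0] by simp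
  ultimately show ?thesis by blast
qed

subsection \<open>Bounded Lipschitz functions\<close>

text \<open>Boundedness is carried along because a product of Lipschitz functions is Lipschitz when
  the factors are bounded. The class is then closed under every bilinear operation from which the
  field is assembled.\<close>

definition lip_bounded :: "'a::metric_space set \<Rightarrow> ('a \<Rightarrow> 'b::real_normed_vector) \<Rightarrow> bool" where
  "lip_bounded S f \<longleftrightarrow> bounded (f ` S) \<and> (\<exists>L. L-lipschitz_on S f)"

lemma lip_boundedI:
  assumes "\<And>x. x \<in> S \<Longrightarrow> norm (f x) \<le> B" and "\<And>x y. x \<in> S \<Longrightarrow> y \<in> S \<Longrightarrow> dist (f x) (f y) \<le> L * dist x y" and "0 \<le> L"
  shows "lip_bounded S f"
  using assms by (auto simp: lip_bounded_def bounded_iff lipschitz_on_def)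

lemma lip_boundedD:
  assumes "lip_bounded S f"
  shows "\<exists>B\<ge>0. \<exists>L\<ge>0. (\<forall>x\<in>S. norm (f x) \<le> B) \<and> (\<forall>x\<in>S. \<forall>y\<in>S. dist (f x) (f y) \<le> L * dist x y)"
proof -
  obtain B where B: "\<forall>x\<in>S. norm (f x) \<le> B" using assms by (auto simp: lip_bounded_def bounded_iff)
  obtain L where L: "L-lipschitz_on S f" using assms by (auto simp: lip_bounded_def)
  show ?thesis
    by (rule exI[of _ "max B 0"], rule conjI[OF _ exI[of _ L]])
       (use B L in \<open>auto simp: lipschitz_on_def intro: max.coboundedI1\<close>)
qed

lemma lip_bounded_const [intro]: "lip_bounded S (\<lambda>x. c)"
  by (rule lip_boundedI[of _ _ "norm c" 0]) auto

lemma lip_bounded_id: "bounded S \<Longrightarrow> lip_bounded S (\<lambda>x. x)" for S :: "'a::real_normed_vector set"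
  by (auto simp: bounded_iff intro!: lip_boundedI[of _ _ _ 1])

lemma lip_bounded_bounded_linear:
  assumes "bounded_linear h" "lip_bounded S f"
  shows "lip_bounded S (\<lambda>x. h (f x))"
proof -
  obtain K where K: "\<And>x. norm (h x) \<le> norm x * K" "0 < K" using bounded_linear.pos_bounded[OF assms(1)] by blast
  obtain B L where f: "\<And>x. x \<in> S \<Longrightarrow> norm (f x) \<le> B" "\<And>x y. x \<in> S \<Longrightarrow> y \<in> S \<Longrightarrow> dist (f x) (f y) \<le> L * dist x y" "0 \<le> L"
    using lip_boundedD[OF assms(2)] by blast
  show ?thesis
  proof (rule lip_boundedI[of _ _ "B * K" "L * K"])
    fix x assume "x \<in> S"
    then show "norm (h (f x)) \<le> B * K" using K f(1)[of x] by (meson mult_right_mono less_imp_le order_trans)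
    fix y assume "y \<in> S"
    have "dist (h (f x)) (h (f y)) \<le> norm (f x - f y) * K"
      using K(1)[of "f x - f y"] by (simp add: dist_norm linear_diff[OF bounded_linear.linear[OF assms(1)]])
    also have "\<dots> \<le> (L * dist x y) * K" using f(2)[OF \<open>x \<in> S\<close> \<open>y \<in> S\<close>] K by (intro mult_right_mono) (auto simp: dist_norm)
    finally show "dist (h (f x)) (h (f y)) \<le> L * K * dist x y" by (simp add: mult_ac)
  qed (use K f in auto)
qed

lemma lip_bounded_Pair:
  assumes "lip_bounded S f" "lip_bounded S g"
  shows "lip_bounded S (\<lambda>x. (f x, g x))"
proof -
  obtain B L where f: "\<And>x. x \<in> S \<Longrightarrow> norm (f x) \<le> B" "\<And>x y. x \<in> S \<Longrightarrow> y \<in> S \<Longrightarrow> dist (f x) (f y) \<le> L * dist x y" "0 \<le> L"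
    using lip_boundedD[OF assms(1)] by blast
  obtain B' L' where g: "\<And>x. x \<in> S \<Longrightarrow> norm (g x) \<le> B'" "\<And>x y. x \<in> S \<Longrightarrow> y \<in> S \<Longrightarrow> dist (g x) (g y) \<le> L' * dist x y" "0 \<le> L'"
    using lip_boundedD[OF assms(2)] by blast
  show ?thesis
  proof (rule lip_boundedI[of _ _ "B + B'" "L + L'"])
    fix x assume "x \<in> S"
    then show "norm (f x, g x) \<le> B + B'" using norm_Pair_le[of "f x" "g x"] f(1) g(1) by (meson add_mono order_trans)
    fix y assume "y \<in> S"
    have "dist (f x, g x) (f y, g y) \<le> dist (f x) (f y) + dist (g x) (g y)"
      using norm_Pair_le[of "f x - f y" "g x - g y"] by (simp add: dist_norm)
    then show "dist (f x, g x) (f y, g y) \<le> (L + L') * dist x y"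
      using f(2)[OF \<open>x \<in> S\<close> \<open>y \<in> S\<close>] g(2)[OF \<open>x \<in> S\<close> \<open>y \<in> S\<close>] by (simp add: distrib_right)
  qed (use f g in auto)
qed

lemma lip_bounded_add: "lip_bounded S f \<Longrightarrow> lip_bounded S g \<Longrightarrow> lip_bounded S (\<lambda>x. f x + g x)"
  using lip_bounded_bounded_linear[OF bounded_linear_add[OF bounded_linear_fst bounded_linear_snd] lip_bounded_Pair] by fastforce

lemma lip_bounded_diff: "lip_bounded S f \<Longrightarrow> lip_bounded S g \<Longrightarrow> lip_bounded S (\<lambda>x. f x - g x)"
  using lip_bounded_bounded_linear[OF bounded_linear_sub[OF bounded_linear_fst bounded_linear_snd] lip_bounded_Pair] by fastforce

lemma lip_bounded_bilinear:
  assumes "bounded_bilinear h" "lip_bounded S f" "lip_bounded S g"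
  shows "lip_bounded S (\<lambda>x. h (f x) (g x))"
proof -
  interpret h: bounded_bilinear h by fact
  obtain K where K: "\<And>x y. norm (h x y) \<le> norm x * norm y * K" "0 < K" using h.pos_bounded by blast
  obtain B L where f: "\<And>x. x \<in> S \<Longrightarrow> norm (f x) \<le> B" "\<And>x y. x \<in> S \<Longrightarrow> y \<in> S \<Longrightarrow> dist (f x) (f y) \<le> L * dist x y" "0 \<le> L" "0 \<le> B"
    using lip_boundedD[OF assms(2)] by blast
  obtain B' L' where g: "\<And>x. x \<in> S \<Longrightarrow> norm (g x) \<le> B'" "\<And>x y. x \<in> S \<Longrightarrow> y \<in> S \<Longrightarrow> dist (g x) (g y) \<le> L' * dist x y" "0 \<le> L'" "0 \<le> B'"
    using lip_boundedD[OF assms(3)] by blast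
  show ?thesis
  proof (rule lip_boundedI[of _ _ "B * B' * K" "(L * B' + B * L') * K"])
    fix x assume x: "x \<in> S"
    have "norm (f x) * norm (g x) * K \<le> B * B' * K" using f g K x by (intro mult_right_mono mult_mono) auto
    then show "norm (h (f x) (g x)) \<le> B * B' * K" using K(1)[of "f x" "g x"] by linarith
    fix y assume y: "y \<in> S"
    have "dist (h (f x) (g x)) (h (f y) (g y)) = norm (h (f x - f y) (g x) + h (f y) (g x - g y))"
      by (simp add: dist_norm h.diff_left h.diff_right)
    also have "\<dots> \<le> norm (f x - f y) * norm (g x) * K + norm (f y) * norm (g x - g y) * K"
      by (intro norm_triangle_le add_mono K)
    also have "\<dots> \<le> (L * dist x y) * B' * K + B * (L' * dist x y) * K"
      using f g K x y by (intro add_mono mult_right_mono mult_mono) (auto simp: dist_norm)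
    finally show "dist (h (f x) (g x)) (h (f y) (g y)) \<le> (L * B' + B * L') * K * dist x y" by (simp add: algebra_simps)
  qed (use K f g in auto)
qed

lemma lip_bounded_compose:
  assumes "lip_bounded T h" "lip_bounded S f" "f ` S \<subseteq> T"
  shows "lip_bounded S (\<lambda>x. h (f x))"
proof -
  obtain B L where f: "\<And>x. x \<in> S \<Longrightarrow> norm (f x) \<le> B" "\<And>x y. x \<in> S \<Longrightarrow> y \<in> S \<Longrightarrow> dist (f x) (f y) \<le> L * dist x y" "0 \<le> L"
    using lip_boundedD[OF assms(2)] by blast
  obtain B' L' where h: "\<And>x. x \<in> T \<Longrightarrow> norm (h x) \<le> B'" "\<And>x y. x \<in> T \<Longrightarrow> y \<in> T \<Longrightarrow> dist (h x) (h y) \<le> L' * dist x y" "0 \<le> L'"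
    using lip_boundedD[OF assms(1)] by blast
  show ?thesis
  proof (rule lip_boundedI[of _ _ B' "L' * L"])
    fix x assume x: "x \<in> S"
    then show "norm (h (f x)) \<le> B'" using h(1) assms(3) by auto
    fix y assume y: "y \<in> S"
    have "dist (h (f x)) (h (f y)) \<le> L' * dist (f x) (f y)" using h(2) assms(3) x y by auto
    also have "\<dots> \<le> L' * (L * dist x y)" using f(2)[OF x y] h(3) by (rule mult_left_mono)
    finally show "dist (h (f x)) (h (f y)) \<le> L' * L * dist x y" by (simp add: mult.assoc)
  qed (use h f in auto)
qed

lemma lip_bounded_norm:
  assumes "lip_bounded S f"
  shows "lip_bounded S (\<lambda>x. norm (f x))"
proof -
  obtain B L where f: "\<And>x. x \<in> S \<Longrightarrow> norm (f x) \<le> B" "\<And>x y. x \<in> S \<Longrightarrow> y \<in> S \<Longrightarrow> dist (f x) (f y) \<le> L * dist x y" "0 \<le> L"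
    using lip_boundedD[OF assms] by blast
  have "dist (norm (f x)) (norm (f y)) \<le> L * dist x y" if "x \<in> S" "y \<in> S" for x y
    using norm_triangle_ineq3[of "f x" "f y"] f(2)[OF that] by (simp add: dist_norm)
  then show ?thesis using f by (intro lip_boundedI[of _ _ B L]) auto
qed

text \<open>The field depends on time only through a term linear in \<xi>. As \<xi> is continuous
  but possibly unbounded, the Lipschitz constant is a continuous function of time built from
  \<open>norm (\<xi> t)\<close>.\<close>

theorem ode_solution_exists:
  fixes H0 :: "'a::banach \<Rightarrow> 'a" and H1 :: "'a \<Rightarrow> 'b::real_normed_vector" and \<xi> :: "real \<Rightarrow> 'c::real_normed_vector"
  assumes "lip_bounded UNIV H0" "lip_bounded UNIV H1" "bounded_bilinear B" "continuous_on {t0..} \<xi>"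
  shows "\<exists>x. x t0 = x0 \<and> (\<forall>t\<ge>t0. (x has_vector_derivative H0 (x t) + B (H1 (x t)) (\<xi> t)) (at t within {t0..}))"
proof -
  interpret B: bounded_bilinear B by fact
  obtain K where K: "\<And>x y. norm (B x y) \<le> norm x * norm y * K" "0 < K" using B.pos_bounded by blast
  obtain B0 L0 where 0: "\<And>x. norm (H0 x) \<le> B0" "\<And>x y. dist (H0 x) (H0 y) \<le> L0 * dist x y" "0 \<le> L0" "0 \<le> B0"
    using lip_boundedD[OF assms(1)] by auto
  obtain B1 L1 where 1: "\<And>x. norm (H1 x) \<le> B1" "\<And>x y. dist (H1 x) (H1 y) \<le> L1 * dist x y" "0 \<le> L1" "0 \<le> B1"
    using lip_boundedD[OF assms(2)] by auto
  define L where "L t = (B0 + L0) + (B1 + L1) * norm (\<xi> t) * K" for t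
  have H0c: "continuous_on UNIV H0" and H1c: "continuous_on UNIV H1"
    using assms(1,2) lipschitz_on_continuous_on by (auto simp: lip_bounded_def)
  show ?thesis
  proof (rule picard_global[where L = L])
    fix y :: "real \<Rightarrow> 'a" assume y: "continuous_on {t0..} y"
    show "continuous_on {t0..} (\<lambda>s. H0 (y s) + B (H1 (y s)) (\<xi> s))"
      by (intro continuous_on_add B.continuous_on assms(4) continuous_on_compose2[OF H0c y] continuous_on_compose2[OF H1c y]) auto
  next
    fix t x y
    have "dist (H0 x + B (H1 x) (\<xi> t)) (H0 y + B (H1 y) (\<xi> t)) = norm ((H0 x - H0 y) + B (H1 x - H1 y) (\<xi> t))"
      by (simp add: dist_norm B.diff_left algebra_simps)
    also have "\<dots> \<le> norm (H0 x - H0 y) + norm (H1 x - H1 y) * norm (\<xi> t) * K"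
      by (intro norm_triangle_le add_mono K) auto
    also have "\<dots> \<le> L0 * dist x y + (L1 * dist x y) * norm (\<xi> t) * K"
      using 0(2) 1(2) K by (intro add_mono mult_right_mono) (auto simp: dist_norm)
    also have "\<dots> \<le> L t * dist x y"
      using 0 1 K by (simp add: L_def algebra_simps)
    finally show "dist (H0 x + B (H1 x) (\<xi> t)) (H0 y + B (H1 y) (\<xi> t)) \<le> L t * dist x y" .
  next
    fix t x
    have "norm (H0 x + B (H1 x) (\<xi> t)) \<le> B0 + norm (H1 x) * norm (\<xi> t) * K"
      by (intro norm_triangle_le add_mono K 0)
    also have "\<dots> \<le> B0 + B1 * norm (\<xi> t) * K" using 1 K by (intro add_left_mono mult_right_mono) auto
    also have "\<dots> \<le> L t" using 0 1 K by (simp add: L_def algebra_simps)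
    finally show "norm (H0 x + B (H1 x) (\<xi> t)) \<le> L t" .
  next
    show "continuous_on {t0..} L" unfolding L_def by (intro continuous_intros assms(4))
  qed
qed

section \<open>Lipschitz continuity of the error field\<close>

text \<open>The value \<open>h 0\<close> is irrelevant: the derivative formulas to which this is
  applied have a removable singularity there.\<close>

lemma filled_continuous_on_bounded:
  fixes h :: "real \<Rightarrow> real"
  assumes "\<And>t. 0 < t \<Longrightarrow> t \<le> r \<Longrightarrow> isCont h t" and "(h \<longlongrightarrow> l) (at 0)" and "0 \<le> r"
  shows "\<exists>B. \<forall>t. 0 < t \<and> t \<le> r \<longrightarrow> \<bar>h t\<bar> \<le> B"
proof -
  define k where "k x = (if x = 0 then l else h x)" for x
  have "isCont k t" if "t \<in> {0..r}" for t
  proof (cases "t = 0")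
    case True
    then show ?thesis unfolding k_def using filled_isCont[OF assms(2)] by simp
  next
    case False
    then have "isCont h t" using that assms(1) by simp
    moreover have "\<forall>\<^sub>F x in nhds t. h x = k x"
      using t1_space_nhds[OF False] by (rule eventually_mono) (simp add: k_def)
    ultimately show ?thesis using isCont_cong by metis
  qed
  then have "continuous_on {0..r} k" by (simp add: continuous_at_imp_continuous_on)
  then have "bounded (k ` {0..r})" by (intro compact_imp_bounded compact_continuous_image) auto
  then obtain B where B: "\<forall>t\<in>{0..r}. \<bar>k t\<bar> \<le> B" unfolding bounded_iff by auto
  have "\<bar>h t\<bar> \<le> B" if "0 < t" "t \<le> r" for t using B[rule_format, of t] that by (simp add: k_def)
  then show ?thesis by blast
qed

text \<open>The mean value theorem with a bounded derivative. At the splice point 0 it relies on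
  continuity of \<open>h\<close> and a limit of \<open>h'\<close>.\<close>

lemma lip_bounded_of_derivative:
  fixes h :: "real \<Rightarrow> real"
  assumes d: "\<And>t. 0 < t \<Longrightarrow> t \<le> r \<Longrightarrow> (h has_real_derivative h' t) (at t)" and c: "isCont h 0"
    and h': "\<And>t. 0 < t \<Longrightarrow> t \<le> r \<Longrightarrow> isCont h' t" "(h' \<longlongrightarrow> l) (at 0)" and r: "0 \<le> r"
  shows "lip_bounded {0..r} h"
proof -
  obtain B where B: "\<And>t. 0 < t \<Longrightarrow> t \<le> r \<Longrightarrow> \<bar>h' t\<bar> \<le> B" using filled_continuous_on_bounded[OF h' r] by blast
  then have B': "\<And>t. 0 < t \<Longrightarrow> t \<le> r \<Longrightarrow> \<bar>h' t\<bar> \<le> max B 0" by fastforce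
  have cont: "continuous_on {0..r} h"
    using c DERIV_isCont[OF d] by (intro continuous_at_imp_continuous_on) (metis atLeastAtMost_iff less_eq_real_def)
  have lt: "\<bar>h y - h x\<bar> \<le> max B 0 * (y - x)" if "0 \<le> x" "x < y" "y \<le> r" for x y
  proof -
    have "\<exists>z>x. z < y \<and> h y - h x = (y - x) * h' z"
    proof -
      have "\<exists>l z. x < z \<and> z < y \<and> DERIV h z :> l \<and> h y - h x = (y - x) * l"
        using that by (intro MVT continuous_on_subset[OF cont]) (auto simp: real_differentiable_def intro!: exI d)
      then obtain l z where z: "x < z" "z < y" "DERIV h z :> l" "h y - h x = (y - x) * l" by blast
      then have "l = h' z" using d[of z] that DERIV_unique by force
      then show ?thesis using z by blast
    qed
    then obtain z where z: "x < z" "z < y" "h y - h x = (y - x) * h' z" by blast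
    then have "\<bar>h y - h x\<bar> = \<bar>h' z\<bar> * (y - x)" using that by (simp add: abs_mult)
    also have "\<dots> \<le> max B 0 * (y - x)" using B'[of z] z that by (intro mult_right_mono) auto
    finally show ?thesis .
  qed
  have "bounded (h ` {0..r})" using cont by (intro compact_imp_bounded compact_continuous_image) auto
  then obtain C where C: "\<forall>x\<in>{0..r}. norm (h x) \<le> C" unfolding bounded_iff by auto
  show ?thesis
  proof (rule lip_boundedI)
    fix x y assume "x \<in> {0..r}" "y \<in> {0..r}"
    then show "dist (h x) (h y) \<le> max B 0 * dist x y"
      using lt[of x y] lt[of y x] by (cases x y rule: linorder_cases) (auto simp: dist_real_def abs_minus_commute)
  qed (use C in auto)
qed

text \<open>The Riccati equation solved for \<open>coef_T2\<close>. Its derivative then follows from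
  that of \<open>coef_A\<close>, without differentiating the trigonometric quotient.\<close>

lemma coef_T2_eq: "0 < t \<Longrightarrow> t < pi \<Longrightarrow> coef_T2 t = (1/4 - 3 * coef_A t + t\<^sup>2 * (coef_A t)\<^sup>2) / t\<^sup>2"
  using coef_T1_riccati[of t] rodrigues_coef_identities(3)[of t] by (simp add: field_simps)

lemma coef_T2_deriv:
  assumes "0 < t" "t < pi"
  shows "(coef_T2 has_real_derivative (2 * (coef_A t)\<^sup>2 - 5 * coef_T2 t + 2 * t\<^sup>2 * coef_A t * coef_T2 t) / t) (at t)"
proof -
  have T: "t\<^sup>2 * coef_T2 t = 1/4 - 3 * coef_A t + t\<^sup>2 * (coef_A t)\<^sup>2" using coef_T2_eq[OF assms] assms by simp
  have "((\<lambda>t. (1/4 - 3 * coef_A t + t\<^sup>2 * (coef_A t)\<^sup>2) / t\<^sup>2) has_real_derivative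
    ((- 3 * (t * coef_T2 t) + (2 * t * (coef_A t)\<^sup>2 + 2 * coef_A t * (t * coef_T2 t) * t\<^sup>2)) * t\<^sup>2
      - (1/4 - 3 * coef_A t + t\<^sup>2 * (coef_A t)\<^sup>2) * (2 * t)) / (t\<^sup>2 * t\<^sup>2)) (at t)"
    using assms by (auto intro!: derivative_eq_intros coef_deriv(1) simp: power2_eq_square)
  also have "((- 3 * (t * coef_T2 t) + (2 * t * (coef_A t)\<^sup>2 + 2 * coef_A t * (t * coef_T2 t) * t\<^sup>2)) * t\<^sup>2
      - (1/4 - 3 * coef_A t + t\<^sup>2 * (coef_A t)\<^sup>2) * (2 * t)) / (t\<^sup>2 * t\<^sup>2)
    = (2 * (coef_A t)\<^sup>2 - 5 * coef_T2 t + 2 * t\<^sup>2 * coef_A t * coef_T2 t) / t"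
    unfolding T[symmetric] using assms by (simp add: field_simps power2_eq_square)
  finally have *: "((\<lambda>t. (1/4 - 3 * coef_A t + t\<^sup>2 * (coef_A t)\<^sup>2) / t\<^sup>2) has_real_derivative
     (2 * (coef_A t)\<^sup>2 - 5 * coef_T2 t + 2 * t\<^sup>2 * coef_A t * coef_T2 t) / t) (at t)" .
  show ?thesis
    by (rule DERIV_cong_ev[THEN iffD1, OF refl _ refl *])
      (rule eventually_nhds_in_open[of "{0<..<pi}", THEN eventually_mono], use assms coef_T2_eq in auto)
qed

lemma coef_T2_deriv_tendsto:
  "((\<lambda>t. (2 * (coef_A t)\<^sup>2 - 5 * coef_T2 t + 2 * t\<^sup>2 * coef_A t * coef_T2 t) / t) \<longlongrightarrow> 0) (at 0)"
proof -
  have "((\<lambda>t::real. ((1 / t\<^sup>2 - (1 + cos t) / (2 * t * sin t)) - 1 / 12) / t) \<longlongrightarrow> 0) (at 0)"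
    by real_asymp
  then have A: "((\<lambda>t. (coef_A t - 1 / 12) / t) \<longlongrightarrow> 0) (at 0)"
    by (rule Lim_transform_eventually) (auto simp: eventually_at_filter coef_A_def)
  have "((\<lambda>t::real. (((1 + cos t) * (t + sin t) / (2 * t^3 * (sin t)\<^sup>2) - 2 / t^4) - 1 / 360) / t) \<longlongrightarrow> 0) (at 0)"
    by real_asymp
  then have T: "((\<lambda>t. (coef_T2 t - 1 / 360) / t) \<longlongrightarrow> 0) (at 0)"
    by (rule Lim_transform_eventually) (auto simp: eventually_at_filter coef_T2_def)
  \<comment> \<open>The values at 0 fit together: \<open>2 * (1/12)^2 = 5 * (1/360)\<close>.
    Subtracting them leaves the numerator unchanged and produces two quotients that tend to
    0.\<close>
  have "((\<lambda>t. 2 * (coef_A t + 1 / 12) * ((coef_A t - 1 / 12) / t) - 5 * ((coef_T2 t - 1 / 360) / t)) \<longlongrightarrow> 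
     2 * (coef_A 0 + 1 / 12) * 0 - 5 * 0) (at 0)"
    using coef_A_isCont by (intro tendsto_intros A T) (simp add: isCont_def)
  then have "((\<lambda>t. (2 * (coef_A t)\<^sup>2 - 5 * coef_T2 t) / t) \<longlongrightarrow> 0) (at 0)"
    by (simp, elim Lim_transform_eventually) (auto simp: eventually_at_filter field_simps power2_eq_square)
  moreover have "((\<lambda>t. 2 * t * coef_A t * coef_T2 t) \<longlongrightarrow> 2 * 0 * coef_A 0 * coef_T2 0) (at 0)"
    using coef_A_isCont coef_T2_isCont by (intro tendsto_intros) (simp_all add: isCont_def)
  ultimately have "((\<lambda>t. (2 * (coef_A t)\<^sup>2 - 5 * coef_T2 t) / t + 2 * t * coef_A t * coef_T2 t) \<longlongrightarrow> 0) (at 0)"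
    using tendsto_add by fastforce
  then show ?thesis
    by (rule Lim_transform_eventually) (auto simp: eventually_at_filter field_simps power2_eq_square)
qed

lemma coef_lip_bounded:
  assumes "0 \<le> r" "r < pi"
  shows "lip_bounded {0..r} coef_A" "lip_bounded {0..r} coef_S1" "lip_bounded {0..r} coef_S2"
    "lip_bounded {0..r} coef_T1" "lip_bounded {0..r} coef_T2"
proof -
  have T2c: "isCont coef_T2 t" if "0 \<le> t" "t \<le> r" for t
    using coef_T2_deriv[of t, THEN DERIV_isCont] coef_T2_isCont that assms by (cases "t = 0") auto
  have Ac: "isCont coef_A t" if "0 \<le> t" "t \<le> r" for t using coef_isCont that assms by auto
  have "((\<lambda>t. t * coef_T2 t) \<longlongrightarrow> 0 * coef_T2 0) (at 0)"
    using coef_T2_isCont by (intro tendsto_intros) (simp add: isCont_def)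
  then show A: "lip_bounded {0..r} coef_A"
    by (rule lip_bounded_of_derivative[rotated 3])
       (use assms coef_deriv(1) coef_A_isCont T2c in \<open>auto intro!: continuous_intros\<close>)
  have "((\<lambda>t::real. (t * sin t - 2 * (1 - cos t)) / t ^ 3) \<longlongrightarrow> 0) (at 0)" by real_asymp
  then show "lip_bounded {0..r} coef_S1"
    by (rule lip_bounded_of_derivative[rotated 3])
       (use assms coef_deriv(2) coef_S1_isCont in \<open>auto intro!: continuous_intros\<close>)
  have "((\<lambda>t::real. (t * (1 - cos t) - 3 * (t - sin t)) / t ^ 4) \<longlongrightarrow> 0) (at 0)" by real_asymp
  then show "lip_bounded {0..r} coef_S2"
    by (rule lip_bounded_of_derivative[rotated 3])
       (use assms coef_deriv(3) coef_S2_isCont in \<open>auto intro!: continuous_intros\<close>)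
  show T2: "lip_bounded {0..r} coef_T2"
    by (rule lip_bounded_of_derivative[OF coef_T2_deriv coef_T2_isCont _ coef_T2_deriv_tendsto])
       (use assms Ac T2c in \<open>auto intro!: continuous_intros\<close>)
  have id: "lip_bounded {0..r} (\<lambda>t. t)" by (rule lip_bounded_id) simp
  note times = lip_bounded_bilinear[OF bounded_bilinear_mult]
  \<comment> \<open>\<open>coef_T1\<close> is recovered from the other two coefficients, so its own
    derivative is never formed.\<close>
  have "lip_bounded {0..r} (\<lambda>t. 2 * coef_A t + (t * t) * coef_T2 t)"
    by (intro lip_bounded_add times A T2 id lip_bounded_const)
  moreover have "coef_T1 t = 2 * coef_A t + (t * t) * coef_T2 t" if "t \<in> {0..r}" for t
    using rodrigues_coef_identities(3)[of t] that assms by (simp add: power2_eq_square)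
  ultimately show "lip_bounded {0..r} coef_T1"
    unfolding lip_bounded_def lipschitz_on_def by simp
qed

text \<open>Radius 1 lies below pi, so rotation vectors in this ball stay away from the singularity
  of \<open>coef_A\<close>.\<close>

definition err_domain :: "((real^(3+3)) \<times> (real^(3+3))) set" where
  "err_domain = cball 0 1"

lemma err_domain_norm:
  assumes "x \<in> err_domain"
  shows "norm (fst_block (fst x)) \<le> 1"
proof -
  have "(norm (fst x))\<^sup>2 = (norm (fst_block (fst x)))\<^sup>2 + (norm (snd_block (fst x)))\<^sup>2"
    by (simp add: power2_norm_eq_inner inner_blocks)
  then have "norm (fst_block (fst x)) \<le> norm (fst x)" by - (rule power2_le_imp_le, auto)
  also have "\<dots> \<le> norm x" using norm_fst_le[of "fst x" "snd x"] by simp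
  finally show ?thesis using assms by (simp add: err_domain_def)
qed

lemma bounded_bilinear_outer_prod: "bounded_bilinear (outer_prod :: real^'n \<Rightarrow> real^'m \<Rightarrow> _)"
  by (auto simp: bilinear_conv_bounded_bilinear[symmetric] bilinear_def intro!: linearI
     simp: vec_eq_iff outer_prod_def algebra_simps)

lemma bounded_linear_skew: "bounded_linear skew"
  by (auto intro!: linear_conv_bounded_linear[THEN iffD1] linearI)

lemmas lip_bounded_matrix_vector = lip_bounded_bilinear[OF bounded_bilinear_matrix_vector_mult]
  and lip_bounded_matrix_mult = lip_bounded_bilinear[OF bounded_bilinear_matrix_mult]
  and lip_bounded_outer_prod = lip_bounded_bilinear[OF bounded_bilinear_outer_prod]
  and lip_bounded_scaleR = lip_bounded_bilinear[OF bounded_bilinear_scaleR]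
  and lip_bounded_inner = lip_bounded_bilinear[OF bounded_bilinear_inner]
  and lip_bounded_mult = lip_bounded_bilinear[OF bounded_bilinear_mult]
  and lip_bounded_skew = lip_bounded_bounded_linear[OF bounded_linear_skew]
  and lip_bounded_transpose = lip_bounded_bounded_linear[OF bounded_linear_transpose]

lemma G_mat_lip_bounded:
  assumes \<Theta>: "lip_bounded S \<Theta>" "\<And>x. x \<in> S \<Longrightarrow> norm (\<Theta> x) \<le> 1" and \<beta>: "lip_bounded S \<beta>"
  shows "lip_bounded S (\<lambda>x. G_mat (join (\<Theta> x) (\<beta> x)))"
proof -
  have c: "lip_bounded S (\<lambda>x. h (norm (\<Theta> x)))" if "lip_bounded {0..1} h" for h :: "real \<Rightarrow> real"
    using that lip_bounded_norm[OF \<Theta>(1)] by (rule lip_bounded_compose) (use \<Theta>(2) in auto)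
  have "1 < pi" using pi_gt3 by simp
  note coefs = coef_lip_bounded[OF zero_le_one this, THEN c]
  note X = lip_bounded_skew[OF \<Theta>(1)]
  have A: "lip_bounded S (\<lambda>x. A_mat (\<Theta> x))"
    unfolding A_mat_def by (intro lip_bounded_add lip_bounded_scaleR lip_bounded_matrix_mult lip_bounded_const X coefs)
  have Smat: "lip_bounded S (\<lambda>x. S_mat (\<Theta> x))"
    unfolding S_mat_def by (intro lip_bounded_add lip_bounded_scaleR lip_bounded_matrix_mult lip_bounded_const X coefs)
  have T: "lip_bounded S (\<lambda>x. T_mat (\<Theta> x) (\<beta> x))"
    unfolding T_mat_def
    by (intro lip_bounded_add lip_bounded_diff lip_bounded_scaleR lip_bounded_matrix_mult lip_bounded_const
      lip_bounded_skew lip_bounded_matrix_vector lip_bounded_outer_prod lip_bounded_inner lip_bounded_mult A Smat \<Theta>(1) \<beta> coefs)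
  have "bounded_linear (\<lambda>p :: (real^3^3) \<times> (real^3^3). block_mat (fst p) (0 :: real^3^3) (snd p) (fst p))"
    by (auto intro!: linear_conv_bounded_linear[THEN iffD1] linearI simp: block_mat_linear)
  from lip_bounded_bounded_linear[OF this lip_bounded_Pair[OF A T]] show ?thesis by (simp add: G_mat_def)
qed

section \<open>The closed error system\<close>

text \<open>The error system in the coordinates \<open>(\<eta>, u)\<close>. The motion of the body
  enters only through \<xi>; the pose and the applied forces have cancelled.\<close>

definition err_solution ::
  "real^3^3 \<Rightarrow> real \<Rightarrow> real \<Rightarrow> real \<Rightarrow> real \<Rightarrow> (real \<Rightarrow> real^(3+3)) \<Rightarrow> real set
    \<Rightarrow> (real \<Rightarrow> real^(3+3)) \<Rightarrow> (real \<Rightarrow> real^(3+3)) \<Rightarrow> bool" where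
  "err_solution J m k1 k2 k3 \<xi> I \<eta> u \<longleftrightarrow> (\<forall>t\<in>I. norm (fst_block (\<eta> t)) < pi \<and>
     (\<eta> has_vector_derivative G_mat (\<eta> t) *v (u t - k1 *\<^sub>R \<eta> t)) (at t within I) \<and>
     (\<exists>u'. (u has_vector_derivative u') (at t within I) \<and> inertia J m *v u' = err_force J m k2 k3 (\<xi> t) (\<eta> t) (u t)))"

lemma forward_intervals_props:
  assumes "I \<in> forward_intervals t0"
  shows "t0 \<in> I" "I \<subseteq> {t0..}" "t \<in> I \<Longrightarrow> {t0..t} \<subseteq> I"
  using assms by (auto simp: forward_intervals_def)

text \<open>The derivative of \<open>V\<close> is at most \<open>- c V\<close>, so \<open>V\<close>
  times the growing exponential is nonincreasing. The rate \<open>c\<close> is chosen before the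
  motion, the initial time and the solution.\<close>

lemma lyapunov_decay:
  assumes "k1 > 0" "k2 > 0" "k3 > 0" "m > 0" "transpose J = J" "\<And>v. v \<noteq> 0 \<Longrightarrow> v \<bullet> (J *v v) > 0"
  shows "\<exists>c>0. \<forall>\<xi> t0 I \<eta> u t. I \<in> forward_intervals t0 \<longrightarrow> err_solution J m k1 k2 k3 \<xi> I \<eta> u \<longrightarrow> t \<in> I \<longrightarrow>
     lyapunov J m k2 (\<eta> t) (u t) \<le> lyapunov J m k2 (\<eta> t0) (u t0) * exp (- c * (t - t0))"
proof -
  obtain c where c: "c > 0" "\<And>\<eta> u. c * lyapunov J m k2 \<eta> u \<le> k1 * (\<eta> \<bullet> (gain_K k2 *v \<eta>)) + k3 * (u \<bullet> (gain_K k2 *v u))"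
    using lyapunov_bounds(2)[of J m k2 k1 k3] assms by blast
  have "lyapunov J m k2 (\<eta> t) (u t) \<le> lyapunov J m k2 (\<eta> t0) (u t0) * exp (- c * (t - t0))"
    if I: "I \<in> forward_intervals t0" and sol: "err_solution J m k1 k2 k3 \<xi> I \<eta> u" and t: "t \<in> I" for \<xi> t0 I \<eta> u t
  proof -
    define V where "V s = lyapunov J m k2 (\<eta> s) (u s)" for s
    define D where "D s = - k1 * (\<eta> s \<bullet> (gain_K k2 *v \<eta> s)) - k3 * (u s \<bullet> (gain_K k2 *v u s))" for s
    have V: "(V has_real_derivative D s) (at s within I)" if "s \<in> I" for s
    proof -
      from sol that obtain u' where 1: "norm (fst_block (\<eta> s)) < pi"
        "(\<eta> has_vector_derivative G_mat (\<eta> s) *v (u s - k1 *\<^sub>R \<eta> s)) (at s within I)"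
        "(u has_vector_derivative u') (at s within I)" "inertia J m *v u' = err_force J m k2 k3 (\<xi> s) (\<eta> s) (u s)"
        by (auto simp: err_solution_def)
      from lyapunov_has_derivative[OF assms(5) 1(2,3), of m k2] show ?thesis
        unfolding 1(4) err_dissipation[OF 1(1)] V_def D_def .
    qed
    have "V t * exp (c * (t - t0)) \<le> V t0 * exp (c * (t0 - t0))"
    proof (rule has_real_derivative_nonpos_imp_le[where I = I and f = "\<lambda>s. V s * exp (c * (s - t0))" and f' = "\<lambda>s. (D s + c * V s) * exp (c * (s - t0))"])
      show "t0 \<le> t" "{t0..t} \<subseteq> I" using forward_intervals_props[OF I] t by auto
      fix s assume s: "s \<in> I"
      show "((\<lambda>s. V s * exp (c * (s - t0))) has_real_derivative (D s + c * V s) * exp (c * (s - t0))) (at s within I)"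
        by (rule derivative_eq_intros V s refl)+ (simp add: algebra_simps)
      show "(D s + c * V s) * exp (c * (s - t0)) \<le> 0"
        using c(2)[of "\<eta> s" "u s"] by (intro mult_nonpos_nonneg) (simp_all add: D_def V_def)
    qed
    then have "V t * exp (c * (t - t0)) * exp (- c * (t - t0)) \<le> V t0 * exp (- c * (t - t0))"
      by (intro mult_right_mono) auto
    then show ?thesis by (simp add: V_def mult.assoc exp_add[symmetric])
  qed
  with c show ?thesis by blast
qed

text \<open>The part of the field that is free of \<xi>, with \<open>N\<close> in the place of the
  inverse inertia.\<close>

lemma err_field_lip_bounded:
  "lip_bounded err_domain (\<lambda>x. (G_mat (fst x) *v (snd x - k1 *\<^sub>R fst x),
     N *v (- (transpose (G_mat (gain_K k2 *v fst x)) *v fst x) - k3 *\<^sub>R snd x)))"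
proof -
  have id: "lip_bounded err_domain (\<lambda>x. x)" unfolding err_domain_def by (rule lip_bounded_id) simp
  note \<eta> = lip_bounded_bounded_linear[OF bounded_linear_fst id] and u = lip_bounded_bounded_linear[OF bounded_linear_snd id]
  note \<Theta> = lip_bounded_bounded_linear[OF bounded_linear_fst_block \<eta>]
    and \<beta> = lip_bounded_bounded_linear[OF bounded_linear_snd_block \<eta>]
  have G: "lip_bounded err_domain (\<lambda>x. G_mat (fst x))"
    using G_mat_lip_bounded[OF \<Theta> err_domain_norm \<beta>] by simp
  \<comment> \<open>The gain stretches only the translational block, so the rotation vector keeps
    its bound whatever the size of \<open>k2\<close>.\<close>
  have "lip_bounded err_domain (\<lambda>x. G_mat (join (fst_block (fst x)) (k2 *\<^sub>R snd_block (fst x))))"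
    by (rule G_mat_lip_bounded[OF \<Theta> err_domain_norm lip_bounded_scaleR[OF lip_bounded_const \<beta>]])
  moreover have "join (fst_block \<eta>) (k2 *\<^sub>R snd_block \<eta>) = gain_K k2 *v \<eta>" for \<eta> by (simp add: vec_eq_blocks)
  ultimately have GK: "lip_bounded err_domain (\<lambda>x. G_mat (gain_K k2 *v fst x))" by simp
  note neg = lip_bounded_bounded_linear[OF bounded_linear_minus[OF bounded_linear_ident]]
  show ?thesis
    by (intro lip_bounded_Pair lip_bounded_matrix_vector lip_bounded_diff lip_bounded_scaleR lip_bounded_const
      lip_bounded_transpose neg G GK \<eta> u)
qed

text \<open>The projection onto a convex set does not increase distances. It extends the field from
  the unit ball to the whole space.\<close>

lemma closest_point_lip_bounded: "lip_bounded UNIV (closest_point (cball (0 :: 'a::euclidean_space) 1))"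
proof (rule lip_boundedI[of _ _ 1 1])
  fix x y :: 'a
  have "closest_point (cball 0 1) x \<in> cball (0 :: 'a) 1" by (rule closest_point_in_set) auto
  then show "norm (closest_point (cball 0 1) x) \<le> 1" by simp
  show "dist (closest_point (cball 0 1) x) (closest_point (cball 0 1) y) \<le> 1 * dist x y"
    using closest_point_lipschitz[of "cball (0 :: 'a) 1" x y] by simp
qed simp

text \<open>It is 1 up to norm 1/2 and 0 from norm 1 on, so it vanishes wherever the projection
  differs from the identity, and the extension never shows in the equation.\<close>

definition cutoff :: "'a::real_normed_vector \<Rightarrow> real" where
  "cutoff x = max 0 (min 1 (2 - 2 * norm x))"

lemma cutoff_lip_bounded: "lip_bounded UNIV cutoff"
proof (rule lip_boundedI[of _ _ 1 2])
  fix x y :: 'a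
  show "norm (cutoff x) \<le> 1" by (simp add: cutoff_def)
  show "dist (cutoff x) (cutoff y) \<le> 2 * dist x y"
    using norm_triangle_ineq3[of x y] by (auto simp: cutoff_def dist_norm max_def min_def)
qed simp

lemma inertia_inverse:
  assumes "m > 0" "\<And>v. v \<noteq> 0 \<Longrightarrow> v \<bullet> (J *v v) > 0"
  shows "\<exists>N. \<forall>y. inertia J m *v (N *v y) = y"
proof -
  have "x = 0" if "inertia J m *v x = 0" for x
  proof -
    have "J *v fst_block x = 0" "m *\<^sub>R snd_block x = 0" using that by (metis inertia_mult block_linear(9,10))+
    then show ?thesis using assms(1) assms(2)[of "fst_block x"] by (auto simp: vec_eq_blocks)
  qed
  then obtain N where "N ** inertia J m = mat 1"
    using matrix_left_invertible_ker by blast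
  then have "inertia J m ** N = mat 1" by (simp add: matrix_left_right_inverse)
  then show ?thesis by (intro exI[of _ N]) (simp add: matrix_vector_mul_assoc)
qed

lemma lyapunov_small:
  assumes "\<epsilon> > 0"
  shows "\<exists>\<delta>>0. \<forall>\<eta> u. norm \<eta> < \<delta> \<longrightarrow> norm u < \<delta> \<longrightarrow> lyapunov J m k2 \<eta> u < \<epsilon>"
proof -
  have "continuous_on UNIV (\<lambda>p. lyapunov J m k2 (fst p) (snd p))"
    unfolding lyapunov_def
    by (intro continuous_intros continuous_on_compose2[OF matrix_vector_mult_linear_continuous_on]) auto
  then have "((\<lambda>p. lyapunov J m k2 (fst p) (snd p)) \<longlongrightarrow> lyapunov J m k2 0 0) (at (0, 0))"
    by (auto simp: continuous_on_def)
  then obtain d where d: "d > 0" "\<And>p. dist p (0, 0) < d \<Longrightarrow> p \<noteq> (0,0) \<Longrightarrow> dist (lyapunov J m k2 (fst p) (snd p)) (lyapunov J m k2 0 0) < \<epsilon>"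
    using assms unfolding Lim_at by (metis dist_nz)
  have V0: "lyapunov J m k2 0 0 = 0" by (simp add: lyapunov_def)
  have "lyapunov J m k2 \<eta> u < \<epsilon>" if "norm \<eta> < d / 2" "norm u < d / 2" for \<eta> u
  proof (cases "(\<eta>, u) = (0, 0)")
    case False
    have "dist (\<eta>, u) (0, 0) < d" using norm_Pair_le[of \<eta> u] that by (simp add: dist_norm)
    from d(2)[OF this False] show ?thesis by (simp add: V0 dist_real_def)
  qed (use assms V0 in auto)
  then show ?thesis using d(1) by (intro exI[of _ "d / 2"]) auto
qed

text \<open>The field is multiplied by a cutoff, which keeps the Lyapunov function nonincreasing; hence small
  solutions never reach the region where the cutoff differs from 1.\<close>

lemma err_solution_exists:
  assumes k: "k1 > 0" "k2 > 0" "k3 > 0" and m: "m > 0" and J: "transpose J = J" "\<And>v. v \<noteq> 0 \<Longrightarrow> v \<bullet> (J *v v) > 0"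
    and \<xi>: "continuous_on {t0..} \<xi>"
  shows "\<exists>\<delta>>0. \<forall>\<eta>0 u0. norm \<eta>0 < \<delta> \<longrightarrow> norm u0 < \<delta> \<longrightarrow>
     (\<exists>\<eta> u. \<eta> t0 = \<eta>0 \<and> u t0 = u0 \<and> err_solution J m k1 k2 k3 \<xi> {t0..} \<eta> u)"
proof -
  obtain N where N: "\<And>y. inertia J m *v (N *v y) = y" using inertia_inverse[OF m J(2)] by blast
  obtain a where a: "a > 0" "\<And>\<eta> u. a * ((norm \<eta>)\<^sup>2 + (norm u)\<^sup>2) \<le> lyapunov J m k2 \<eta> u"
    using lyapunov_bounds(1)[OF J(2) m k(2)] by blast
  \<comment> \<open>The level \<open>a / 4 = a (1/2)^2\<close> forces norm below 1/2, where the
    cutoff is 1.\<close>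
  obtain \<delta> where \<delta>: "\<delta> > 0" "\<And>\<eta> u. norm \<eta> < \<delta> \<Longrightarrow> norm u < \<delta> \<Longrightarrow> lyapunov J m k2 \<eta> u < a / 4"
    using lyapunov_small[of "a / 4" J m k2] a by auto
  let ?C = "closest_point (cball (0 :: (real^(3+3)) \<times> (real^(3+3))) 1)"
  define F where "F x = (G_mat (fst x) *v (snd x - k1 *\<^sub>R fst x),
     N *v (- (transpose (G_mat (gain_K k2 *v fst x)) *v fst x) - k3 *\<^sub>R snd x))" for x
  define B where "B x \<zeta> = (0 :: real^(3+3), N *v (ad_star (gain_K k2 *v snd x) *v (inertia J m *v \<zeta>)))" for x :: "(real^(3+3)) \<times> (real^(3+3))" and \<zeta>
  have H0: "lip_bounded UNIV (\<lambda>x. cutoff x *\<^sub>R F (?C x))"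
  proof (intro lip_bounded_scaleR cutoff_lip_bounded lip_bounded_compose[OF _ closest_point_lip_bounded])
    show "lip_bounded err_domain F" unfolding F_def by (rule err_field_lip_bounded)
    show "range ?C \<subseteq> err_domain" unfolding err_domain_def using closest_point_in_set[of "cball 0 1"] by auto
  qed
  have H1: "lip_bounded UNIV (\<lambda>x. cutoff x *\<^sub>R ?C x)"
    by (intro lip_bounded_scaleR cutoff_lip_bounded closest_point_lip_bounded)
  have "bilinear B"
    unfolding bilinear_def B_def
    by (auto intro!: linearI arg_cong[of _ _ "(*v) N"] simp: matrix_vector_right_distrib[symmetric] matrix_vector_mult_scaleR[symmetric])
      (simp_all add: vec_eq_blocks cross_linear matrix_vector_simps algebra_simps)
  then have "bounded_bilinear B" by (simp add: bilinear_conv_bounded_bilinear)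
  note ode = ode_solution_exists[OF H0 H1 this \<xi>]
  have "\<exists>\<eta> u. \<eta> t0 = \<eta>0 \<and> u t0 = u0 \<and> err_solution J m k1 k2 k3 \<xi> {t0..} \<eta> u" if small: "norm \<eta>0 < \<delta>" "norm u0 < \<delta>" for \<eta>0 u0
  proof -
    obtain x where x0: "x t0 = (\<eta>0, u0)" and 
      x: "\<And>t. t \<ge> t0 \<Longrightarrow> (x has_vector_derivative cutoff (x t) *\<^sub>R F (?C (x t)) + B (cutoff (x t) *\<^sub>R ?C (x t)) (\<xi> t)) (at t within {t0..})"
      using ode[of "(\<eta>0, u0)"] by blast
    define \<eta> u where "\<eta> t = fst (x t)" and "u t = snd (x t)" for t
    \<comment> \<open>Inside the unit ball the projection is the identity, and outside the cutoff is
      0. The modified field is thus the true field times a nonnegative scalar everywhere.\<close>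
    have rhs: "cutoff p *\<^sub>R F (?C p) + B (cutoff p *\<^sub>R ?C p) \<zeta> =
       cutoff p *\<^sub>R (G_mat (fst p) *v (snd p - k1 *\<^sub>R fst p), N *v err_force J m k2 k3 \<zeta> (fst p) (snd p))" for p \<zeta>
    proof (cases "norm p < 1")
      case True
      then have C: "?C p = p" by (intro closest_point_self) simp
      have "B (cutoff p *\<^sub>R p) \<zeta> = cutoff p *\<^sub>R B p \<zeta>"
        using \<open>bilinear B\<close> by (simp add: bilinear_lmul)
      then show ?thesis 
        unfolding C by (simp add: F_def B_def err_force_def matrix_vector_mult_diff_distrib matrix_vector_right_distrib 
          matrix_vector_mult_uminus algebra_simps)
    next
      case False
      then have "cutoff p = 0" by (simp add: cutoff_def)
      moreover have "ad_star 0 *v y = 0" for y by (simp add: vec_eq_blocks)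
      ultimately show ?thesis by (simp add: B_def)
    qed
    have \<eta>': "(\<eta> has_vector_derivative cutoff (x t) *\<^sub>R (G_mat (\<eta> t) *v (u t - k1 *\<^sub>R \<eta> t))) (at t within {t0..})"
      and u': "(u has_vector_derivative cutoff (x t) *\<^sub>R (N *v err_force J m k2 k3 (\<xi> t) (\<eta> t) (u t))) (at t within {t0..})"
      if "t0 \<le> t" for t
      using bounded_linear.has_vector_derivative[OF bounded_linear_fst x[OF that]]
        bounded_linear.has_vector_derivative[OF bounded_linear_snd x[OF that]]
      unfolding rhs by (simp_all add: \<eta>_def[abs_def] u_def[abs_def])
    define V where "V t = lyapunov J m k2 (\<eta> t) (u t)" for t
    define V' where "V' t = cutoff (x t) * (- k1 * (\<eta> t \<bullet> (gain_K k2 *v \<eta> t)) - k3 * (u t \<bullet> (gain_K k2 *v u t)))" for t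
    have nb: "norm (fst_block (\<eta> t)) \<le> 1" if "norm (x t) \<le> 1" for t
      using err_domain_norm[of "x t"] that by (simp add: err_domain_def \<eta>_def)
    have V: "(V has_real_derivative V' t) (at t within {t0..})" if t: "t \<in> {t0..}" for t
    proof -
      \<comment> \<open>Where the cutoff is positive, the rotation vector is shorter than pi and the
        dissipation identity applies, scaled by the cutoff.\<close>
      have "V' t = (gain_K k2 *v \<eta> t) \<bullet> (cutoff (x t) *\<^sub>R (G_mat (\<eta> t) *v (u t - k1 *\<^sub>R \<eta> t)))
          + (gain_K k2 *v u t) \<bullet> (inertia J m *v (cutoff (x t) *\<^sub>R (N *v err_force J m k2 k3 (\<xi> t) (\<eta> t) (u t))))"
      proof (cases "norm (x t) < 1")
        case True
        then have "norm (fst_block (\<eta> t)) < pi" using nb[of t] pi_gt3 by simp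
        from err_dissipation[OF this, of k2 "u t" k1 J m k3 "\<xi> t"] show ?thesis 
          by (simp add: V'_def matrix_vector_mult_scaleR N distrib_left[symmetric])
      next
        case False
        then have "cutoff (x t) = 0" by (simp add: cutoff_def)
        then show ?thesis by (simp add: V'_def)
      qed
      then show ?thesis unfolding V_def using lyapunov_has_derivative[OF J(1) \<eta>' u'] t by simp
    qed
    have Vle: "V t \<le> V t0" if "t0 \<le> t" for t
    proof (rule has_real_derivative_nonpos_imp_le[OF that _ V])
      fix s
      have "0 \<le> k1 * (\<eta> s \<bullet> (gain_K k2 *v \<eta> s)) + k3 * (u s \<bullet> (gain_K k2 *v u s))"
        using k lyapunov_bounds(3)[OF J(2) m k(2)] by (intro add_nonneg_nonneg mult_nonneg_nonneg) auto
      then show "V' s \<le> 0" unfolding V'_def by (intro mult_nonneg_nonpos) (simp_all add: cutoff_def)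
    qed auto
    have V0: "V t0 < a / 4" using \<delta>(2)[OF small] by (simp add: V_def \<eta>_def u_def x0)
    have half: "norm (x t) < 1 / 2" if "t0 \<le> t" for t
    proof -
      have "a * (norm (x t))\<^sup>2 = a * ((norm (\<eta> t))\<^sup>2 + (norm (u t))\<^sup>2)"
        by (simp add: \<eta>_def u_def norm_prod_def)
      also have "\<dots> \<le> V t" unfolding V_def by (rule a)
      also have "\<dots> < a * (1/2)\<^sup>2" using Vle[OF that] V0 by (simp add: power2_eq_square)
      finally have "(norm (x t))\<^sup>2 < (1/2)\<^sup>2" using a(1) by simp
      then show ?thesis by (rule power2_less_imp_less) simp
    qed
    then have one: "cutoff (x t) = 1" if "t0 \<le> t" for t using that by (fastforce simp: cutoff_def)
    have "err_solution J m k1 k2 k3 \<xi> {t0..} \<eta> u"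
      unfolding err_solution_def
    proof (intro ballI conjI)
      fix t assume "t \<in> {t0..}"
      then have t: "t0 \<le> t" by simp
      show "norm (fst_block (\<eta> t)) < pi" using nb[of t] half[OF t] pi_gt3 by simp
      show "(\<eta> has_vector_derivative G_mat (\<eta> t) *v (u t - k1 *\<^sub>R \<eta> t)) (at t within {t0..})"
        using \<eta>'[OF t] by (simp add: one[OF t])
      show "\<exists>u'. (u has_vector_derivative u') (at t within {t0..}) \<and> inertia J m *v u' = err_force J m k2 k3 (\<xi> t) (\<eta> t) (u t)"
        using u'[OF t] N by (auto simp: one[OF t])
    qed
    then show ?thesis using x0 by (intro exI[of _ \<eta>] exI[of _ u]) (simp add: \<eta>_def u_def)
  qed
  with \<delta>(1) show ?thesis by blast
qed

section \<open>From observer trajectories to solutions of the error system, and back\<close>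

lemma at_within_atLeast_neq_bot:
  fixes t :: real
  assumes "t0 \<le> t"
  shows "at t within {t0..} \<noteq> bot"
proof -
  have "t + 1 \<in> {t0..}" "t \<in> {t0..}" using assms by auto
  then have "{t0..} \<noteq> {x}" for x by (metis add_cancel_left_right singletonD zero_neq_one)
  then have "t islimpt {t0..}" using assms by (intro connected_imp_perfect) auto
  then show ?thesis by (simp add: trivial_limit_within)
qed

lemma error_trajectory_imp_err_solution:
  assumes body: "rigid_body_motion J m g \<xi> \<phi>" and I: "I \<subseteq> {0..}"
    and traj: "error_trajectory J m k1 k2 k3 g \<xi> \<phi> I x"
  shows "err_solution J m k1 k2 k3 \<xi> I (\<lambda>t. fst (x t)) (\<lambda>t. k1 *\<^sub>R fst (x t) + snd (x t))"
proof -
  obtain gh \<xi>h where sol: "observer_solution J m k1 k2 k3 g \<xi> \<phi> I gh \<xi>h"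
    and x: "\<And>t. t \<in> I \<Longrightarrow> x t = (eta_err (gh t) (g t), xi_err (gh t) (g t) (\<xi>h t) (\<xi> t))"
    using traj by (auto simp: error_trajectory_def)
  define e where "e t = pose_err (gh t) (g t)" for t
  define \<xi>b where "\<xi>b t = xi_breve (gh t) (g t) (\<xi>h t)" for t
  have SE3: "gh s \<in> SE3" "g s \<in> SE3" "e s \<in> SE3" and lt: "principal_angle (rot_part (e s)) < pi" if "s \<in> I" for s
    using that sol body I by (auto simp: observer_solution_def rigid_body_motion_def e_def intro: pose_err_SE3)
  have \<eta>: "fst (x s) = pose_log (e s)" "fst (x s) = exp_coords (e s)" if "s \<in> I" for s
    using x[OF that] exp_coords_pose_log[OF SE3(3)[OF that] lt[OF that]] by (simp_all add: eta_err_def e_def)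
  have \<xi>e: "snd (x s) = \<xi> s - \<xi>b s" if "s \<in> I" for s using x[OF that] by (simp add: xi_err_def \<xi>b_def)
  show ?thesis
    unfolding err_solution_def
  proof (intro ballI conjI)
    fix t assume t: "t \<in> I"
    then have "0 \<le> t" using I by auto
    show "norm (fst_block (fst (x t))) < pi"
      using norm_exp_coords[OF SE3(3)[OF t] lt[OF t]] lt[OF t] by (simp add: \<eta>(2)[OF t])
    have gh': "(gh has_vector_derivative gh t ** hat (\<xi>h t)) (at t within I)"
      using sol t by (simp add: observer_solution_def)
    have "(g has_vector_derivative g t ** hat (\<xi> t)) (at t within {0..})"
      using body \<open>0 \<le> t\<close> by (simp add: rigid_body_motion_def)
    then have g': "(g has_vector_derivative g t ** hat (\<xi> t)) (at t within I)"
      using I by (rule has_vector_derivative_within_subset)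
    have "(e has_vector_derivative e t ** hat (snd (x t))) (at t within I)"
      using pose_err_has_vector_derivative[OF gh' g' t SE3(1,2)] x[OF t] by (simp add: e_def[abs_def])
    then have "((\<lambda>s. pose_log (e s)) has_vector_derivative G_mat (pose_log (e t)) *v snd (x t)) (at t within I)"
      by (rule pose_log_has_vector_derivative[OF _ t SE3(3) lt])
    then have \<eta>': "((\<lambda>t. fst (x t)) has_vector_derivative G_mat (fst (x t)) *v snd (x t)) (at t within I)"
      unfolding \<eta>(1)[OF t] by (rule has_vector_derivative_transform[OF t, rotated]) (rule \<eta>(1))
    then show "((\<lambda>t. fst (x t)) has_vector_derivative G_mat (fst (x t)) *v (k1 *\<^sub>R fst (x t) + snd (x t) - k1 *\<^sub>R fst (x t))) (at t within I)"
      by simp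
    obtain d where d: "(\<xi> has_vector_derivative d) (at t within {0..})" "inertia J m *v d = ad_star (\<xi> t) *v (inertia J m *v \<xi> t) + \<phi> t"
      using body \<open>0 \<le> t\<close> by (auto simp: rigid_body_motion_def)
    obtain db where db: "(\<xi>b has_vector_derivative db) (at t within I)"
      "inertia J m *v db = observer_rhs J m k1 k2 k3 (g t) (\<xi> t) (\<phi> t) (gh t) (\<xi>h t)"
      using sol t by (auto simp: observer_solution_def \<xi>b_def[abs_def])
    let ?u' = "k1 *\<^sub>R (G_mat (fst (x t)) *v (\<xi> t - \<xi>b t)) + (d - db)"
    have "((\<lambda>s. k1 *\<^sub>R fst (x s) + (\<xi> s - \<xi>b s)) has_vector_derivative ?u') (at t within I)"
      using \<eta>' unfolding \<xi>e[OF t]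
      by (intro has_vector_derivative_add has_vector_derivative_diff db(1) has_vector_derivative_within_subset[OF d(1) I]
        bounded_linear.has_vector_derivative[OF bounded_linear_scaleR_right])
    then have u': "((\<lambda>s. k1 *\<^sub>R fst (x s) + snd (x s)) has_vector_derivative ?u') (at t within I)"
      by (rule has_vector_derivative_transform[OF t, rotated]) (simp add: \<xi>e)
    have "inertia J m *v ?u' = err_force J m k2 k3 (\<xi> t) (fst (x t)) (k1 *\<^sub>R fst (x t) + snd (x t))"
      using db(2) x[OF t] \<xi>e[OF t]
      by (subst observer_equation_iff[OF d(2) refl, symmetric]) (simp_all add: observer_rhs_def Let_def \<xi>b_def xi_err_def)
    with u' show "\<exists>u'. ((\<lambda>s. k1 *\<^sub>R fst (x s) + snd (x s)) has_vector_derivative u') (at t within I) \<and>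
        inertia J m *v u' = err_force J m k2 k3 (\<xi> t) (fst (x t)) (k1 *\<^sub>R fst (x t) + snd (x t))" by blast
  qed
qed

text \<open>The error definitions are inverted explicitly: \<open>e = pose_exp \<eta>\<close>, the
  estimate is \<open>g\<close> times the inverse of \<open>e\<close>, and its velocity is
  \<open>Ad e\<close> applied to \<open>\<xi> - \<xi>e\<close>. It supplies the trajectories
  required by attractivity.\<close>

lemma err_solution_imp_error_trajectory:
  assumes body: "rigid_body_motion J m g \<xi> \<phi>" and t0: "0 \<le> t0"
    and sol: "err_solution J m k1 k2 k3 \<xi> {t0..} \<eta> u"
  shows "error_trajectory J m k1 k2 k3 g \<xi> \<phi> {t0..} (\<lambda>t. (\<eta> t, u t - k1 *\<^sub>R \<eta> t))"
proof -
  define e where "e t = pose_exp (\<eta> t)" for t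
  define \<xi>e where "\<xi>e t = u t - k1 *\<^sub>R \<eta> t" for t
  define gh where "gh t = g t ** matrix_inv (e t)" for t
  define \<xi>h where "\<xi>h t = Ad (e t) *v (\<xi> t - \<xi>e t)" for t
  have lt: "norm (fst_block (\<eta> t)) < pi" if "t \<in> {t0..}" for t using sol that by (simp add: err_solution_def)
  have SE3: "g t \<in> SE3" "e t \<in> SE3" "gh t \<in> SE3" if "t \<in> {t0..}" for t
    using body that t0 by (auto simp: rigid_body_motion_def e_def gh_def pose_exp_SE3 intro!: SE3_mult SE3_inv(1))
  have pe: "pose_err (gh t) (g t) = e t" if t: "t \<in> {t0..}" for t
  proof -
    have "(g t ** matrix_inv (e t)) ** (e t ** matrix_inv (g t)) = g t ** (matrix_inv (e t) ** e t) ** matrix_inv (g t)"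
      by (simp add: matrix_mul_assoc)
    also have "\<dots> = mat 1" by (simp add: SE3_inv SE3[OF t])
    finally have "matrix_inv (gh t) = e t ** matrix_inv (g t)" unfolding gh_def by (rule matrix_inv_eqI)
    then have "pose_err (gh t) (g t) = e t ** (matrix_inv (g t) ** g t)" by (simp add: pose_err_def matrix_mul_assoc)
    then show ?thesis by (simp add: SE3_inv SE3[OF t])
  qed
  have ee: "eta_err (gh t) (g t) = \<eta> t" if "t \<in> {t0..}" for t
    using exp_coords_pose_exp[OF lt[OF that]] by (simp add: eta_err_def pe[OF that] e_def)
  have xb: "xi_breve (gh t) (g t) (\<xi>h t) = \<xi> t - \<xi>e t" if "t \<in> {t0..}" for t
    by (simp add: xi_breve_def pe[OF that] \<xi>h_def Ad_inv SE3[OF that])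
  have "observer_solution J m k1 k2 k3 g \<xi> \<phi> {t0..} gh \<xi>h"
    unfolding observer_solution_def
  proof (intro ballI conjI)
    fix t assume t: "t \<in> {t0..}"
    then have "0 \<le> t" using t0 by simp
    have sub: "{t0..} \<subseteq> {0..}" using t0 by simp
    have nt: "at t within {t0..} \<noteq> bot" by (rule at_within_atLeast_neq_bot) (use t in simp)
    show "gh t \<in> SE3" using SE3 t by blast
    show "principal_angle (rot_part (pose_err (gh t) (g t))) < pi"
      using principal_angle_pose_exp[OF lt[OF t]] by (simp add: pe[OF t] e_def)
    have \<eta>': "(\<eta> has_vector_derivative G_mat (\<eta> t) *v \<xi>e t) (at t within {t0..})"
      using sol t by (simp add: err_solution_def \<xi>e_def)
    have e': "(e has_vector_derivative e t ** hat (\<xi>e t)) (at t within {t0..})"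
      using pose_exp_has_vector_derivative[OF \<eta>' t lt nt] by (simp add: e_def[abs_def])
    have "(g has_vector_derivative g t ** hat (\<xi> t)) (at t within {0..})"
      using body \<open>0 \<le> t\<close> by (simp add: rigid_body_motion_def)
    then have g': "(g has_vector_derivative g t ** hat (\<xi> t)) (at t within {t0..})"
      using sub by (rule has_vector_derivative_within_subset)
    show "(gh has_vector_derivative gh t ** hat (\<xi>h t)) (at t within {t0..})"
      using reconstructed_pose_has_vector_derivative[OF e' g' t SE3(2)] by (simp add: gh_def[abs_def] \<xi>h_def)
    obtain d where d: "(\<xi> has_vector_derivative d) (at t within {0..})" "inertia J m *v d = ad_star (\<xi> t) *v (inertia J m *v \<xi> t) + \<phi> t"
      using body \<open>0 \<le> t\<close> by (auto simp: rigid_body_motion_def)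
    obtain u' where u': "(u has_vector_derivative u') (at t within {t0..})" "inertia J m *v u' = err_force J m k2 k3 (\<xi> t) (\<eta> t) (u t)"
      using sol t by (auto simp: err_solution_def)
    \<comment> \<open>The derivative forced by
      \<open>xi_breve = \<xi> - (u - k1 \<eta>)\<close>.\<close>
    define db where "db = d - (u' - k1 *\<^sub>R (G_mat (\<eta> t) *v \<xi>e t))"
    have "((\<lambda>s. \<xi> s - (u s - k1 *\<^sub>R \<eta> s)) has_vector_derivative db) (at t within {t0..})"
      unfolding db_def
      by (intro has_vector_derivative_diff has_vector_derivative_within_subset[OF d(1) sub] u'(1) \<eta>'
        bounded_linear.has_vector_derivative[OF bounded_linear_scaleR_right])
    then have 1: "((\<lambda>s. xi_breve (gh s) (g s) (\<xi>h s)) has_vector_derivative db) (at t within {t0..})"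
      by (rule has_vector_derivative_transform[OF t, rotated]) (simp add: xb \<xi>e_def)
    have xe: "xi_err (gh t) (g t) (\<xi>h t) (\<xi> t) = \<xi>e t" by (simp add: xi_err_def xb[OF t])
    have "u' = k1 *\<^sub>R (G_mat (\<eta> t) *v (\<xi> t - (\<xi> t - \<xi>e t))) + (d - db)" by (simp add: db_def)
    moreover have u: "u t = k1 *\<^sub>R \<eta> t + (\<xi> t - (\<xi> t - \<xi>e t))" by (simp add: \<xi>e_def)
    ultimately have "inertia J m *v db = observer_rhs J m k1 k2 k3 (g t) (\<xi> t) (\<phi> t) (gh t) (\<xi>h t)"
      using observer_equation_iff[OF d(2), of u' k1 "\<eta> t" "\<xi> t - \<xi>e t" db "u t" k2 k3] u'(2)
      by (simp add: observer_rhs_def Let_def xb[OF t] xe ee[OF t])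
    with 1 show "\<exists>d. ((\<lambda>s. xi_breve (gh s) (g s) (\<xi>h s)) has_vector_derivative d) (at t within {t0..}) \<and>
       inertia J m *v d = observer_rhs J m k1 k2 k3 (g t) (\<xi> t) (\<phi> t) (gh t) (\<xi>h t)" by blast
  qed
  moreover have "(\<eta> t, u t - k1 *\<^sub>R \<eta> t) = (eta_err (gh t) (g t), xi_err (gh t) (g t) (\<xi>h t) (\<xi> t))" if "t \<in> {t0..}" for t
    using ee[OF that] xb[OF that] by (simp add: xi_err_def \<xi>e_def)
  ultimately show ?thesis unfolding error_trajectory_def by blast
qed

text \<open>With \<open>r = sqrt (v / a)\<close> both \<eta> and \<open>u\<close> have norm at most
  \<open>r\<close>, hence \<zeta> = u - k1 \<eta> at most \<open>(1 + k1) r\<close>; the pair adds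
  up to \<open>(2 + k1) r\<close>.\<close>

lemma norm_error_le:
  fixes k1 :: real
  assumes "k1 > 0" "a > 0" "a * ((norm \<eta>)\<^sup>2 + (norm (k1 *\<^sub>R \<eta> + \<zeta>))\<^sup>2) \<le> v"
  shows "norm (\<eta>, \<zeta>) \<le> (2 + k1) * sqrt (v / a)"
proof -
  have v: "(norm \<eta>)\<^sup>2 + (norm (k1 *\<^sub>R \<eta> + \<zeta>))\<^sup>2 \<le> v / a" using assms by (simp add: pos_le_divide_eq mult.commute)
  have 1: "norm \<eta> \<le> sqrt (v / a)" by (rule real_le_rsqrt) (use v zero_le_power2[of "norm (k1 *\<^sub>R \<eta> + \<zeta>)"] in linarith)
  have 2: "norm (k1 *\<^sub>R \<eta> + \<zeta>) \<le> sqrt (v / a)" by (rule real_le_rsqrt) (use v zero_le_power2[of "norm \<eta>"] in linarith)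
  have "norm \<zeta> = norm ((k1 *\<^sub>R \<eta> + \<zeta>) - k1 *\<^sub>R \<eta>)" by simp
  also have "\<dots> \<le> norm (k1 *\<^sub>R \<eta> + \<zeta>) + k1 * norm \<eta>" using norm_triangle_ineq4[of "k1 *\<^sub>R \<eta> + \<zeta>" "k1 *\<^sub>R \<eta>"] assms(1) by simp
  also have "\<dots> \<le> sqrt (v / a) + k1 * sqrt (v / a)" using 1 2 assms(1) by (intro add_mono mult_left_mono) auto
  finally show ?thesis using norm_Pair_le[of \<eta> \<zeta>] 1 by (simp add: algebra_simps)
qed

theorem mainTheorem2:
  fixes k1 k2 k3 m :: real
    and J :: "real^3^3"
    and g :: "real \<Rightarrow> real^(3 + 1)^(3 + 1)"
    and \<xi> \<phi> :: "real \<Rightarrow> real^(3 + 3)"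
  assumes "k1 > 0" and "k2 > 0" and "k3 > 0"
    and "m > 0"
    and "transpose J = J" and "\<And>v. v \<noteq> 0 \<Longrightarrow> v \<bullet> (J *v v) > 0"
    and "rigid_body_motion J m g \<xi> \<phi>"
  shows "lyapunov_asymptotically_stable (error_trajectory J m k1 k2 k3 g \<xi> \<phi>) (0, 0)"
proof -
  let ?traj = "error_trajectory J m k1 k2 k3 g \<xi> \<phi>"
  define V where "V p = lyapunov J m k2 (fst p) (k1 *\<^sub>R fst p + snd p)" for p
  obtain a where a: "a > 0" "\<And>\<eta> u. a * ((norm \<eta>)\<^sup>2 + (norm u)\<^sup>2) \<le> lyapunov J m k2 \<eta> u"
    using lyapunov_bounds(1)[OF assms(6,4,2)] by blast
  obtain c where c: "c > 0" "\<And>\<xi> t0 I \<eta> u t. I \<in> forward_intervals t0 \<Longrightarrow> err_solution J m k1 k2 k3 \<xi> I \<eta> u \<Longrightarrow> t \<in> I \<Longrightarrow>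
     lyapunov J m k2 (\<eta> t) (u t) \<le> lyapunov J m k2 (\<eta> t0) (u t0) * exp (- c * (t - t0))"
    using lyapunov_decay[OF assms(1-6)] by blast
  have Vnn: "0 \<le> V p" for p
    using a(2)[of "fst p" "k1 *\<^sub>R fst p + snd p"] a(1) unfolding V_def
    by (meson add_nonneg_nonneg less_imp_le mult_nonneg_nonneg order_trans zero_le_power2)
  \<comment> \<open>One estimate for all admissible intervals, bounded ones included; stability and
    convergence both follow from it.\<close>
  have bound: "dist (x t) (0, 0) \<le> (2 + k1) * sqrt (V (x t0) * exp (- c * (t - t0)) / a)"
    if "0 \<le> t0" "I \<in> forward_intervals t0" "?traj I x" "t \<in> I" for I x t0 t
  proof -
    have "I \<subseteq> {0..}" using forward_intervals_props(2)[OF that(2)] that(1) by auto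
    from c(2)[OF that(2) error_trajectory_imp_err_solution[OF assms(7) this that(3)] that(4)]
    have "V (x t) \<le> V (x t0) * exp (- c * (t - t0))" by (simp add: V_def)
    with a(2) have "a * ((norm (fst (x t)))\<^sup>2 + (norm (k1 *\<^sub>R fst (x t) + snd (x t)))\<^sup>2) \<le> V (x t0) * exp (- c * (t - t0))"
      unfolding V_def by (rule order_trans)
    from norm_error_le[OF assms(1) a(1) this] show ?thesis by (simp add: dist_norm zero_prod_def[symmetric])
  qed
  \<comment> \<open>Passing from the pair of errors to \<open>(\<eta>, u)\<close> enlarges norms by
    at most \<open>1 + k1\<close>.\<close>
  have small: "\<exists>\<delta>>0. \<forall>p::(real^(3+3)) \<times> (real^(3+3)). dist p (0, 0) < \<delta> \<longrightarrow> norm (fst p) < d \<and> norm (k1 *\<^sub>R fst p + snd p) < d" if "d > 0" for d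
  proof (intro exI[of _ "d / (1 + k1)"] conjI allI impI)
    show "0 < d / (1 + k1)" using that assms(1) by simp
    fix p :: "(real^(3+3)) \<times> (real^(3+3))" assume "dist p (0, 0) < d / (1 + k1)"
    then have p: "norm p * (1 + k1) < d" using assms(1) by (simp add: dist_norm zero_prod_def[symmetric] pos_less_divide_eq)
    have f: "norm (fst p) \<le> norm p" and s: "norm (snd p) \<le> norm p"
      using norm_fst_le[of "fst p" "snd p"] norm_snd_le[of "snd p" "fst p"] by simp_all
    have "norm p * 1 \<le> norm p * (1 + k1)" using assms(1) by (intro mult_left_mono) auto
    then show "norm (fst p) < d" using f p by simp
    have "norm (k1 *\<^sub>R fst p + snd p) \<le> k1 * norm (fst p) + norm (snd p)"
      using norm_triangle_ineq[of "k1 *\<^sub>R fst p" "snd p"] assms(1) by simp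
    also have "\<dots> \<le> k1 * norm p + norm p" using f s assms(1) by (intro add_mono mult_left_mono) auto
    finally show "norm (k1 *\<^sub>R fst p + snd p) < d" using p by (simp add: algebra_simps)
  qed
  have "lyapunov_stable ?traj (0, 0)"
    unfolding lyapunov_stable_def
  proof (intro allI impI)
    fix t0 \<epsilon> :: real assume t0: "0 \<le> t0" and \<epsilon>: "0 < \<epsilon>"
    \<comment> \<open>The level of \<open>V\<close> for which the estimate \<open>bound\<close>
      yields exactly \<epsilon>.\<close>
    have "0 < a * (\<epsilon> / (2 + k1))\<^sup>2" using a(1) \<epsilon> assms(1) by simp
    from lyapunov_small[OF this, of J m k2] obtain d where d: "d > 0" 
      "\<And>\<eta> u. norm \<eta> < d \<Longrightarrow> norm u < d \<Longrightarrow> lyapunov J m k2 \<eta> u < a * (\<epsilon> / (2 + k1))\<^sup>2" by blast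
    obtain \<delta> where \<delta>: "\<delta> > 0" "\<And>p::(real^(3+3)) \<times> (real^(3+3)). dist p (0, 0) < \<delta> \<Longrightarrow> norm (fst p) < d \<and> norm (k1 *\<^sub>R fst p + snd p) < d"
      using small[OF d(1)] by blast
    have "dist (x t) (0, 0) < \<epsilon>" if "I \<in> forward_intervals t0" "?traj I x" "dist (x t0) (0, 0) < \<delta>" "t \<in> I" for I x t
    proof -
      have "t0 \<le> t" using forward_intervals_props(2)[OF that(1)] that(4) by auto
      then have "V (x t0) * exp (- c * (t - t0)) \<le> V (x t0) * 1" using c(1) Vnn by (intro mult_left_mono) auto
      also have "\<dots> < a * (\<epsilon> / (2 + k1))\<^sup>2" using d(2) \<delta>(2)[OF that(3)] by (simp add: V_def)
      finally have "V (x t0) * exp (- c * (t - t0)) / a < (\<epsilon> / (2 + k1))\<^sup>2" using a(1) by (simp add: pos_divide_less_eq mult.commute)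
      then have "sqrt (V (x t0) * exp (- c * (t - t0)) / a) < \<epsilon> / (2 + k1)"
        using \<epsilon> assms(1) by (intro real_less_lsqrt) auto
      then have "(2 + k1) * sqrt (V (x t0) * exp (- c * (t - t0)) / a) < \<epsilon>"
        using assms(1) by (simp add: pos_less_divide_eq mult.commute)
      then show ?thesis using bound[OF t0 that(1,2,4)] by linarith
    qed
    then show "\<exists>\<delta>>0. \<forall>I\<in>forward_intervals t0. \<forall>x. ?traj I x \<and> dist (x t0) (0, 0) < \<delta> \<longrightarrow> (\<forall>t\<in>I. dist (x t) (0, 0) < \<epsilon>)"
      using \<delta>(1) by blast
  qed
  moreover have "attractive ?traj (0, 0)"
    unfolding attractive_def
  proof (intro allI impI)
    fix t0 :: real assume t0: "0 \<le> t0"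
    have "continuous (at t within {0..}) \<xi>" if "t \<in> {0..}" for t
    proof -
      obtain d where "(\<xi> has_vector_derivative d) (at t within {0..})"
        using assms(7) \<open>t \<in> {0..}\<close> by (auto simp: rigid_body_motion_def)
      then show ?thesis by (rule has_vector_derivative_continuous)
    qed
    then have "continuous_on {0..} \<xi>" by (simp add: continuous_on_eq_continuous_within)
    then have "continuous_on {t0..} \<xi>" by (rule continuous_on_subset) (use t0 in auto)
    from err_solution_exists[OF assms(1-6) this] obtain d where d: "d > 0"
      "\<And>\<eta>0 u0. norm \<eta>0 < d \<Longrightarrow> norm u0 < d \<Longrightarrow> \<exists>\<eta> u. \<eta> t0 = \<eta>0 \<and> u t0 = u0 \<and> err_solution J m k1 k2 k3 \<xi> {t0..} \<eta> u" by blast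
    obtain \<delta> where \<delta>: "\<delta> > 0" "\<And>p::(real^(3+3)) \<times> (real^(3+3)). dist p (0, 0) < \<delta> \<Longrightarrow> norm (fst p) < d \<and> norm (k1 *\<^sub>R fst p + snd p) < d"
      using small[OF d(1)] by blast
    have ex: "\<exists>x. ?traj {t0..} x \<and> x t0 = x0" if x0: "dist x0 (0, 0) < \<delta>" for x0
    proof -
      obtain \<eta> u where "\<eta> t0 = fst x0" "u t0 = k1 *\<^sub>R fst x0 + snd x0" "err_solution J m k1 k2 k3 \<xi> {t0..} \<eta> u"
        using d(2) \<delta>(2)[OF x0] by blast
      with err_solution_imp_error_trajectory[OF assms(7) t0 this(3)] show ?thesis
        by (intro exI[of _ "\<lambda>t. (\<eta> t, u t - k1 *\<^sub>R \<eta> t)"]) simp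
    qed
    have lim: "(x \<longlongrightarrow> (0, 0)) at_top" if x: "?traj {t0..} x" for x
    proof -
      have "((\<lambda>t. exp (- c * (t - t0))) \<longlongrightarrow> 0) at_top" using c(1) by real_asymp
      then have "((\<lambda>t. (2 + k1) * sqrt (V (x t0) * exp (- c * (t - t0)) / a)) \<longlongrightarrow> (2 + k1) * sqrt (V (x t0) * 0 / a)) at_top"
        by (intro tendsto_intros) (use a(1) in auto)
      then have *: "((\<lambda>t. (2 + k1) * sqrt (V (x t0) * exp (- c * (t - t0)) / a)) \<longlongrightarrow> 0) at_top" by simp
      have "{t0..} \<in> forward_intervals t0" by (simp add: forward_intervals_def)
      from bound[OF t0 this x] have "\<forall>\<^sub>F t in at_top. dist (x t) (0, 0) \<le> (2 + k1) * sqrt (V (x t0) * exp (- c * (t - t0)) / a)"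
        by (intro eventually_mono[OF eventually_ge_at_top[of t0]]) simp
      then have "((\<lambda>t. dist (x t) (0, 0)) \<longlongrightarrow> 0) at_top"
        by (intro tendsto_sandwich[OF _ _ tendsto_const *]) auto
      then show ?thesis by (rule tendsto_dist_iff[THEN iffD2])
    qed
    show "\<exists>\<delta>>0. (\<forall>x0. dist x0 (0, 0) < \<delta> \<longrightarrow> (\<exists>x. ?traj {t0..} x \<and> x t0 = x0)) \<and>
        (\<forall>x. ?traj {t0..} x \<and> dist (x t0) (0, 0) < \<delta> \<longrightarrow> (x \<longlongrightarrow> (0, 0)) at_top)"
      using \<delta>(1) ex lim by blast
  qed
  ultimately show ?thesis by (simp add: lyapunov_asymptotically_stable_def)
qed

end
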